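(* Let $(X,\rho)$ be a metric space with two doubling measures $\mu,\nu$ that satisfy the $A_\infty$ relation. Suppose further that $(X,\rho,\nu)$ is Ahlfors $d$-regular for some $d\in(1,\infty)$ and supports the $q$-Poincaré inequality for some $q\in[1,d)$. Let $T$ be a strongly non-degenerate $\mu$-singular integral (with kernel $K$) and $b\in L^1_{\mathrm{loc}}(\mu)$. Suppose that either (1) $T$ is bounded on $L^2(\mu)$ and its kernel is Hölder $\eta$-regular with some $\eta>\max(1-\frac d2,0)$, or (2) $\mu=\nu$ and $d>2$. If $$\lim_{n\to\infty}n^{\frac1d}a_n([T,b];L^2(\mu))=0,$$ or more generally if $$\limsup_{n\to\infty}n^{\frac1d}a_n([T,b];L^2(\mu))<\infty\quad\text{and}\quad\liminf_{n\to\infty}n^{\frac1d}a_n([T,b];L^2(\mu))=0,$$ then $b$ is equal to a constant almost everywhere.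
   Context: Notation: $A\lesssim B$ means $A\le CB$ with a constant $C$ independent of the variable quantities; $A\sim B$ means $A\lesssim B\lesssim A$. $\fint_B f\,d\nu=\nu(B)^{-1}\int_B f\,d\nu$. Spaces. A measure $\mu$ on $(X,\rho)$ is doubling if all balls $B(x,r)$ have finite positive measure and $\mu(B(x,2r))\lesssim\mu(B(x,r))$. Two doubling measures $\mu,\nu$ satisfy the $A_\infty$ relation if there are $\varepsilon,\delta>0$ such that for all balls $B$ and measurable $E\subset B$: $\mu(E)\le\varepsilon\mu(B)\Rightarrow\nu(E)\le(1-\delta)\nu(B)$ (this implies mutual absolute continuity). $(X,\rho,\nu)$ is Ahlfors $d$-regular if $\nu(B(x,r))\sim r^d$ for all $x\in X$, $r>0$. It supports the $q$-Poincaré inequality if there is $\lambda\in[1,\infty)$ such that for all Lipschitz $f$ and all balls, $\inf_{c\in\mathbb C}\fint_{B(x,r)}|f-c|\,d\nu\lesssim r\big(\fint_{B(x,\lambda r)}(\operatorname{lip}f)^q\,d\nu\big)^{1/q}$, where $\operatorname{lip}f(y)=\liminf_{t\to0}\sup_{z\in B(y,t)}|f(y)-f(z)|/t$. $L^1_{\mathrm{loc}}(\mu)$ consists of the functions integrable over every ball. Kernels. Let $V(x,y):=\mu(B(x,\rho(x,y)))$. A (measurable) function $K$ on $\{(x,y)\in X\times X:x\ne y\}$ is a $\mu$-singular kernel if $|K(x,y)|\lesssim 1/V(x,y)$. It is Hölder $\eta$-regular if $|K(x,y)-K(x',y)|+|K(y,x)-K(y,x')|\lesssim\frac{1}{V(x,y)}\big(\frac{\rho(x,x')}{\rho(x,y)}\big)^\eta$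 whenever $\rho(x,x')\le c_1\rho(x,y)$, for some fixed small $c_1\in(0,1)$. It is strongly non-degenerate if there is $\alpha>0$ such that for every $x_0\in X$ and $r>0$ there exist $y_0\in X$ with $\rho(x_0,y_0)\sim r$ and $v\in\mathbb C$ with $|v|=1$ such that $|K(x,y)|\gtrsim 1/V(x,y)$ and $|\arg(\bar vK(x,y))|\le\pi/9$, either for all $(x,y)\in B(x_0,\alpha r)\times B(y_0,\alpha r)$, or for all $(x,y)$ with $(y,x)\in B(x_0,\alpha r)\times B(y_0,\alpha r)$ (constants uniform in $x_0,r$). A $\mu$-singular integral $T$ with $\mu$-singular kernel $K$ is a linear operator with $Tf(x)=\int_XK(x,y)f(y)\,d\mu(y)$ for $x\notin\operatorname{supp}f$; adjectives for $T$ refer to $K$. Commutator. $[T,b]f=T(bf)-bTf$, the operator with kernel $K(x,y)(b(y)-b(x))$: a bounded operator $R$ on $L^2(\mu)$ realises $[T,b]$ if $\int (Rf)g\,d\mu=\iint K(x,y)(b(y)-b(x))f(y)g(x)\,d\mu(y)\,d\mu(x)$ for all bounded $f,g$ with bounded supports at positive distance from each other. In the present setting a compact $R$ realising $[T,b]$ is unique, and then $[T,b]$ is identified with $R$. The hypotheses on $a_n([T,b])$ mean that $[T,b]$ is realised by a bounded operator $R$ whose approximation numbers $a_n(R)$ satisfy the stated conditions ($R$ is then compact). Approximation numbers. For a bounded operator $R$ on a Hilbert space $\mathcal H$, $a_n(R)=a_n(R;\mathcal H)=\inf\{\|R-F\|:\operatorname{rank}F<n\}$. *)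

theory Defs
  imports "HOL-Analysis.Analysis"
begin

section \<open>Metric measure spaces\<close>

definition doubling_measure :: "'a::metric_space measure \<Rightarrow> bool" where
  "doubling_measure \<mu> \<longleftrightarrow>
     sets \<mu> = sets borel \<and>
     (\<forall>x r. r > 0 \<longrightarrow> 0 < emeasure \<mu> (ball x r) \<and> emeasure \<mu> (ball x r) < \<infinity>) \<and>
     (\<exists>C. \<forall>x r. r > 0 \<longrightarrow> measure \<mu> (ball x (2 * r)) \<le> C * measure \<mu> (ball x r))"

definition A_infinity :: "'a::metric_space measure \<Rightarrow> 'a measure \<Rightarrow> bool" where
  "A_infinity \<mu> \<nu> \<longleftrightarrow>
     (\<exists>\<epsilon>>0. \<exists>\<delta>>0. \<forall>x r E. r > 0 \<longrightarrow> E \<in> sets borel \<longrightarrow> E \<subseteq> ball x r \<longrightarrow>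
        measure \<mu> E \<le> \<epsilon> * measure \<mu> (ball x r) \<longrightarrow>
        measure \<nu> E \<le> (1 - \<delta>) * measure \<nu> (ball x r))"

definition ahlfors_regular :: "real \<Rightarrow> 'a::metric_space measure \<Rightarrow> bool" where
  "ahlfors_regular d \<nu> \<longleftrightarrow>
     (\<exists>c>0. \<exists>C. \<forall>x r. r > 0 \<longrightarrow>
        c * r powr d \<le> measure \<nu> (ball x r) \<and> measure \<nu> (ball x r) \<le> C * r powr d)"

definition average :: "'a measure \<Rightarrow> 'a set \<Rightarrow> ('a \<Rightarrow> real) \<Rightarrow> real" where
  "average \<nu> B f = (LINT x:B|\<nu>. f x) / measure \<nu> B"

text \<open>The lower limit is formed in the extended reals; for Lipschitz functions it is finite, so
  that the conversion to a real number loses nothing.\<close>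

definition lower_lip :: "('a::metric_space \<Rightarrow> complex) \<Rightarrow> 'a \<Rightarrow> real" where
  "lower_lip f y =
     real_of_ereal (Liminf (at_right 0) (\<lambda>t. SUP z\<in>ball y t. ereal (cmod (f y - f z) / t)))"

definition poincare_inequality :: "real \<Rightarrow> 'a::metric_space measure \<Rightarrow> bool" where
  "poincare_inequality q \<nu> \<longleftrightarrow>
     (\<exists>\<Lambda>\<ge>1. \<exists>C. \<forall>f :: 'a \<Rightarrow> complex. (\<exists>L. L-lipschitz_on UNIV f) \<longrightarrow>
        (\<forall>x r. r > 0 \<longrightarrow>
          (INF c. average \<nu> (ball x r) (\<lambda>y. cmod (f y - c)))
            \<le> C * r * average \<nu> (ball x (\<Lambda> * r)) (\<lambda>y. lower_lip f y powr q) powr (1 / q)))"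

definition locally_integrable :: "'a::metric_space measure \<Rightarrow> ('a \<Rightarrow> complex) \<Rightarrow> bool" where
  "locally_integrable \<mu> b \<longleftrightarrow> (\<forall>x r. set_integrable \<mu> (ball x r) b)"


section \<open>Kernels\<close>

text \<open>A kernel is a function on pairs of distinct points. It is represented by a total function
  whose values on the diagonal are never constrained.\<close>

definition V :: "'a::metric_space measure \<Rightarrow> 'a \<Rightarrow> 'a \<Rightarrow> real" where
  "V \<mu> x y = measure \<mu> (ball x (dist x y))"

definition singular_kernel ::
    "'a::metric_space measure \<Rightarrow> ('a \<Rightarrow> 'a \<Rightarrow> complex) \<Rightarrow> bool" where
  "singular_kernel \<mu> K \<longleftrightarrow>
     (\<lambda>(x, y). K x y) \<in> borel_measurable (restrict_space (\<mu> \<Otimes>\<^sub>M \<mu>) {(x, y). x \<noteq> y}) \<and>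
     (\<exists>C. \<forall>x y. x \<noteq> y \<longrightarrow> cmod (K x y) \<le> C / V \<mu> x y)"

definition hoelder_regular ::
    "real \<Rightarrow> 'a::metric_space measure \<Rightarrow> ('a \<Rightarrow> 'a \<Rightarrow> complex) \<Rightarrow> bool" where
  "hoelder_regular \<eta> \<mu> K \<longleftrightarrow>
     (\<exists>c\<^sub>1\<in>{0<..<1}. \<exists>C. \<forall>x x' y. x \<noteq> y \<longrightarrow> dist x x' \<le> c\<^sub>1 * dist x y \<longrightarrow>
        cmod (K x y - K x' y) + cmod (K y x - K y x')
          \<le> C / V \<mu> x y * (dist x x' / dist x y) powr \<eta>)"

definition strongly_nondegenerate ::
    "'a::metric_space measure \<Rightarrow> ('a \<Rightarrow> 'a \<Rightarrow> complex) \<Rightarrow> bool" where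
  "strongly_nondegenerate \<mu> K \<longleftrightarrow>
     (\<exists>\<alpha>>0. \<exists>c>0. \<exists>c\<^sub>0>0. \<exists>C\<^sub>0. \<forall>x\<^sub>0 r. r > 0 \<longrightarrow>
        (\<exists>y\<^sub>0 v. c\<^sub>0 * r \<le> dist x\<^sub>0 y\<^sub>0 \<and> dist x\<^sub>0 y\<^sub>0 \<le> C\<^sub>0 * r \<and> cmod v = 1 \<and>
           ((\<forall>x y. x \<noteq> y \<and> (x, y) \<in> ball x\<^sub>0 (\<alpha> * r) \<times> ball y\<^sub>0 (\<alpha> * r) \<longrightarrow>
               cmod (K x y) \<ge> c / V \<mu> x y \<and> \<bar>Arg (cnj v * K x y)\<bar> \<le> pi / 9) \<or>
            (\<forall>x y. x \<noteq> y \<and> (y, x) \<in> ball x\<^sub>0 (\<alpha> * r) \<times> ball y\<^sub>0 (\<alpha> * r) \<longrightarrow>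
               cmod (K x y) \<ge> c / V \<mu> x y \<and> \<bar>Arg (cnj v * K x y)\<bar> \<le> pi / 9))))"


section \<open>Operators on functions modulo null sets\<close>

text \<open>Elements of function spaces such as \<open>L\<^sup>2(\<mu>)\<close> are represented by functions, and the identities
  that make an operator linear are required almost everywhere. Accordingly, the support of \<open>f\<close> is
  the complement of the largest open set on which \<open>f\<close> vanishes almost everywhere.\<close>

definition ess_support :: "'a::metric_space measure \<Rightarrow> ('a \<Rightarrow> complex) \<Rightarrow> 'a set" where
  "ess_support \<mu> f = {x. \<forall>r>0. \<not> (AE y in \<mu>. y \<in> ball x r \<longrightarrow> f y = 0)}"

definition bounded_bounded_support :: "'a::metric_space measure \<Rightarrow> ('a \<Rightarrow> complex) set" where
  "bounded_bounded_support \<mu> =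
     {f \<in> borel_measurable \<mu>. bounded (range f) \<and> bounded (ess_support \<mu> f)}"

definition linear_AE ::
    "'a measure \<Rightarrow> ('a \<Rightarrow> complex) set \<Rightarrow> (('a \<Rightarrow> complex) \<Rightarrow> 'a \<Rightarrow> complex) \<Rightarrow> bool" where
  "linear_AE \<mu> D T \<longleftrightarrow>
     (\<forall>f\<in>D. \<forall>g\<in>D. (\<lambda>x. f x + g x) \<in> D \<and>
        (AE x in \<mu>. T (\<lambda>x. f x + g x) x = T f x + T g x)) \<and>
     (\<forall>f\<in>D. \<forall>c. (\<lambda>x. c * f x) \<in> D \<and> (AE x in \<mu>. T (\<lambda>x. c * f x) x = c * T f x))"

definition L2 :: "'a measure \<Rightarrow> ('a \<Rightarrow> complex) set" where
  "L2 \<mu> = {f \<in> borel_measurable \<mu>. integrable \<mu> (\<lambda>x. (cmod (f x))\<^sup>2)}"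

definition L2_norm :: "'a measure \<Rightarrow> ('a \<Rightarrow> complex) \<Rightarrow> real" where
  "L2_norm \<mu> f = sqrt (LINT x|\<mu>. (cmod (f x))\<^sup>2)"

text \<open>\<open>T\<close> is a linear operator on a space \<open>D\<close> of measurable functions with kernel \<open>K\<close>. The space
  \<open>D\<close> can be anything between the bounded functions with bounded support and a space on which the
  defining integral makes sense off the support, for instance \<open>L\<^sup>2(\<mu>)\<close>.\<close>

definition singular_integral ::
    "'a::metric_space measure \<Rightarrow> ('a \<Rightarrow> complex) set \<Rightarrow> (('a \<Rightarrow> complex) \<Rightarrow> 'a \<Rightarrow> complex)
      \<Rightarrow> ('a \<Rightarrow> 'a \<Rightarrow> complex) \<Rightarrow> bool" where
  "singular_integral \<mu> D T K \<longleftrightarrow>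
     singular_kernel \<mu> K \<and>
     bounded_bounded_support \<mu> \<subseteq> D \<and> D \<subseteq> borel_measurable \<mu> \<and>
     linear_AE \<mu> D T \<and>
     (\<forall>f\<in>D. AE x in \<mu>. x \<notin> ess_support \<mu> f \<longrightarrow>
        has_bochner_integral \<mu> (\<lambda>y. K x y * f y) (T f x))"

definition bounded_on_L2 ::
    "'a measure \<Rightarrow> ('a \<Rightarrow> complex) set \<Rightarrow> (('a \<Rightarrow> complex) \<Rightarrow> 'a \<Rightarrow> complex) \<Rightarrow> bool" where
  "bounded_on_L2 \<mu> D T \<longleftrightarrow>
     (\<exists>C. \<forall>f \<in> D \<inter> L2 \<mu>. T f \<in> L2 \<mu> \<and> L2_norm \<mu> (T f) \<le> C * L2_norm \<mu> f)"


section \<open>Approximation numbers and commutators\<close>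

definition L2_bounded_operator ::
    "'a measure \<Rightarrow> (('a \<Rightarrow> complex) \<Rightarrow> 'a \<Rightarrow> complex) \<Rightarrow> bool" where
  "L2_bounded_operator \<mu> R \<longleftrightarrow> linear_AE \<mu> (L2 \<mu>) R \<and> bounded_on_L2 \<mu> (L2 \<mu>) R"

definition L2_onorm :: "'a measure \<Rightarrow> (('a \<Rightarrow> complex) \<Rightarrow> 'a \<Rightarrow> complex) \<Rightarrow> real" where
  "L2_onorm \<mu> R = (SUP f\<in>{f \<in> L2 \<mu>. L2_norm \<mu> f \<le> 1}. L2_norm \<mu> (R f))"

text \<open>The range of \<open>F\<close>, modulo null sets, is spanned by fewer than \<open>n\<close> of its elements.\<close>

definition L2_rank_less ::
    "'a measure \<Rightarrow> nat \<Rightarrow> (('a \<Rightarrow> complex) \<Rightarrow> 'a \<Rightarrow> complex) \<Rightarrow> bool" where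
  "L2_rank_less \<mu> n F \<longleftrightarrow>
     (\<exists>B. finite B \<and> card B < n \<and> B \<subseteq> L2 \<mu> \<and>
        (\<forall>f\<in>L2 \<mu>. \<exists>c. AE x in \<mu>. F f x = (\<Sum>h\<in>B. c h * F h x)))"

definition approximation_number ::
    "'a measure \<Rightarrow> (('a \<Rightarrow> complex) \<Rightarrow> 'a \<Rightarrow> complex) \<Rightarrow> nat \<Rightarrow> real" where
  "approximation_number \<mu> R n =
     Inf {L2_onorm \<mu> (\<lambda>f x. R f x - F f x) | F. L2_bounded_operator \<mu> F \<and> L2_rank_less \<mu> n F}"

text \<open>\<open>R\<close> realises the commutator \<open>[T, b]\<close> of an operator \<open>T\<close> with kernel \<open>K\<close>.\<close>

definition realises_commutator ::
    "'a::metric_space measure \<Rightarrow> ('a \<Rightarrow> 'a \<Rightarrow> complex) \<Rightarrow> ('a \<Rightarrow> complex)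
      \<Rightarrow> (('a \<Rightarrow> complex) \<Rightarrow> 'a \<Rightarrow> complex) \<Rightarrow> bool" where
  "realises_commutator \<mu> K b R \<longleftrightarrow>
     L2_bounded_operator \<mu> R \<and>
     (\<forall>f \<in> bounded_bounded_support \<mu>. \<forall>g \<in> bounded_bounded_support \<mu>.
        (\<exists>\<delta>>0. \<forall>x \<in> ess_support \<mu> g. \<forall>y \<in> ess_support \<mu> f. \<delta> \<le> dist x y) \<longrightarrow>
        (LINT x|\<mu>. R f x * g x) =
          (LINT x|\<mu>. LINT y|\<mu>. K x y * (b y - b x) * f y * g x))"

end

theory Submission
  imports Defs
begin

text \<open>The argument works at a single scale \<open>s\<close>. Non-degeneracy of the kernel bounds the oscillation of
  \<open>b\<close> on a ball of radius \<open>s\<close> by a matrix coefficient of the commutator between normalised indicator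
  functions supported near that ball. Over a separated net of such balls these functions have
  bounded overlap, so that the \<open>\<ell>\<^sup>q\<close> sum of the coefficients is controlled by
  the sum of the first \<open>q\<close>-th powers of approximation numbers. If \<open>a\<^sub>n < \<epsilon> n powr (-1/d)\<close>
  and \<open>s = sqrt \<epsilon> n powr (-1/d)\<close>, this makes the \<open>L\<^sup>q\<close> norm of the local Lipschitz constant of
  the discrete convolution of \<open>b\<close> at scale \<open>s\<close> tend to zero with \<open>\<epsilon>\<close>; here \<open>1 < d\<close> and \<open>q < d\<close> enter.
  By the Poincare inequality the discrete convolutions approach constants, which is impossible
  if \<open>b\<close> takes two different essential values. The \<open>A\<^sub>\<infinity>\<close> relation is what transfers these values
  from \<open>\<mu>\<close> to \<open>\<nu>\<close>.\<close>

subsection \<open>Operators on square integrable functions\<close>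

text \<open>Oscillation is measured by medians, not means: a radius about some value outside which b
  takes its values on a small proportion of a ball only. Such radii are tested by pairing the
  commutator with indicators of sets, compare on overlapping balls because two large sets intersect,
  and pass from \<mu> to \<nu> because the A_infinity relation is itself about proportions.

  The square root in the scale balances two errors. The net has at most about
  \<open>s powr (-d)\<close> points. Cutting R at rank n leaves a remainder of norm below
  \<open>\<epsilon> * n powr (-1/d)\<close>, beside a part known only to satisfy
  \<open>C * k powr (-1/d)\<close> at ranks k up to n. Normalised by
  \<open>s powr (d/q - 1)\<close>, a scale \<open>\<epsilon> powr a * n powr (-1/d)\<close> turns
  the remainder into \<open>\<epsilon> powr (1 - a)\<close> and the finite rank part into
  \<open>\<epsilon> powr (a * (d/q - 1))\<close>, up to constants; both vanish for 0 < a < 1, and a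
  = 1/2 is taken. Each \<epsilon> asks for a single n, so a vanishing liminf is enough once all
  approximation numbers obey the weak bound.\<close>

definition ip :: "'a measure \<Rightarrow> ('a \<Rightarrow> complex) \<Rightarrow> ('a \<Rightarrow> complex) \<Rightarrow> complex" where
  "ip \<mu> f g = (LINT x|\<mu>. f x * cnj (g x))"

lemma borel_measurable_cnj [measurable (raw)]:
  "f \<in> borel_measurable M \<Longrightarrow> (\<lambda>x. cnj (f x)) \<in> borel_measurable M"
  by (rule measurable_compose[OF _ borel_measurable_continuous_onI]) (auto intro: continuous_intros)

lemma L2_integrable: "f \<in> L2 \<mu> \<Longrightarrow> integrable \<mu> (\<lambda>x. (cmod (f x))\<^sup>2)"
  by (simp add: L2_def)

lemma integrable_norm_bound:
  fixes f :: "'a \<Rightarrow> 'b::{banach, second_countable_topology}" and g :: "'a \<Rightarrow> real"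
  assumes "integrable M g" "f \<in> borel_measurable M" "\<And>x. norm (f x) \<le> g x"
  shows "integrable M f"
proof (rule Bochner_Integration.integrable_bound[OF assms(1,2)])
  show "AE x in M. norm (f x) \<le> norm (g x)"
    using order_trans[OF assms(3) abs_ge_self] by simp
qed

lemma L2_zero [simp]: "(\<lambda>x. 0) \<in> L2 \<mu>"
  by (simp add: L2_def)

lemma L2_add: 
  assumes "f \<in> L2 \<mu>" "g \<in> L2 \<mu>" shows "(\<lambda>x. f x + g x) \<in> L2 \<mu>"
proof -
  have [measurable]: "f \<in> borel_measurable \<mu>" "g \<in> borel_measurable \<mu>" using assms by (auto simp: L2_def)
  have le: "(cmod (f x + g x))\<^sup>2 \<le> 2 * (cmod (f x))\<^sup>2 + 2 * (cmod (g x))\<^sup>2" for x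
  proof -
    have "(cmod (f x + g x))\<^sup>2 \<le> (cmod (f x) + cmod (g x))\<^sup>2"
      by (intro power_mono norm_triangle_ineq) auto
    also have "\<dots> \<le> 2 * (cmod (f x))\<^sup>2 + 2 * (cmod (g x))\<^sup>2"
      using zero_le_power2[of "cmod (f x) - cmod (g x)"] by (simp add: power2_eq_square algebra_simps)
    finally show ?thesis .
  qed
  have "integrable \<mu> (\<lambda>x. (cmod (f x + g x))\<^sup>2)"
    by (rule integrable_norm_bound[where g="\<lambda>x. 2 * (cmod (f x))\<^sup>2 + 2 * (cmod (g x))\<^sup>2"])
      (use le L2_integrable[OF assms(1)] L2_integrable[OF assms(2)] in \<open>simp_all add: borel_measurable_cnj\<close>)
  then show ?thesis by (simp add: L2_def)
qed

lemma L2_cmult: assumes "f \<in> L2 \<mu>" shows "(\<lambda>x. c * f x) \<in> L2 \<mu>"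
  using assms by (auto simp: L2_def norm_mult power_mult_distrib)

lemma L2_diff: assumes "f \<in> L2 \<mu>" "g \<in> L2 \<mu>" shows "(\<lambda>x. f x - g x) \<in> L2 \<mu>"
  using L2_add[OF assms(1) L2_cmult[OF assms(2), of "-1"]] by simp

lemma L2_sum: assumes "finite I" "\<And>i. i \<in> I \<Longrightarrow> f i \<in> L2 \<mu>" shows "(\<lambda>x. \<Sum>i\<in>I. f i x) \<in> L2 \<mu>"
  using assms by (induction I rule: finite_induct) (auto intro: L2_add)

lemma L2_lincomb:
  assumes "finite I" "\<And>i. i \<in> I \<Longrightarrow> f i \<in> L2 \<mu>" shows "(\<lambda>x. \<Sum>i\<in>I. c i * f i x) \<in> L2 \<mu>"
  using assms by (intro L2_sum L2_cmult) auto

lemma L2_prod_integrable: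
  assumes "f \<in> L2 \<mu>" "g \<in> L2 \<mu>" shows "integrable \<mu> (\<lambda>x. f x * cnj (g x))"
proof -
  have [measurable]: "f \<in> borel_measurable \<mu>" "g \<in> borel_measurable \<mu>" using assms by (auto simp: L2_def)
  have "a * b \<le> a\<^sup>2 + b\<^sup>2" if "0 \<le> a" "0 \<le> b" for a b :: real
    using sum_squares_bound[of a b] mult_nonneg_nonneg[OF that] by linarith
  then have le: "cmod (f x * cnj (g x)) \<le> (cmod (f x))\<^sup>2 + (cmod (g x))\<^sup>2" for x
    by (simp add: norm_mult)
  show ?thesis
    by (rule integrable_norm_bound[where g="\<lambda>x. (cmod (f x))\<^sup>2 + (cmod (g x))\<^sup>2"])
      (use le L2_integrable[OF assms(1)] L2_integrable[OF assms(2)] in \<open>simp_all add: borel_measurable_cnj\<close>)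
qed

lemma L2_norm_nonneg [simp]: "0 \<le> L2_norm \<mu> f"
  by (simp add: L2_norm_def)

lemma L2_norm_sq: "(L2_norm \<mu> f)\<^sup>2 = (LINT x|\<mu>. (cmod (f x))\<^sup>2)"
  by (simp add: L2_norm_def)

lemma L2_norm_cmult: "L2_norm \<mu> (\<lambda>x. c * f x) = cmod c * L2_norm \<mu> f"
  by (simp add: L2_norm_def norm_mult power_mult_distrib real_sqrt_mult)

lemma L2_norm_cong:
  assumes "f \<in> L2 \<mu>" "g \<in> L2 \<mu>" "AE x in \<mu>. f x = g x" shows "L2_norm \<mu> f = L2_norm \<mu> g"
  unfolding L2_norm_def using assms
  by (auto intro!: arg_cong[where f=sqrt] integral_cong_AE simp: L2_def)

lemma ip_cong:
  assumes "f \<in> L2 \<mu>" "g \<in> L2 \<mu>" "h \<in> L2 \<mu>" "AE x in \<mu>. f x = g x" shows "ip \<mu> f h = ip \<mu> g h"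
  unfolding ip_def using assms
  by (intro integral_cong_AE borel_measurable_times borel_measurable_cnj) (auto simp: L2_def)

lemma ip_add:
  assumes "f \<in> L2 \<mu>" "g \<in> L2 \<mu>" "h \<in> L2 \<mu>"
  shows "ip \<mu> (\<lambda>x. f x + g x) h = ip \<mu> f h + ip \<mu> g h"
  unfolding ip_def using assms
  by (simp add: distrib_right L2_prod_integrable)

lemma ip_diff:
  assumes "f \<in> L2 \<mu>" "g \<in> L2 \<mu>" "h \<in> L2 \<mu>"
  shows "ip \<mu> (\<lambda>x. f x - g x) h = ip \<mu> f h - ip \<mu> g h"
  unfolding ip_def using assms
  by (simp add: left_diff_distrib L2_prod_integrable)

lemma ip_cmult: "ip \<mu> (\<lambda>x. c * f x) h = c * ip \<mu> f h"
  unfolding ip_def by (simp add: mult.assoc)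

lemma ip_cnj: "ip \<mu> f g = cnj (ip \<mu> g f)"
proof -
  have "cnj (ip \<mu> g f) = (LINT x|\<mu>. cnj (g x * cnj (f x)))"
    unfolding ip_def by (rule Bochner_Integration.integral_cnj[symmetric])
  then show ?thesis unfolding ip_def by (simp add: mult.commute)
qed

lemma ip_sum:
  assumes "finite I" "\<And>i. i \<in> I \<Longrightarrow> f i \<in> L2 \<mu>" "h \<in> L2 \<mu>"
  shows "ip \<mu> (\<lambda>x. \<Sum>i\<in>I. c i * f i x) h = (\<Sum>i\<in>I. c i * ip \<mu> (f i) h)"
  using assms
proof (induction I rule: finite_induct)
  case empty then show ?case by (simp add: ip_def)
next
  case (insert i I)
  then show ?case
    by (simp add: ip_add L2_cmult L2_lincomb ip_cmult)
qed

lemma ip_self: "ip \<mu> f f = of_real ((L2_norm \<mu> f)\<^sup>2)"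
proof -
  have "f x * cnj (f x) = complex_of_real ((cmod (f x))\<^sup>2)" for x
    by (rule complex_norm_square[symmetric])
  then show ?thesis unfolding ip_def L2_norm_sq by (simp only: integral_complex_of_real)
qed

text \<open>Integrate 2 |f| |g| \<le> t |f|^2 + |g|^2 / t and take for t the ratio of the norms. A
  function of norm zero need not vanish everywhere, so that case is settled by an extreme t
  instead.\<close>

lemma Cauchy_Schwarz_L2:
  assumes "f \<in> L2 \<mu>" "g \<in> L2 \<mu>" shows "cmod (ip \<mu> f g) \<le> L2_norm \<mu> f * L2_norm \<mu> g"
proof -
  let ?a = "L2_norm \<mu> f" and ?b = "L2_norm \<mu> g"
  have I: "integrable \<mu> (\<lambda>x. (cmod (f x))\<^sup>2)" "integrable \<mu> (\<lambda>x. (cmod (g x))\<^sup>2)"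
    using assms by (auto simp: L2_def)
  have key: "2 * cmod (ip \<mu> f g) \<le> t * ?a\<^sup>2 + ?b\<^sup>2 / t" if t: "t > 0" for t
  proof -
    have "cmod (ip \<mu> f g) \<le> (LINT x|\<mu>. cmod (f x * cnj (g x)))"
      unfolding ip_def by (rule integral_norm_bound)
    also have "\<dots> \<le> (LINT x|\<mu>. (t * (cmod (f x))\<^sup>2 + (cmod (g x))\<^sup>2 / t) / 2)"
    proof (rule integral_mono)
      show "integrable \<mu> (\<lambda>x. cmod (f x * cnj (g x)))"
        using L2_prod_integrable[OF assms] by (rule integrable_norm)
      show "integrable \<mu> (\<lambda>x. (t * (cmod (f x))\<^sup>2 + (cmod (g x))\<^sup>2 / t) / 2)"
        using I by auto
      fix x
      have "0 \<le> (t * cmod (f x) - cmod (g x))\<^sup>2 / t" using t by simp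
      also have "\<dots> = t * (cmod (f x))\<^sup>2 + (cmod (g x))\<^sup>2 / t - 2 * cmod (f x) * cmod (g x)"
        using t by (simp add: power2_eq_square field_simps)
      finally show "cmod (f x * cnj (g x)) \<le> (t * (cmod (f x))\<^sup>2 + (cmod (g x))\<^sup>2 / t) / 2"
        by (simp add: norm_mult)
    qed
    also have "\<dots> = (t * ?a\<^sup>2 + ?b\<^sup>2 / t) / 2"
      unfolding L2_norm_sq using I by simp
    finally show ?thesis by simp
  qed
  show ?thesis
  proof (cases "?a = 0 \<or> ?b = 0")
    case False
    then have ab: "?a > 0" "?b > 0" using L2_norm_nonneg[of \<mu> f] L2_norm_nonneg[of \<mu> g] by linarith+
    then have "2 * cmod (ip \<mu> f g) \<le> (?b / ?a) * ?a\<^sup>2 + ?b\<^sup>2 / (?b / ?a)" by (intro key) auto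
    also have "\<dots> = 2 * (?a * ?b)" using ab by (simp add: power2_eq_square)
    finally show ?thesis by simp
  next
    \<comment> \<open>If p = \<open>cmod (ip \<mu> f g)\<close> were positive, t = (b^2 + 1) / p or
      t = p / (a^2 + 1) would remove the vanishing norm and leave 2 p \<le> p.\<close>
    case True
    have "cmod (ip \<mu> f g) \<le> 0"
    proof (rule ccontr)
      assume n: "\<not> cmod (ip \<mu> f g) \<le> 0"
      let ?p = "cmod (ip \<mu> f g)"
      from True show False
      proof
        assume "?a = 0"
        then have "2 * ?p \<le> ?b\<^sup>2 / ((?b\<^sup>2 + 1) / ?p)"
          using key[of "(?b\<^sup>2 + 1) / ?p"] n by (simp add: add_nonneg_pos)
        also have "\<dots> = ?p * (?b\<^sup>2 / (?b\<^sup>2 + 1))" by simp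
        also have "\<dots> \<le> ?p * 1" by (intro mult_left_mono) (auto simp: divide_simps add_nonneg_pos)
        finally show False using n by simp
      next
        assume "?b = 0"
        then have "2 * ?p \<le> (?p / (?a\<^sup>2 + 1)) * ?a\<^sup>2"
          using key[of "?p / (?a\<^sup>2 + 1)"] n by (simp add: add_nonneg_pos)
        also have "\<dots> = ?p * (?a\<^sup>2 / (?a\<^sup>2 + 1))" by simp
        also have "\<dots> \<le> ?p * 1" by (intro mult_left_mono) (auto simp: divide_simps add_nonneg_pos)
        finally show False using n by simp
      qed
    qed
    then show ?thesis by (meson L2_norm_nonneg mult_nonneg_nonneg order_trans)
  qed
qed

lemma L2_norm_triangle:
  assumes "f \<in> L2 \<mu>" "g \<in> L2 \<mu>"
  shows "L2_norm \<mu> (\<lambda>x. f x + g x) \<le> L2_norm \<mu> f + L2_norm \<mu> g"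
proof -
  let ?h = "\<lambda>x. f x + g x"
  have h: "?h \<in> L2 \<mu>" by (rule L2_add[OF assms])
  have "(L2_norm \<mu> ?h)\<^sup>2 = cmod (ip \<mu> ?h ?h)" unfolding ip_self by (simp only: norm_of_real) simp
  also have "\<dots> = cmod (ip \<mu> f ?h + ip \<mu> g ?h)" by (simp add: ip_add[OF assms h])
  also have "\<dots> \<le> L2_norm \<mu> f * L2_norm \<mu> ?h + L2_norm \<mu> g * L2_norm \<mu> ?h"
    by (intro order_trans[OF norm_triangle_ineq] add_mono Cauchy_Schwarz_L2 assms h)
  finally have "L2_norm \<mu> ?h * L2_norm \<mu> ?h \<le> (L2_norm \<mu> f + L2_norm \<mu> g) * L2_norm \<mu> ?h"
    by (simp add: power2_eq_square distrib_right)
  then show ?thesis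
    using L2_norm_nonneg[of \<mu> ?h] L2_norm_nonneg[of \<mu> f] L2_norm_nonneg[of \<mu> g]
    by (metis add_nonneg_nonneg mult_right_le_imp_le order_le_less)
qed

lemma L2_norm_zero_AE:
  assumes "f \<in> L2 \<mu>" "L2_norm \<mu> f = 0" shows "AE x in \<mu>. f x = 0"
proof -
  have "(LINT x|\<mu>. (cmod (f x))\<^sup>2) = 0" using assms(2) by (simp add: L2_norm_def)
  then have "AE x in \<mu>. (cmod (f x))\<^sup>2 = 0"
    using L2_integrable[OF assms(1)] by (subst (asm) integral_nonneg_eq_0_iff_AE) auto
  then show ?thesis by auto
qed

section \<open>Bounded linear operators modulo null sets\<close>

text \<open>The bound is carried explicitly, because \<open>L2_onorm\<close> is a supremum of reals
  and says something only once the set is known to be bounded above. Any upper bound is allowed, so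
  bounds simply add under differences.\<close>

definition bounded_by :: "'a measure \<Rightarrow> (('a \<Rightarrow> complex) \<Rightarrow> 'a \<Rightarrow> complex) \<Rightarrow> real \<Rightarrow> bool" where
  "bounded_by \<mu> G A \<longleftrightarrow> linear_AE \<mu> (L2 \<mu>) G \<and>
     (\<forall>f\<in>L2 \<mu>. G f \<in> L2 \<mu> \<and> L2_norm \<mu> (G f) \<le> A * L2_norm \<mu> f)"

lemma bounded_byD:
  assumes "bounded_by \<mu> G A" "f \<in> L2 \<mu>"
  shows "G f \<in> L2 \<mu>" "L2_norm \<mu> (G f) \<le> A * L2_norm \<mu> f"
  using assms by (auto simp: bounded_by_def)

lemma bounded_by_diff:
  assumes "bounded_by \<mu> G A" "bounded_by \<mu> H B"
  shows "bounded_by \<mu> (\<lambda>f x. G f x - H f x) (A + B)"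
proof -
  have 1: "AE x in \<mu>. G (\<lambda>x. f x + g x) x - H (\<lambda>x. f x + g x) x = (G f x - H f x) + (G g x - H g x)"
    if "f \<in> L2 \<mu>" "g \<in> L2 \<mu>" for f g
  proof -
    have "AE x in \<mu>. G (\<lambda>x. f x + g x) x = G f x + G g x" "AE x in \<mu>. H (\<lambda>x. f x + g x) x = H f x + H g x"
      using assms that by (auto simp: bounded_by_def linear_AE_def)
    then show ?thesis by eventually_elim auto
  qed
  have 2: "AE x in \<mu>. G (\<lambda>x. c * f x) x - H (\<lambda>x. c * f x) x = c * (G f x - H f x)"
    if "f \<in> L2 \<mu>" for f c
  proof -
    have "AE x in \<mu>. G (\<lambda>x. c * f x) x = c * G f x" "AE x in \<mu>. H (\<lambda>x. c * f x) x = c * H f x"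
      using assms that by (auto simp: bounded_by_def linear_AE_def)
    then show ?thesis by eventually_elim (auto simp: algebra_simps)
  qed
  have 3: "L2_norm \<mu> (\<lambda>x. G f x - H f x) \<le> (A + B) * L2_norm \<mu> f" if f: "f \<in> L2 \<mu>" for f
  proof -
    have "L2_norm \<mu> (\<lambda>x. G f x + (-1) * H f x) \<le> L2_norm \<mu> (G f) + L2_norm \<mu> (\<lambda>x. (-1) * H f x)"
      using f bounded_byD[OF assms(1) f] bounded_byD[OF assms(2) f]
      by (intro L2_norm_triangle L2_cmult) auto
    also have "\<dots> \<le> A * L2_norm \<mu> f + B * L2_norm \<mu> f"
      unfolding L2_norm_cmult using bounded_byD[OF assms(1) f] bounded_byD[OF assms(2) f] by simp
    finally show ?thesis by (simp add: distrib_right)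
  qed
  show ?thesis
    using 1 2 3 assms unfolding bounded_by_def linear_AE_def
    by (auto intro: L2_add L2_cmult L2_diff)
qed

lemma linear_AE_addD:
  "linear_AE \<mu> D G \<Longrightarrow> f \<in> D \<Longrightarrow> g \<in> D \<Longrightarrow> AE x in \<mu>. G (\<lambda>x. f x + g x) x = G f x + G g x"
  by (simp add: linear_AE_def)

lemma linear_AE_cmultD:
  "linear_AE \<mu> D G \<Longrightarrow> f \<in> D \<Longrightarrow> AE x in \<mu>. G (\<lambda>x. c * f x) x = c * G f x"
  by (simp add: linear_AE_def)

lemma linear_AE_sum:
  assumes "linear_AE \<mu> (L2 \<mu>) G" "finite I" "\<And>i. i \<in> I \<Longrightarrow> f i \<in> L2 \<mu>"
  shows "AE x in \<mu>. G (\<lambda>x. \<Sum>i\<in>I. c i * f i x) x = (\<Sum>i\<in>I. c i * G (f i) x)"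
  using assms(2,3)
proof (induction I rule: finite_induct)
  case empty
  \<comment> \<open>Homogeneity with factor 0 gives the value at the zero function.\<close>
  have "AE x in \<mu>. G (\<lambda>x. 0 * (0::complex)) x = 0 * G (\<lambda>x. 0) x"
    by (rule linear_AE_cmultD[OF assms(1) L2_zero])
  then show ?case by simp
next
  case (insert i I)
  have m: "(\<lambda>x. c i * f i x) \<in> L2 \<mu>" "(\<lambda>x. \<Sum>i\<in>I. c i * f i x) \<in> L2 \<mu>"
    using insert by (auto intro: L2_cmult L2_lincomb)
  have "AE x in \<mu>. G (\<lambda>x. c i * f i x + (\<Sum>i\<in>I. c i * f i x)) x
      = G (\<lambda>x. c i * f i x) x + G (\<lambda>x. \<Sum>i\<in>I. c i * f i x) x"
    by (rule linear_AE_addD[OF assms(1) m])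
  moreover have "AE x in \<mu>. G (\<lambda>x. c i * f i x) x = c i * G (f i) x"
    using insert.prems by (intro linear_AE_cmultD[OF assms(1)]) simp
  moreover have "AE x in \<mu>. G (\<lambda>x. \<Sum>i\<in>I. c i * f i x) x = (\<Sum>i\<in>I. c i * G (f i) x)"
    using insert by auto
  ultimately have "AE x in \<mu>. G (\<lambda>x. c i * f i x + (\<Sum>i\<in>I. c i * f i x)) x = c i * G (f i) x + (\<Sum>i\<in>I. c i * G (f i) x)"
    by eventually_elim simp
  then show ?case using insert.hyps by simp
qed

section \<open>Finite rank operators\<close>

text \<open>Orthonormality is exact in terms of \<open>ip\<close>, while the span is taken modulo
  null sets: a residual \<open>w\<close> of norm zero vanishes almost everywhere and adds no vector,
  so M can be smaller than N.\<close>

lemma gram_schmidt: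
  fixes h :: "nat \<Rightarrow> 'a \<Rightarrow> complex"
  assumes "\<And>i. i < N \<Longrightarrow> h i \<in> L2 \<mu>"
  shows "\<exists>M u. M \<le> N \<and> (\<forall>i<M. u i \<in> L2 \<mu>) \<and> (\<forall>i<M. \<forall>j<M. ip \<mu> (u i) (u j) = (if i = j then 1 else 0)) \<and>
    (\<forall>i<N. \<exists>c. AE x in \<mu>. h i x = (\<Sum>k<M. c k * u k x))"
  using assms
proof (induction N)
  case 0 then show ?case by (intro exI[of _ 0]) auto
next
  case (Suc N)
  have "\<exists>M u. M \<le> N \<and> (\<forall>i<M. u i \<in> L2 \<mu>) \<and> (\<forall>i<M. \<forall>j<M. ip \<mu> (u i) (u j) = (if i = j then 1 else 0)) \<and>
    (\<forall>i<N. \<exists>c. AE x in \<mu>. h i x = (\<Sum>k<M. c k * u k x))"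
    by (rule Suc.IH) (simp add: Suc.prems)
  then obtain M u where M: "M \<le> N" and u: "\<And>i. i < M \<Longrightarrow> u i \<in> L2 \<mu>"
    and on: "\<And>i j. i < M \<Longrightarrow> j < M \<Longrightarrow> ip \<mu> (u i) (u j) = (if i = j then 1 else 0)"
    and sp: "\<And>i. i < N \<Longrightarrow> \<exists>c. AE x in \<mu>. h i x = (\<Sum>k<M. c k * u k x)"
    by (elim exE conjE) blast
  define w where "w = (\<lambda>x. h N x - (\<Sum>k<M. ip \<mu> (h N) (u k) * u k x))"
  have hN: "h N \<in> L2 \<mu>" using Suc.prems by simp
  have s: "(\<lambda>x. \<Sum>k<M. ip \<mu> (h N) (u k) * u k x) \<in> L2 \<mu>" by (intro L2_lincomb) (auto intro: u)
  have w: "w \<in> L2 \<mu>" unfolding w_def by (intro L2_diff hN s)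
  have orth: "ip \<mu> w (u j) = 0" if "j < M" for j
  proof -
    have "ip \<mu> w (u j) = ip \<mu> (h N) (u j) - (\<Sum>k<M. ip \<mu> (h N) (u k) * ip \<mu> (u k) (u j))"
      unfolding w_def using hN s u that by (subst ip_diff) (auto intro!: ip_sum)
    also have "(\<Sum>k<M. ip \<mu> (h N) (u k) * ip \<mu> (u k) (u j)) = (\<Sum>k<M. if k = j then ip \<mu> (h N) (u k) else 0)"
      by (intro sum.cong) (auto simp: on that)
    finally show ?thesis using that by simp
  qed
  show ?case
  proof (cases "L2_norm \<mu> w = 0")
    case True
    then have "AE x in \<mu>. w x = 0" by (rule L2_norm_zero_AE[OF w])
    then have "AE x in \<mu>. h N x = (\<Sum>k<M. ip \<mu> (h N) (u k) * u k x)" by (simp add: w_def)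
    then have "\<exists>c. AE x in \<mu>. h N x = (\<Sum>k<M. c k * u k x)"
      by (rule exI[of _ "\<lambda>k. ip \<mu> (h N) (u k)"])
    then have "\<forall>i<Suc N. \<exists>c. AE x in \<mu>. h i x = (\<Sum>k<M. c k * u k x)"
      using sp less_Suc_eq by metis
    then show ?thesis using M u on by (intro exI[of _ M] exI[of _ u]) auto
  next
    case False
    define n where "n = L2_norm \<mu> w"
    have n: "n > 0" using False unfolding n_def by (smt (verit) L2_norm_nonneg)
    define v where "v = (\<lambda>x. complex_of_real (1/n) * w x)"
    have v: "v \<in> L2 \<mu>" unfolding v_def by (intro L2_cmult w)
    have nv: "L2_norm \<mu> v = 1" unfolding v_def L2_norm_cmult using n by (simp add: n_def norm_divide)
    have vv: "ip \<mu> v v = 1" unfolding ip_self nv by simp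
    have vu: "ip \<mu> v (u j) = 0" if "j < M" for j unfolding v_def ip_cmult using orth[OF that] by simp
    then have uv: "ip \<mu> (u j) v = 0" if "j < M" for j using ip_cnj[of \<mu> "u j" v] that by simp
    let ?u = "u(M := v)"
    have 1: "\<exists>c. AE x in \<mu>. h i x = (\<Sum>k<Suc M. c k * ?u k x)" if "i < Suc N" for i
    proof (cases "i < N")
      case True
      then obtain c where c: "AE x in \<mu>. h i x = (\<Sum>k<M. c k * u k x)" using sp by blast
      have "(\<Sum>k<Suc M. (c(M := 0)) k * ?u k x) = (\<Sum>k<M. c k * u k x)" for x by simp
      then show ?thesis using c by (intro exI[of _ "c(M := 0)"]) simp
    next
      case False
      then have i: "i = N" using that by simp
      let ?c = "(\<lambda>k. ip \<mu> (h N) (u k))(M := of_real n)"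
      have "(\<Sum>k<Suc M. ?c k * ?u k x) = (\<Sum>k<M. ip \<mu> (h N) (u k) * u k x) + of_real n * v x" for x
        by simp
      moreover have "of_real n * v x = w x" for x unfolding v_def using n by simp
      ultimately have "(\<Sum>k<Suc M. ?c k * ?u k x) = h N x" for x unfolding w_def by simp
      then show ?thesis unfolding i by (intro exI[of _ ?c]) simp
    qed
    show ?thesis
      using M u on 1 v vv vu uv
      by (intro exI[of _ "Suc M"] exI[of _ ?u]) (auto simp: less_Suc_eq)
  qed
qed

text \<open>The spanning functions are arbitrary, possibly dependent, and indexed by an initial
  segment. In \<open>L2_rank_less\<close> they are images under F; the present form is the one that
  survives differences, with ranks adding.\<close>

definition rank_le :: "'a measure \<Rightarrow> nat \<Rightarrow> (('a \<Rightarrow> complex) \<Rightarrow> 'a \<Rightarrow> complex) \<Rightarrow> bool" where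
  "rank_le \<mu> N G \<longleftrightarrow> (\<exists>h. (\<forall>i<N. h i \<in> L2 \<mu>) \<and>
     (\<forall>f\<in>L2 \<mu>. \<exists>c. AE x in \<mu>. G f x = (\<Sum>i<N. c i * h i x)))"

lemma rank_le_of_rank_less:
  assumes "L2_rank_less \<mu> n F" "bounded_by \<mu> F A"
  shows "\<exists>N<n. rank_le \<mu> N F"
proof -
  obtain B where B: "finite B" "card B < n" "B \<subseteq> L2 \<mu>"
    and sp: "\<And>f. f \<in> L2 \<mu> \<Longrightarrow> \<exists>c. AE x in \<mu>. F f x = (\<Sum>h\<in>B. c h * F h x)"
    using assms(1) unfolding L2_rank_less_def by blast
  obtain e where e: "bij_betw e {..<card B} B"
    using B(1) by (metis ex_bij_betw_nat_finite lessThan_atLeast0)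
  have "rank_le \<mu> (card B) F"
    unfolding rank_le_def
  proof (intro exI[of _ "\<lambda>i. F (e i)"] conjI allI impI ballI)
    fix i assume "i < card B"
    then have "e i \<in> B" using e by (auto simp: bij_betw_def)
    then show "F (e i) \<in> L2 \<mu>" using B(3) bounded_byD[OF assms(2)] by auto
  next
    fix f assume "f \<in> L2 \<mu>"
    then obtain c where c: "AE x in \<mu>. F f x = (\<Sum>h\<in>B. c h * F h x)" using sp by blast
    have "(\<Sum>h\<in>B. c h * F h x) = (\<Sum>i<card B. c (e i) * F (e i) x)" for x
      by (rule sum.reindex_bij_betw[OF e, symmetric])
    then show "\<exists>c. AE x in \<mu>. F f x = (\<Sum>i<card B. c i * F (e i) x)"
      using c by (intro exI[of _ "\<lambda>i. c (e i)"]) simp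
  qed
  then show ?thesis using B(2) by blast
qed

lemma rank_le_diff:
  assumes "rank_le \<mu> N G" "rank_le \<mu> M H"
  shows "rank_le \<mu> (N + M) (\<lambda>f x. G f x - H f x)"
proof -
  obtain g h where g: "\<And>i. i < N \<Longrightarrow> g i \<in> L2 \<mu>" "\<And>f. f \<in> L2 \<mu> \<Longrightarrow> \<exists>c. AE x in \<mu>. G f x = (\<Sum>i<N. c i * g i x)"
    and h: "\<And>i. i < M \<Longrightarrow> h i \<in> L2 \<mu>" "\<And>f. f \<in> L2 \<mu> \<Longrightarrow> \<exists>c. AE x in \<mu>. H f x = (\<Sum>i<M. c i * h i x)"
    using assms unfolding rank_le_def by blast
  let ?k = "\<lambda>i. if i < N then g i else h (i - N)"
  have "\<exists>c. AE x in \<mu>. G f x - H f x = (\<Sum>i<N+M. c i * ?k i x)" if f: "f \<in> L2 \<mu>" for f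
  proof -
    obtain c d where c: "AE x in \<mu>. G f x = (\<Sum>i<N. c i * g i x)" and d: "AE x in \<mu>. H f x = (\<Sum>i<M. d i * h i x)"
      using g(2) h(2) f by blast
    let ?e = "\<lambda>i. if i < N then c i else - d (i - N)"
    have "(\<Sum>i<N+M. ?e i * ?k i x) = (\<Sum>i<N. c i * g i x) - (\<Sum>i<M. d i * h i x)" for x
    proof -
      have "(\<Sum>i<N+M. ?e i * ?k i x) = (\<Sum>i<N. ?e i * ?k i x) + (\<Sum>i\<in>{N..<N+M}. ?e i * ?k i x)"
        by (simp only: lessThan_atLeast0) (rule sum.atLeastLessThan_concat[symmetric], simp_all)
      also have "(\<Sum>i\<in>{N..<N+M}. ?e i * ?k i x) = (\<Sum>i<M. ?e (i+N) * ?k (i+N) x)"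
        using sum.shift_bounds_nat_ivl[of "\<lambda>i. ?e i * ?k i x" 0 N M] by (simp add: lessThan_atLeast0 add.commute)
      finally show ?thesis by (simp add: sum_negf)
    qed
    then show ?thesis using c d by (intro exI[of _ ?e]) auto
  qed
  then show ?thesis unfolding rank_le_def
    using g(1) h(1) by (intro exI[of _ ?k]) auto
qed

section \<open>From approximation numbers to approximants\<close>

lemma L2_bounded_operator_iff: "L2_bounded_operator \<mu> G \<longleftrightarrow> (\<exists>A. bounded_by \<mu> G A)"
  by (auto simp: L2_bounded_operator_def bounded_on_L2_def bounded_by_def)

text \<open>Some bound A makes the set behind the supremum bounded above; normalising f then gives
  the estimate. If f has norm zero, A itself shows that \<open>G f\<close> has norm zero.\<close>

lemma bounded_by_onorm:
  assumes "L2_bounded_operator \<mu> G" shows "bounded_by \<mu> G (L2_onorm \<mu> G)"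
proof -
  obtain A where A: "bounded_by \<mu> G A" using assms unfolding L2_bounded_operator_iff by blast
  let ?S = "{f \<in> L2 \<mu>. L2_norm \<mu> f \<le> 1}"
  have bdd: "bdd_above ((\<lambda>f. L2_norm \<mu> (G f)) ` ?S)"
  proof (rule bdd_aboveI2)
    fix f assume f: "f \<in> ?S"
    then have "L2_norm \<mu> (G f) \<le> A * L2_norm \<mu> f" using bounded_byD[OF A] by simp
    also have "\<dots> \<le> \<bar>A\<bar> * 1" using f by (intro mult_mono) auto
    finally show "L2_norm \<mu> (G f) \<le> \<bar>A\<bar>" by simp
  qed
  have "L2_norm \<mu> (G f) \<le> L2_onorm \<mu> G * L2_norm \<mu> f" if f: "f \<in> L2 \<mu>" for f
  proof (cases "L2_norm \<mu> f = 0")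
    case True
    then show ?thesis using bounded_byD(2)[OF A f] by simp
  next
    case False
    define n where "n = L2_norm \<mu> f"
    have n: "n > 0" using False L2_norm_nonneg[of \<mu> f] unfolding n_def by linarith
    let ?c = "complex_of_real (1 / n)"
    have m: "(\<lambda>x. ?c * f x) \<in> L2 \<mu>" by (rule L2_cmult[OF f])
    have "L2_norm \<mu> (\<lambda>x. ?c * f x) = 1" unfolding L2_norm_cmult using n by (simp add: n_def norm_divide)
    then have "(\<lambda>x. ?c * f x) \<in> ?S" using m by simp
    then have "L2_norm \<mu> (G (\<lambda>x. ?c * f x)) \<le> L2_onorm \<mu> G"
      unfolding L2_onorm_def by (rule cSUP_upper[OF _ bdd])
    moreover have "L2_norm \<mu> (G (\<lambda>x. ?c * f x)) = L2_norm \<mu> (\<lambda>x. ?c * G f x)"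
    proof (rule L2_norm_cong)
      show "G (\<lambda>x. ?c * f x) \<in> L2 \<mu>" by (rule bounded_byD(1)[OF A m])
      show "(\<lambda>x. ?c * G f x) \<in> L2 \<mu>" by (rule L2_cmult[OF bounded_byD(1)[OF A f]])
      show "AE x in \<mu>. G (\<lambda>x. ?c * f x) x = ?c * G f x"
        using A f by (intro linear_AE_cmultD[where D="L2 \<mu>"]) (auto simp: bounded_by_def)
    qed
    moreover have "L2_norm \<mu> (\<lambda>x. ?c * G f x) = L2_norm \<mu> (G f) / n"
      unfolding L2_norm_cmult using n by (simp add: norm_divide)
    ultimately have "L2_norm \<mu> (G f) / n \<le> L2_onorm \<mu> G" by (simp only:)
    then show ?thesis using n unfolding n_def[symmetric] by (simp only: pos_divide_le_eq)
  qed
  then show ?thesis using A unfolding bounded_by_def by auto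
qed

lemma bounded_by_mono:
  assumes "bounded_by \<mu> G A" "A \<le> B" shows "bounded_by \<mu> G B"
  using assms unfolding bounded_by_def
  by (meson L2_norm_nonneg mult_right_mono order_trans)

lemma bounded_by_zero: "bounded_by \<mu> (\<lambda>f x. 0) 0"
  by (auto simp: bounded_by_def linear_AE_def L2_norm_def intro: L2_add L2_cmult)

text \<open>For \<open>n \<ge> 1\<close> the zero operator has rank less than n, so the infimum runs
  over a nonempty set and a strict upper bound on it is undercut by an actual F.\<close>

lemma approximation_numberD:
  assumes "L2_bounded_operator \<mu> R" "approximation_number \<mu> R n < t" "n \<ge> 1"
  shows "\<exists>F N. N < n \<and> L2_bounded_operator \<mu> F \<and> rank_le \<mu> N F \<and> bounded_by \<mu> (\<lambda>f x. R f x - F f x) t"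
proof -
  let ?X = "{L2_onorm \<mu> (\<lambda>f x. R f x - F f x) | F. L2_bounded_operator \<mu> F \<and> L2_rank_less \<mu> n F}"
  have "L2_bounded_operator \<mu> (\<lambda>f x. 0)"
    unfolding L2_bounded_operator_iff using bounded_by_zero by blast
  moreover have "L2_rank_less \<mu> n (\<lambda>f x. 0)"
    unfolding L2_rank_less_def using assms(3) by (intro exI[of _ "{}"]) auto
  ultimately have "?X \<noteq> {}" by blast
  then obtain y where "y \<in> ?X" "y < t"
    using cInf_lessD[of ?X t] assms(2) unfolding approximation_number_def by blast
  then obtain F where F: "L2_bounded_operator \<mu> F" "L2_rank_less \<mu> n F"
    and t: "L2_onorm \<mu> (\<lambda>f x. R f x - F f x) < t" by blast
  obtain A B where AB: "bounded_by \<mu> R A" "bounded_by \<mu> F B"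
    using assms(1) F(1) unfolding L2_bounded_operator_iff by blast
  have "L2_bounded_operator \<mu> (\<lambda>f x. R f x - F f x)"
    unfolding L2_bounded_operator_iff using bounded_by_diff[OF AB] by blast
  then have "bounded_by \<mu> (\<lambda>f x. R f x - F f x) t"
    using bounded_by_mono[OF bounded_by_onorm] t by fastforce
  then show ?thesis using F(1) rank_le_of_rank_less[OF F(2) AB(2)] by blast
qed

section \<open>Sums of matrix coefficients\<close>

text \<open>Parseval's identity in a finite orthonormal system: pairing f with \<open>u j\<close>
  recovers the coefficient \<open>c j\<close>.\<close>

lemma orthonormal_expansion:
  fixes u :: "nat \<Rightarrow> 'a \<Rightarrow> complex"
  assumes "\<And>k. k < n \<Longrightarrow> u k \<in> L2 \<mu>"
    and "\<And>i j. i < n \<Longrightarrow> j < n \<Longrightarrow> ip \<mu> (u i) (u j) = (if i = j then 1 else 0)"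
    and "f \<in> L2 \<mu>" "AE x in \<mu>. f x = (\<Sum>k<n. c k * u k x)" "g \<in> L2 \<mu>"
  shows "ip \<mu> f g = (\<Sum>k<n. ip \<mu> f (u k) * ip \<mu> (u k) g)"
proof -
  have m: "(\<lambda>x. \<Sum>k<n. c k * u k x) \<in> L2 \<mu>" using assms(1) by (intro L2_lincomb) auto
  have e: "ip \<mu> f h = (\<Sum>k<n. c k * ip \<mu> (u k) h)" if "h \<in> L2 \<mu>" for h
    using ip_cong[OF assms(3) m that assms(4)] ip_sum[of "{..<n}" u \<mu> h c] assms(1) that by simp
  have "ip \<mu> f (u j) = c j" if "j < n" for j
  proof -
    have "ip \<mu> f (u j) = (\<Sum>k<n. if k = j then c k else 0)"
      unfolding e[OF assms(1)[OF that]] using assms(2) that by (intro sum.cong) auto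
    then show ?thesis using that by simp
  qed
  then show ?thesis using e[OF assms(5)] by simp
qed

text \<open>A nuclear norm estimate. The range is expanded in at most N orthonormal functions
  \<open>u k\<close>; for each k, Cauchy-Schwarz in j separates \<open>G (e j)\<close> from
  \<open>f j\<close>, and both factors are Bessel sums. The hypotheses on M are Bessel bounds, in
  synthesis form for e and in analysis form for f.\<close>

lemma trace_bound:
  assumes G: "bounded_by \<mu> G A" "0 \<le> A" "rank_le \<mu> N G" and J: "finite J"
    and L: "\<And>j. j \<in> J \<Longrightarrow> e j \<in> L2 \<mu>" "\<And>j. j \<in> J \<Longrightarrow> f j \<in> L2 \<mu>"
    and M: "0 \<le> M" "\<And>c. (L2_norm \<mu> (\<lambda>x. \<Sum>j\<in>J. c j * e j x))\<^sup>2 \<le> M * (\<Sum>j\<in>J. (cmod (c j))\<^sup>2)"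
      "\<And>u. u \<in> L2 \<mu> \<Longrightarrow> (\<Sum>j\<in>J. (cmod (ip \<mu> u (f j)))\<^sup>2) \<le> M * (L2_norm \<mu> u)\<^sup>2"
  shows "(\<Sum>j\<in>J. cmod (ip \<mu> (G (e j)) (f j))) \<le> M * A * N"
proof -
  obtain h where h: "\<And>i. i < N \<Longrightarrow> h i \<in> L2 \<mu>"
    and hs: "\<And>f. f \<in> L2 \<mu> \<Longrightarrow> \<exists>c. AE x in \<mu>. G f x = (\<Sum>i<N. c i * h i x)"
    using G(3) unfolding rank_le_def by blast
  have "\<exists>n u. n \<le> N \<and> (\<forall>i<n. u i \<in> L2 \<mu>) \<and> (\<forall>i<n. \<forall>j<n. ip \<mu> (u i) (u j) = (if i = j then 1 else 0)) \<and>
    (\<forall>i<N. \<exists>c. AE x in \<mu>. h i x = (\<Sum>k<n. c k * u k x))"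
    by (rule gram_schmidt) (rule h)
  then obtain n u where n: "n \<le> N" and u: "\<And>i. i < n \<Longrightarrow> u i \<in> L2 \<mu>"
    and on: "\<And>i j. i < n \<Longrightarrow> j < n \<Longrightarrow> ip \<mu> (u i) (u j) = (if i = j then 1 else 0)"
    and sp: "\<And>i. i < N \<Longrightarrow> \<exists>c. AE x in \<mu>. h i x = (\<Sum>k<n. c k * u k x)"
    by (elim exE conjE) blast
  obtain d where d: "\<And>i. i < N \<Longrightarrow> AE x in \<mu>. h i x = (\<Sum>k<n. d i k * u k x)"
    using sp by metis
  have Gs: "\<exists>c. AE x in \<mu>. G f x = (\<Sum>k<n. c k * u k x)" if f: "f \<in> L2 \<mu>" for f
  proof -
    obtain c where c: "AE x in \<mu>. G f x = (\<Sum>i<N. c i * h i x)" using hs[OF f] by blast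
    have "AE x in \<mu>. \<forall>i\<in>{..<N}. h i x = (\<Sum>k<n. d i k * u k x)"
      using d by (intro AE_finite_allI) auto
    then have "AE x in \<mu>. G f x = (\<Sum>k<n. (\<Sum>i<N. c i * d i k) * u k x)"
      using c
    proof eventually_elim
      case (elim x)
      have "G f x = (\<Sum>i<N. c i * (\<Sum>k<n. d i k * u k x))" using elim by simp
      also have "\<dots> = (\<Sum>i<N. \<Sum>k<n. c i * d i k * u k x)" by (simp add: sum_distrib_left mult.assoc)
      also have "\<dots> = (\<Sum>k<n. \<Sum>i<N. c i * d i k * u k x)" by (rule sum.swap)
      finally show ?case by (simp add: sum_distrib_right)
    qed
    then show ?thesis by (rule exI[of _ "\<lambda>k. \<Sum>i<N. c i * d i k"])
  qed
  have Ge: "G (e j) \<in> L2 \<mu>" if "j \<in> J" for j using bounded_byD(1)[OF G(1)] L(1) that by blast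
  have ipe: "ip \<mu> (G (e j)) (f j) = (\<Sum>k<n. ip \<mu> (G (e j)) (u k) * ip \<mu> (u k) (f j))" if j: "j \<in> J" for j
    using Gs[OF L(1)[OF j]] orthonormal_expansion[OF u on Ge[OF j] _ L(2)[OF j]] by blast
  have nu: "L2_norm \<mu> (u k) = 1" if "k < n" for k
  proof -
    have "complex_of_real ((L2_norm \<mu> (u k))\<^sup>2) = of_real 1" unfolding ip_self[symmetric] using on that by simp
    then have "(L2_norm \<mu> (u k))\<^sup>2 = 1\<^sup>2" by (simp only: of_real_eq_iff) simp
    then show ?thesis by (subst (asm) power2_eq_iff_nonneg) auto
  qed
  \<comment> \<open>Duality: with the conjugate coefficients as weights, the pairing of
    \<open>G ?h\<close> with \<open>u k\<close> equals S. Hence S is at most A times the norm of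
    \<open>?h\<close>, and the synthesis bound allows one factor S to be cancelled after
    squaring.\<close>
  have S1: "(\<Sum>j\<in>J. (cmod (ip \<mu> (G (e j)) (u k)))\<^sup>2) \<le> M * A\<^sup>2" if k: "k < n" for k
  proof -
    define S where "S = (\<Sum>j\<in>J. (cmod (ip \<mu> (G (e j)) (u k)))\<^sup>2)"
    define c where "c = (\<lambda>j. cnj (ip \<mu> (G (e j)) (u k)))"
    let ?h = "\<lambda>x. \<Sum>j\<in>J. c j * e j x"
    have S0: "S \<ge> 0" unfolding S_def by (intro sum_nonneg) auto
    have hL: "?h \<in> L2 \<mu>" using L by (intro L2_lincomb J) auto
    have gL: "(\<lambda>x. \<Sum>j\<in>J. c j * G (e j) x) \<in> L2 \<mu>" using Ge by (intro L2_lincomb J) auto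
    have "AE x in \<mu>. G ?h x = (\<Sum>j\<in>J. c j * G (e j) x)"
      using G(1) L(1) by (intro linear_AE_sum J) (auto simp: bounded_by_def)
    then have "ip \<mu> (G ?h) (u k) = (\<Sum>j\<in>J. c j * ip \<mu> (G (e j)) (u k))"
      using ip_cong[OF bounded_byD(1)[OF G(1) hL] gL u[OF k]] ip_sum[OF J Ge u[OF k]] by simp
    also have "\<dots> = of_real S"
      unfolding S_def c_def of_real_sum complex_norm_square by (simp add: mult.commute)
    finally have "S = cmod (ip \<mu> (G ?h) (u k))" using S0 by simp
    also have "\<dots> \<le> L2_norm \<mu> (G ?h) * 1"
      using Cauchy_Schwarz_L2[OF bounded_byD(1)[OF G(1) hL] u[OF k]] nu[OF k] by simp
    also have "\<dots> \<le> A * L2_norm \<mu> ?h" using bounded_byD(2)[OF G(1) hL] by simp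
    finally have "S\<^sup>2 \<le> (A * L2_norm \<mu> ?h)\<^sup>2" using S0 by (intro power_mono) auto
    also have "\<dots> \<le> A\<^sup>2 * (M * (\<Sum>j\<in>J. (cmod (c j))\<^sup>2))"
      unfolding power_mult_distrib by (intro mult_left_mono M) auto
    also have "\<dots> = M * A\<^sup>2 * S" unfolding S_def c_def by simp
    finally have "S * S \<le> M * A\<^sup>2 * S" by (simp add: power2_eq_square)
    then have "S \<le> M * A\<^sup>2" using S0 M(1)
      by (cases "S = 0") (auto simp: mult_le_cancel_right)
    then show ?thesis unfolding S_def .
  qed
  have "(\<Sum>j\<in>J. cmod (ip \<mu> (G (e j)) (f j)))
      \<le> (\<Sum>j\<in>J. \<Sum>k<n. cmod (ip \<mu> (G (e j)) (u k)) * cmod (ip \<mu> (u k) (f j)))"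
    by (intro sum_mono) (simp add: ipe sum_norm_le norm_mult)
  also have "\<dots> = (\<Sum>k<n. \<Sum>j\<in>J. \<bar>cmod (ip \<mu> (G (e j)) (u k))\<bar> * \<bar>cmod (ip \<mu> (u k) (f j))\<bar>)"
    by (subst sum.swap) simp
  also have "\<dots> \<le> (\<Sum>k<n. L2_set (\<lambda>j. cmod (ip \<mu> (G (e j)) (u k))) J * L2_set (\<lambda>j. cmod (ip \<mu> (u k) (f j))) J)"
    by (intro sum_mono L2_set_mult_ineq)
  also have "\<dots> \<le> (\<Sum>k<n. sqrt (M * A\<^sup>2) * sqrt (M * 1))"
  proof (intro sum_mono mult_mono)
    fix k assume "k \<in> {..<n}" then have k: "k < n" by simp
    show "L2_set (\<lambda>j. cmod (ip \<mu> (G (e j)) (u k))) J \<le> sqrt (M * A\<^sup>2)"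
      unfolding L2_set_def using S1[OF k] by simp
    show "L2_set (\<lambda>j. cmod (ip \<mu> (u k) (f j))) J \<le> sqrt (M * 1)"
      unfolding L2_set_def using M(3)[OF u[OF k]] nu[OF k] by simp
  qed (use M in auto)
  also have "\<dots> = M * A * n" using M(1) G(2) by (simp add: real_sqrt_mult)
  also have "\<dots> \<le> M * A * N" using n M(1) G(2) by (intro mult_left_mono) auto
  finally show ?thesis .
qed

text \<open>Away from zero this is \<open>powr_convex\<close>; with one argument zero it reduces to
  \<open>a powr p \<le> a\<close> for a in (0,1).\<close>

lemma convex_on_powr_nonneg:
  assumes "p \<ge> 1" shows "convex_on {0..} (\<lambda>x::real. x powr p)"
proof (rule convex_onI)
  fix t x y :: real assume t: "0 < t" "t < 1" and xy: "x \<in> {0..}" "y \<in> {0..}"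
  have small: "a powr p \<le> a" if "0 < a" "a < 1" for a :: real
    using powr_mono'[of 1 p a] assms that by simp
  consider "x = 0" | "y = 0" | "x > 0" "y > 0" using xy by force
  then show "((1 - t) *\<^sub>R x + t *\<^sub>R y) powr p \<le> (1 - t) * x powr p + t * y powr p"
  proof cases
    case 1 then show ?thesis using small[of t] t xy by (simp add: powr_mult mult_right_mono)
  next
    case 2 then show ?thesis using small[of "1 - t"] t xy by (simp add: powr_mult mult_right_mono)
  next
    case 3 then show ?thesis using convex_onD[OF powr_convex[OF assms], of t x y] t by simp
  qed
qed simp

text \<open>Jensen's inequality with weights \<open>X i / S\<close> applied to
  \<open>S / X i * x i j\<close>: after summation over j, each i contributes at most its weight
  times \<open>S powr q\<close>.\<close>

lemma Minkowski_sum: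
  fixes x :: "'i \<Rightarrow> 'j \<Rightarrow> real"
  assumes "finite I" "I \<noteq> {}" "1 \<le> q" "\<And>i. i \<in> I \<Longrightarrow> 0 < X i" "\<And>i j. 0 \<le> x i j"
    and le: "\<And>i. i \<in> I \<Longrightarrow> (\<Sum>j\<in>J. x i j powr q) \<le> X i powr q"
  shows "(\<Sum>j\<in>J. (\<Sum>i\<in>I. x i j) powr q) \<le> (\<Sum>i\<in>I. X i) powr q"
proof -
  define S where "S = (\<Sum>i\<in>I. X i)"
  have S: "S > 0" unfolding S_def using assms by (intro sum_pos) auto
  have 1: "(\<Sum>i\<in>I. x i j) powr q \<le> (\<Sum>i\<in>I. X i / S * (S / X i * x i j) powr q)" for j
  proof -
    have "(\<Sum>i\<in>I. (X i / S) *\<^sub>R (S / X i * x i j)) powr q \<le> (\<Sum>i\<in>I. X i / S * (S / X i * x i j) powr q)"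
    proof (rule convex_on_sum[OF assms(1,2) convex_on_powr_nonneg[OF assms(3)]])
      show "(\<Sum>i\<in>I. X i / S) = 1" using S by (simp flip: sum_divide_distrib S_def)
      show "0 \<le> X i / S" if "i \<in> I" for i using assms(4)[OF that] S by simp
      show "S / X i * x i j \<in> {0..}" if "i \<in> I" for i using assms(4)[OF that] assms(5)[of i j] S by simp
    qed
    also have "(\<Sum>i\<in>I. (X i / S) *\<^sub>R (S / X i * x i j)) = (\<Sum>i\<in>I. x i j)"
      using assms(4) S by (intro sum.cong) force+
    finally show ?thesis .
  qed
  have "(\<Sum>j\<in>J. (\<Sum>i\<in>I. x i j) powr q) \<le> (\<Sum>j\<in>J. \<Sum>i\<in>I. X i / S * (S / X i * x i j) powr q)"
    by (intro sum_mono 1)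
  also have "\<dots> = (\<Sum>i\<in>I. \<Sum>j\<in>J. X i / S * (S / X i * x i j) powr q)" by (rule sum.swap)
  also have "\<dots> = (\<Sum>i\<in>I. X i / S * ((S / X i) powr q * (\<Sum>j\<in>J. x i j powr q)))"
    by (simp only: powr_mult sum_distrib_left mult.assoc)
  also have "\<dots> \<le> (\<Sum>i\<in>I. X i / S * ((S / X i) powr q * X i powr q))"
    using assms(4) S by (intro sum_mono mult_left_mono le) (auto intro: less_imp_le)
  also have "\<dots> = (\<Sum>i\<in>I. X i / S * S powr q)"
  proof (intro sum.cong refl)
    fix i assume i: "i \<in> I"
    have "(S / X i) powr q * X i powr q = (S / X i * X i) powr q" by (simp only: powr_mult)
    then show "X i / S * ((S / X i) powr q * X i powr q) = X i / S * S powr q"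
      using assms(4)[OF i] S by simp
  qed
  also have "\<dots> = S powr q" using S by (simp flip: sum_distrib_right sum_divide_distrib S_def)
  finally show ?thesis unfolding S_def .
qed

text \<open>The operator is telescoped along approximants \<open>F\<^sub>i\<close> of rank less than \<open>2^i\<close>; each difference contributes
  at most rank times a power of its norm, and these contributions grow geometrically because \<open>q < d\<close>.\<close>

lemma schatten_sum_bound:
  assumes R: "L2_bounded_operator \<mu> R"
    and C: "C > 0" "\<And>k. k \<ge> 1 \<Longrightarrow> approximation_number \<mu> R k < C * real k powr (-1/d)"
    and n: "n \<ge> 1" "0 < \<epsilon>" "\<epsilon> \<le> C" "approximation_number \<mu> R n < \<epsilon> * real n powr (-1/d)"
    and q: "1 \<le> q" "q < d" and J: "finite J"
    and L: "\<And>j. j \<in> J \<Longrightarrow> e j \<in> L2 \<mu>" "\<And>j. j \<in> J \<Longrightarrow> f j \<in> L2 \<mu>"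
      "\<And>j. j \<in> J \<Longrightarrow> L2_norm \<mu> (e j) \<le> 1" "\<And>j. j \<in> J \<Longrightarrow> L2_norm \<mu> (f j) \<le> 1"
    and M: "1 \<le> M" "\<And>c. (L2_norm \<mu> (\<lambda>x. \<Sum>j\<in>J. c j * e j x))\<^sup>2 \<le> M * (\<Sum>j\<in>J. (cmod (c j))\<^sup>2)"
      "\<And>u. u \<in> L2 \<mu> \<Longrightarrow> (\<Sum>j\<in>J. (cmod (ip \<mu> u (f j)))\<^sup>2) \<le> M * (L2_norm \<mu> u)\<^sup>2"
  shows "(\<Sum>j\<in>J. cmod (ip \<mu> (R (e j)) (f j)) powr q) \<le>
    (16 / (2 powr (1/q - 1/d) - 1) * M * C * real n powr (1/q - 1/d)
       + real (card J) powr (1/q) * \<epsilon> * real n powr (-1/d)) powr q"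
proof (cases "J = {}")
  case True then show ?thesis by simp
next
  case False
  define \<theta> where "\<theta> = 1/q - 1/d"
  have d: "d > 1" using q by linarith
  have "1 / q \<le> 1" "0 \<le> 1 / d" "1 / d < 1 / q" using q d by (auto intro: divide_strict_left_mono)
  then have th: "0 < \<theta>" "\<theta> \<le> 1" unfolding \<theta>_def by linarith+
  obtain I where I: "2 ^ I \<le> n" "n < 2 ^ (I + 1)"
    using ex_power_ivl1[of 2 n] n(1) by auto
  \<comment> \<open>Dyadic ranks up to \<open>2 ^ I\<close>, the largest power of 2 not above n,
    then n itself: every index beyond I stands for level n, and \<open>Suc I\<close> is the final
    stage, the one that knows \<epsilon>.\<close>
  define Q where "Q i F N \<longleftrightarrow> N < (if i \<le> I then 2 ^ i else n) \<and> L2_bounded_operator \<mu> F \<and> rank_le \<mu> N F \<and>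
      bounded_by \<mu> (\<lambda>f x. R f x - F f x) (if i \<le> I then C * (2 ^ i) powr (-1/d) else \<epsilon> * real n powr (-1/d))" for i F N
  have "\<exists>F N. Q i F N" for i
  proof (cases "i \<le> I")
    case True
    have "approximation_number \<mu> R (2^i) < C * (2 ^ i) powr (-1/d)" using C(2)[of "2^i"] by simp
    from approximation_numberD[OF R this] True show ?thesis unfolding Q_def by simp
  next
    case False
    from approximation_numberD[OF R n(4,1)] False show ?thesis unfolding Q_def by simp
  qed
  then have "\<forall>i. \<exists>F N. Q i F N" by blast
  from choice[OF this] obtain F where "\<forall>i. \<exists>N. Q i (F i) N" ..
  from choice[OF this] obtain N where QN: "\<forall>i. Q i (F i) (N i)" ..
  have FN: "\<And>i. N i < (if i \<le> I then 2 ^ i else n)" "\<And>i. rank_le \<mu> (N i) (F i)"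
    and FB: "\<And>i. L2_bounded_operator \<mu> (F i)"
      "\<And>i. bounded_by \<mu> (\<lambda>f x. R f x - F i f x) (if i \<le> I then C * (2 ^ i) powr (-1/d) else \<epsilon> * real n powr (-1/d))"
    using QN unfolding Q_def by blast+
  have FL: "F i h \<in> L2 \<mu>" if "h \<in> L2 \<mu>" for i h
    using FB(1)[of i] that unfolding L2_bounded_operator_iff by (auto dest: bounded_byD)
  have RL: "R h \<in> L2 \<mu>" if "h \<in> L2 \<mu>" for h
    using R that unfolding L2_bounded_operator_iff by (auto dest: bounded_byD)
  define P where "P i = (\<lambda>f x. F (Suc i) f x - F i f x)" for i
  have Pb: "bounded_by \<mu> (P i) (2 * C * (2 ^ i) powr (-1/d))" if i: "i \<le> I" for i
  proof -
    have 1: "bounded_by \<mu> (\<lambda>f x. R f x - F i f x) (C * (2 ^ i) powr (-1/d))" using FB(2)[of i] i by simp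
    have 2: "bounded_by \<mu> (\<lambda>f x. R f x - F (Suc i) f x) (C * (2 ^ i) powr (-1/d))"
    proof (cases "Suc i \<le> I")
      case True
      have "(2 ^ Suc i) powr (-1/d) \<le> (2 ^ i) powr (-1/d)"
        using d by (intro powr_mono2') (auto simp: divide_nonpos_pos)
      then show ?thesis using FB(2)[of "Suc i"] True C(1) by (auto intro: bounded_by_mono)
    next
      case False
      then have "i = I" using i by simp
      have "real n powr (-1/d) \<le> (2 ^ i) powr (-1/d)"
        using d I(1) \<open>i = I\<close> by (intro powr_mono2') (auto simp: divide_nonpos_pos numeral_power_le_of_nat_cancel_iff)
      then have "\<epsilon> * real n powr (-1/d) \<le> C * (2 ^ i) powr (-1/d)" using n C(1) by (intro mult_mono) auto
      then show ?thesis using FB(2)[of "Suc i"] False by (auto intro: bounded_by_mono)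
    qed
    show ?thesis using bounded_by_diff[OF 1 2] unfolding P_def by (simp add: mult.assoc)
  qed
  have Pr: "\<exists>k \<le> 4 * 2 ^ i. rank_le \<mu> k (P i)" if i: "i \<le> I" for i
  proof -
    \<comment> \<open>At \<open>i = I\<close> the next rank is below n, hence below
      \<open>2 ^ (I + 1)\<close>; the count \<open>4 * 2 ^ i\<close> covers both cases.\<close>
    have "N (Suc i) \<le> 2 ^ (i + 1)" using FN(1)[of "Suc i"] i I(2) by (auto split: if_splits simp: le_antisym not_less_eq_eq)
    moreover have "N i \<le> 2 ^ i" using FN(1)[of i] i by simp
    ultimately have "N (Suc i) + N i \<le> 4 * 2 ^ i" by simp
    then show ?thesis using rank_le_diff[OF FN(2)[of "Suc i"] FN(2)[of i]] unfolding P_def by blast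
  qed
  define D where "D = (\<lambda>f x. R f x - F (Suc I) f x)"
  have Db: "bounded_by \<mu> D (\<epsilon> * real n powr (-1/d))" using FB(2)[of "Suc I"] unfolding D_def by simp
  have F0: "ip \<mu> (F 0 h) g = 0" if h: "h \<in> L2 \<mu>" and g: "g \<in> L2 \<mu>" for h g
  proof -
    \<comment> \<open>A rank below \<open>2 ^ 0\<close> forces the zero operator modulo null sets,
      so the telescoping sum has no initial term.\<close>
    have "N 0 = 0" using FN(1)[of 0] by simp
    then have "AE x in \<mu>. F 0 h x = 0" using FN(2)[of 0] h unfolding rank_le_def by auto
    then have "ip \<mu> (F 0 h) g = ip \<mu> (\<lambda>x. 0) g" by (intro ip_cong FL h g) auto
    then show ?thesis by (simp add: ip_def)
  qed
  have tele: "ip \<mu> (R h) g = ip \<mu> (D h) g + (\<Sum>i\<le>I. ip \<mu> (P i h) g)" if h: "h \<in> L2 \<mu>" and g: "g \<in> L2 \<mu>" for h g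
  proof -
    have "(\<Sum>i\<le>I. ip \<mu> (P i h) g) = (\<Sum>i\<le>I. ip \<mu> (F (Suc i) h) g - ip \<mu> (F i h) g)"
      unfolding P_def by (intro sum.cong refl ip_diff FL h g)
    also have "\<dots> = ip \<mu> (F (Suc I) h) g - ip \<mu> (F 0 h) g"
      using sum_lessThan_telescope[of "\<lambda>i. ip \<mu> (F i h) g" "Suc I"] by (simp only: lessThan_Suc_atMost)
    finally show ?thesis using F0[OF h g] unfolding D_def by (simp add: ip_diff RL FL h g)
  qed
  have pc: "((2::real) ^ i) powr \<theta> = (2 powr \<theta>) ^ i" for i :: nat
    by (simp add: powr_realpow[symmetric] powr_powr mult.commute)
  define x where "x i j = (if i \<le> I then cmod (ip \<mu> (P i (e j)) (f j)) else cmod (ip \<mu> (D (e j)) (f j)))" for i j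
  \<comment> \<open>Target bounds for the q-norms of the rows of x. The factor 8 combines 4 from the
    rank of \<open>P i\<close> with 2 from its norm.\<close>
  define X where "X i = (if i \<le> I then 8 * M * C * (2 ^ i) powr \<theta> else real (card J) powr (1/q) * \<epsilon> * real n powr (-1/d))" for i
  have cJ: "card J > 0" using J False by (simp add: card_gt_0_iff)
  have each: "cmod (ip \<mu> (G (e j)) (f j)) \<le> A" if "bounded_by \<mu> G A" "0 \<le> A" "j \<in> J" for G A j
  proof -
    have "cmod (ip \<mu> (G (e j)) (f j)) \<le> L2_norm \<mu> (G (e j)) * L2_norm \<mu> (f j)"
      using that L bounded_byD(1)[OF that(1)] by (intro Cauchy_Schwarz_L2) auto
    also have "\<dots> \<le> (A * L2_norm \<mu> (e j)) * 1"
      using that L bounded_byD(2)[OF that(1)] by (intro mult_mono) auto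
    also have "\<dots> \<le> A" using that L(3)[of j] mult_left_mono[of "L2_norm \<mu> (e j)" 1 A] by simp
    finally show ?thesis .
  qed
  have le: "(\<Sum>j\<in>J. x i j powr q) \<le> X i powr q" if "i \<in> {..Suc I}" for i
  proof (cases "i \<le> I")
    case True
    obtain k where k: "k \<le> 4 * 2 ^ i" "rank_le \<mu> k (P i)" using Pr[OF True] by blast
    define A where "A = 2 * C * (2 ^ i) powr (-1/d)"
    have A: "A > 0" unfolding A_def using C by simp
    have b: "bounded_by \<mu> (P i) A" using Pb[OF True] unfolding A_def .
    \<comment> \<open>Of the q powers, q - 1 are spent on the operator norm; the sum of first powers
      that is left belongs to \<open>trace_bound\<close>.\<close>
    have "x i j powr q \<le> A powr (q - 1) * x i j" if "j \<in> J" for j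
    proof (cases "x i j = 0")
      case False
      then have pos: "x i j > 0" unfolding x_def by auto
      have "x i j \<le> A" unfolding x_def using True each[OF b _ that] A by simp
      then have "x i j powr (q - 1) \<le> A powr (q - 1)" using pos q by (intro powr_mono2) auto
      then have "x i j powr (q - 1) * x i j \<le> A powr (q - 1) * x i j" using pos by simp
      moreover have "x i j powr (q - 1) * x i j = x i j powr q"
        using pos powr_add[of "x i j" "q - 1" 1] by simp
      ultimately show ?thesis by simp
    qed simp
    then have "(\<Sum>j\<in>J. x i j powr q) \<le> A powr (q - 1) * (\<Sum>j\<in>J. x i j)"
      unfolding sum_distrib_left by (intro sum_mono) auto
    also have "\<dots> \<le> A powr (q - 1) * (M * A * (4 * 2 ^ i))"
    proof (rule mult_left_mono)
      have "real k \<le> real (4 * 2 ^ i)" using k(1) by (simp only: of_nat_le_iff)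
      then have "M * A * real k \<le> M * A * (4 * 2 ^ i)" using M(1) A by (intro mult_left_mono) simp_all
      moreover have "(\<Sum>j\<in>J. x i j) \<le> M * A * k"
        unfolding x_def using True trace_bound[OF b _ k(2) J L(1,2) _ M(2,3)] A M(1) by simp
      ultimately show "(\<Sum>j\<in>J. x i j) \<le> M * A * (4 * 2 ^ i)" by (rule order_trans[rotated])
    qed simp
    also have "\<dots> = (M * 4) * 2 ^ i * A powr q"
      using A powr_add[of A "q - 1" 1] by (simp add: algebra_simps)
    \<comment> \<open>As \<open>M * 4\<close> is at least 1, it may be raised to the power q, which
      turns the whole bound into a q-th power.\<close>
    also have "\<dots> \<le> (M * 4) powr q * 2 ^ i * A powr q"
      using M(1) q powr_mono[of 1 q "M * 4"] by (intro mult_right_mono) auto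
    also have "\<dots> = X i powr q"
    proof -
      have "((2::real) ^ i) powr \<theta> = (2 ^ i) powr (1/q) * (2 ^ i) powr (-1/d)"
        unfolding \<theta>_def by (simp flip: powr_add)
      then have "X i = (M * 4) * (2 ^ i) powr (1/q) * A" unfolding X_def A_def using True by simp
      then have "X i powr q = (M * 4) powr q * ((2 ^ i) powr (1/q)) powr q * A powr q" by (simp only: powr_mult)
      then show ?thesis using q by (simp add: powr_powr)
    qed
    finally show ?thesis .
  next
    case False
    define B where "B = \<epsilon> * real n powr (-1/d)"
    have B: "B \<ge> 0" "bounded_by \<mu> D B" unfolding B_def using n Db by auto
    have "(\<Sum>j\<in>J. x i j powr q) \<le> (\<Sum>j\<in>J. B powr q)"
      using False each[OF B(2,1)] q by (intro sum_mono powr_mono2) (auto simp: x_def)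
    also have "\<dots> = real (card J) * B powr q" by simp
    also have "\<dots> = X i powr q"
      unfolding X_def using False q cJ by (simp add: powr_mult powr_powr B_def)
    finally show ?thesis .
  qed
  have "(\<Sum>j\<in>J. cmod (ip \<mu> (R (e j)) (f j)) powr q) \<le> (\<Sum>j\<in>J. (\<Sum>i\<in>{..Suc I}. x i j) powr q)"
  proof (intro sum_mono powr_mono2)
    fix j assume j: "j \<in> J"
    have "cmod (ip \<mu> (R (e j)) (f j)) \<le> cmod (ip \<mu> (D (e j)) (f j)) + (\<Sum>i\<le>I. cmod (ip \<mu> (P i (e j)) (f j)))"
      unfolding tele[OF L(1)[OF j] L(2)[OF j]] by (intro order_trans[OF norm_triangle_ineq] add_mono order_refl norm_sum)
    also have "\<dots> = (\<Sum>i\<in>{..Suc I}. x i j)" by (simp add: x_def)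
    finally show "cmod (ip \<mu> (R (e j)) (f j)) \<le> (\<Sum>i\<in>{..Suc I}. x i j)" .
  qed (use q in auto)
  also have "\<dots> \<le> (\<Sum>i\<in>{..Suc I}. X i) powr q"
  proof (rule Minkowski_sum)
    show "0 < X i" if "i \<in> {..Suc I}" for i
      unfolding X_def using M(1) C(1) n cJ by auto
    show "0 \<le> x i j" for i j by (simp add: x_def)
  qed (use q le in auto)
  also have "(\<Sum>i\<in>{..Suc I}. X i) = 8 * M * C * (\<Sum>i\<le>I. (2 powr \<theta>) ^ i) + real (card J) powr (1/q) * \<epsilon> * real n powr (-1/d)"
    unfolding X_def by (simp add: sum_distrib_left pc)
  also have "(\<dots>) powr q \<le> (16 / (2 powr \<theta> - 1) * M * C * real n powr \<theta> + real (card J) powr (1/q) * \<epsilon> * real n powr (-1/d)) powr q"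
  proof (intro powr_mono2 add_mono order_refl)
    \<comment> \<open>A geometric sum with ratio above 1 is at most r / (r - 1) times its last term;
      r \<le> 2 turns 8 into 16.\<close>
    define r where "r = 2 powr \<theta>"
    have r: "r > 1" "r \<le> 2" unfolding r_def using th powr_mono[of \<theta> 1 2] by auto
    have "(\<Sum>i\<le>I. r ^ i) = (r ^ Suc I - 1) / (r - 1)"
      using geometric_sum[of r "Suc I"] r by (simp add: lessThan_Suc_atMost)
    also have "\<dots> \<le> r * r ^ I / (r - 1)" using r by (intro divide_right_mono) auto
    also have "\<dots> \<le> 2 * real n powr \<theta> / (r - 1)"
    proof (intro divide_right_mono mult_mono)
      have "r ^ I = (2 ^ I) powr \<theta>" unfolding r_def by (simp add: pc)
      also have "\<dots> \<le> real n powr \<theta>" using th I(1) by (intro powr_mono2) (auto simp: numeral_power_le_of_nat_cancel_iff)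
      finally show "r ^ I \<le> real n powr \<theta>" .
    qed (use r in auto)
    finally have "8 * M * C * (\<Sum>i\<le>I. r ^ i) \<le> 8 * M * C * (2 * real n powr \<theta> / (r - 1))"
      using M(1) C(1) by (intro mult_left_mono) auto
    then show "8 * M * C * (\<Sum>i\<le>I. (2 powr \<theta>) ^ i) \<le> 16 / (2 powr \<theta> - 1) * M * C * real n powr \<theta>"
      unfolding r_def by (simp add: field_simps)
  qed (use q M C n in \<open>auto intro!: add_nonneg_nonneg mult_nonneg_nonneg sum_nonneg\<close>)
  finally show ?thesis unfolding \<theta>_def .
qed

subsection \<open>Doubling measures\<close>

lemma doubling_sets: "doubling_measure \<mu> \<Longrightarrow> sets \<mu> = sets borel"
  by (simp add: doubling_measure_def)

lemma doubling_space: "doubling_measure \<mu> \<Longrightarrow> space \<mu> = UNIV"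
  using sets_eq_imp_space_eq[of \<mu> borel] by (simp add: doubling_sets)

lemma doubling_ball_fmeasurable: "doubling_measure \<mu> \<Longrightarrow> ball x r \<in> fmeasurable \<mu>"
  by (cases "r > 0") (auto simp: doubling_measure_def fmeasurable_def ball_empty top.not_eq_extremum)

lemma doubling_ball_pos: "doubling_measure \<mu> \<Longrightarrow> r > 0 \<Longrightarrow> 0 < measure \<mu> (ball x r)"
  unfolding doubling_measure_def measure_def
  by (metis enn2real_positive_iff infinity_ennreal_def)

lemma doubling_subset_fmeasurable:
  assumes "doubling_measure \<mu>" "A \<in> sets borel" "A \<subseteq> ball x r" shows "A \<in> fmeasurable \<mu>"
  using fmeasurableI2[OF doubling_ball_fmeasurable[OF assms(1)] assms(3)] assms doubling_sets by blast

lemma doubling_measure_mono: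
  assumes "doubling_measure \<mu>" "A \<in> sets borel" "B \<in> sets borel" "A \<subseteq> B" "B \<subseteq> ball x r"
  shows "measure \<mu> A \<le> measure \<mu> B"
  using assms doubling_sets[OF assms(1)]
  by (intro measure_mono_fmeasurable doubling_subset_fmeasurable) auto

lemma doubling_ball_mono:
  assumes "doubling_measure \<mu>" "ball x r \<subseteq> ball y s"
  shows "measure \<mu> (ball x r) \<le> measure \<mu> (ball y s)"
  using assms by (intro doubling_measure_mono[OF assms(1)]) auto

lemma doubling_constant:
  assumes "doubling_measure \<mu>"
  obtains D where "D \<ge> 1" "\<And>x r. r > 0 \<Longrightarrow> measure \<mu> (ball x (2 * r)) \<le> D * measure \<mu> (ball x r)"
proof -
  obtain C where C: "\<And>x r. r > 0 \<Longrightarrow> measure \<mu> (ball x (2 * r)) \<le> C * measure \<mu> (ball x r)"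
    using assms unfolding doubling_measure_def by blast
  have "measure \<mu> (ball x (2 * r)) \<le> max C 1 * measure \<mu> (ball x r)" if "r > 0" for x r
    using C[OF that, of x] by (meson max.cobounded1 measure_nonneg mult_right_mono order_trans)
  then show ?thesis using that[of "max C 1"] by simp
qed

lemma ball_subset_ballI: "dist x y + r \<le> s \<Longrightarrow> ball x r \<subseteq> ball y s"
  for x y :: "'a::metric_space"
proof
  fix z assume "dist x y + r \<le> s" "z \<in> ball x r"
  then show "z \<in> ball y s" using dist_triangle[of y z x] by (simp add: dist_commute)
qed

text \<open>Iterated doubling: \<open>ball x R\<close> lies in the ball about y of radius
  \<open>2 ^ k * r\<close> as soon as \<open>a < 2 ^ k\<close>, so the constant depends on a and
  \<mu> alone.\<close>

lemma doubling_ball_ratio: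
  fixes \<mu> :: "'a::metric_space measure"
  assumes "doubling_measure \<mu>"
  obtains D where "D \<ge> 1"
    "\<And>(x::'a) y r R. r > 0 \<Longrightarrow> dist x y + R \<le> a * r \<Longrightarrow> measure \<mu> (ball x R) \<le> D * measure \<mu> (ball y r)"
proof -
  obtain D where D: "D \<ge> 1" "\<And>x r. r > 0 \<Longrightarrow> measure \<mu> (ball x (2 * r)) \<le> D * measure \<mu> (ball x r)"
    using doubling_constant[OF assms] by blast
  have pow: "measure \<mu> (ball x (2 ^ k * r)) \<le> D ^ k * measure \<mu> (ball x r)" if r: "r > 0" for x r k
  proof (induction k)
    case (Suc k)
    have "measure \<mu> (ball x (2 ^ Suc k * r)) \<le> D * measure \<mu> (ball x (2 ^ k * r))"
      using D(2)[of "2 ^ k * r" x] r by (simp add: mult.assoc)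
    also have "\<dots> \<le> D * (D ^ k * measure \<mu> (ball x r))" using Suc D(1) by (intro mult_left_mono) auto
    finally show ?case by simp
  qed simp
  obtain k where k: "a < 2 ^ k" using real_arch_pow[of 2 a] by auto
  have "measure \<mu> (ball x R) \<le> D ^ k * measure \<mu> (ball y r)" if "r > 0" "dist x y + R \<le> a * r" for x y r R
  proof -
    have "a * r \<le> 2 ^ k * r" using k that by (intro mult_right_mono) auto
    then have "ball x R \<subseteq> ball y (2 ^ k * r)"
      using that(2) by (intro ball_subset_ballI) simp
    then show ?thesis
      using doubling_ball_mono[OF assms] pow[OF that(1)] order_trans by blast
  qed
  then show ?thesis using that[of "D ^ k"] D(1) by (simp add: one_le_power)
qed

section \<open>Regularity of finite Borel measures\<close>

text \<open>The points of depth r in U form a closed set, because the complement is the union of the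
  balls of radius r centred outside U.\<close>

lemma open_shrink:
  fixes U :: "'a::metric_space set"
  assumes "open U"
  shows "closed {x. ball x r \<subseteq> U}" "(\<Union>n::nat. {x. ball x (1 / Suc n) \<subseteq> U}) = U"
proof -
  have "- {x. ball x r \<subseteq> U} = (\<Union>y\<in>-U. ball y r)" by (auto simp: dist_commute)
  then show "closed {x. ball x r \<subseteq> U}" by (simp add: closed_def open_UN)
  have "x \<in> (\<Union>n::nat. {x. ball x (1 / Suc n) \<subseteq> U})" if "x \<in> U" for x
  proof -
    note xU = that
    obtain e where e: "e > 0" "ball x e \<subseteq> U" using openE[OF assms xU] .
    obtain n where "inverse (real (Suc n)) < e" using reals_Archimedean[OF e(1)] by auto
    then have "ball x (1 / Suc n) \<subseteq> ball x e" by (intro subset_ball) (simp add: inverse_eq_divide)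
    then show ?thesis using e(2) by auto
  qed
  moreover have "x \<in> U" if "ball x (1 / real (Suc n)) \<subseteq> U" for x n
    using that centre_in_ball[of x "1 / real (Suc n)"] by auto
  ultimately show "(\<Union>n::nat. {x. ball x (1 / Suc n) \<subseteq> U}) = U" by auto
qed

lemma measure_diff_shrink:
  fixes M :: "'a::metric_space measure"
  assumes "finite_measure M" "sets M = sets borel" "open U" "e > 0"
  shows "\<exists>n::nat. measure M (U - {x. ball x (1 / Suc n) \<subseteq> U}) < e"
proof -
  interpret finite_measure M by fact
  let ?A = "\<lambda>n::nat. U - {x. ball x (1 / Suc n) \<subseteq> U}"
  have "closed {x. ball x (1 / Suc n) \<subseteq> U}" for n :: nat by (rule open_shrink[OF assms(3)])
  then have "range ?A \<subseteq> sets M" using assms by auto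
  moreover have "decseq ?A"
  proof (rule decseq_SucI)
    fix n :: nat
    have "ball x (1 / Suc (Suc n)) \<subseteq> ball x (1 / Suc n)" for x :: 'a
      by (intro subset_ball) (simp add: frac_le)
    then show "?A (Suc n) \<subseteq> ?A n" by blast
  qed
  ultimately have "(\<lambda>n. measure M (?A n)) \<longlonglongrightarrow> measure M (\<Inter>n. ?A n)"
    by (rule finite_Lim_measure_decseq)
  moreover have "(\<Inter>n. ?A n) = {}" using open_shrink(2)[OF assms(3)] by blast
  ultimately have "(\<lambda>n. measure M (?A n)) \<longlonglongrightarrow> 0" by (simp only: measure_empty)
  then have "eventually (\<lambda>n. measure M (?A n) < e) sequentially"
    by (rule order_tendstoD(2)) (rule assms(4))
  then show ?thesis by (auto simp: eventually_sequentially)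
qed

text \<open>Induction over the sigma-algebra generated by the open sets. Open sets are approximated
  from inside by \<open>measure_diff_shrink\<close>, a complement exchanges U and F, and of a
  countable union only finitely many of the closed sets are kept, since an infinite union of them
  need not be closed.\<close>

lemma finite_borel_regular:
  fixes M :: "'a::metric_space measure"
  assumes fin: "finite_measure M" and s: "sets M = sets borel" and A: "A \<in> sets borel" and "e > 0"
  shows "\<exists>U F. open U \<and> closed F \<and> F \<subseteq> A \<and> A \<subseteq> U \<and> measure M (U - F) < e"
proof -
  interpret finite_measure M by (rule fin)
  have "A \<in> sigma_sets UNIV {S. open S}" using A by (simp add: borel_def)
  then show ?thesis using \<open>e > 0\<close>
  proof (induction A arbitrary: e rule: sigma_sets.induct)
    case (Basic U)
    then have o: "open U" by simp
    then obtain n :: nat where n: "measure M (U - {x. ball x (1 / Suc n) \<subseteq> U}) < e"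
      using measure_diff_shrink[OF fin s o Basic(2)] by blast
    moreover have "{x. ball x (1 / Suc n) \<subseteq> U} \<subseteq> U" using open_shrink(2)[OF o] by blast
    ultimately show ?case using o open_shrink(1)[OF o] by blast
  next
    case Empty then show ?case by (intro exI[of _ "{}"]) auto
  next
    case (Compl A)
    obtain U F where UF: "open U" "closed F" "F \<subseteq> A" "A \<subseteq> U" "measure M (U - F) < e"
      using Compl.IH[OF Compl.prems] by blast
    have "- F - (- U) = U - F" by auto
    then show ?case using UF by (intro exI[of _ "- F"] exI[of _ "- U"]) (auto simp: Compl_eq_Diff_UNIV[symmetric])
  next
    case (Union a)
    \<comment> \<open>These gaps add up to e / 2, strictly below e, which leaves room for truncating
      the union of the closed sets.\<close>
    have "0 < e / 4 * (1/2) ^ i" for i :: nat using Union.prems by simp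
    from Union.IH[OF this]
    have "\<forall>i. \<exists>U F. open U \<and> closed F \<and> F \<subseteq> a i \<and> a i \<subseteq> U \<and> measure M (U - F) < e / 4 * (1/2) ^ i"
      by blast
    then obtain U F where UF: "\<And>i. open (U i)" "\<And>i. closed (F i)" "\<And>i. F i \<subseteq> a i" "\<And>i. a i \<subseteq> U i"
      "\<And>i. measure M (U i - F i) < e / 4 * (1/2) ^ i" by metis
    have m: "U i \<in> sets M" "F i \<in> sets M" for i using UF s by auto
    let ?U = "\<Union>i. U i" and ?F = "\<lambda>n. \<Union>i<n. F i"
    have "(\<lambda>n. measure M (?U - ?F n)) \<longlonglongrightarrow> measure M (\<Inter>n. ?U - ?F n)"
      using m by (intro finite_Lim_measure_decseq) (auto intro!: decseq_SucI)
    moreover have "measure M (\<Inter>n. ?U - ?F n) < e"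
    proof -
      have sm: "summable (\<lambda>i. e / 4 * (1/2) ^ i)" by (intro summable_mult summable_geometric) auto
      have sm': "summable (\<lambda>i. measure M (U i - F i))"
        by (rule summable_comparison_test[OF _ sm]) (use UF(5) in \<open>auto intro!: exI[of _ 0] less_imp_le\<close>)
      have "measure M (\<Inter>n. ?U - ?F n) \<le> measure M (\<Union>i. U i - F i)"
      proof (rule finite_measure_mono)
        show "(\<Inter>n. ?U - ?F n) \<subseteq> (\<Union>i. U i - F i)"
        proof
          fix x assume x: "x \<in> (\<Inter>n. ?U - ?F n)"
          then obtain i where i: "x \<in> U i" by auto
          have "x \<notin> ?F (Suc i)" using x by blast
          then have "x \<notin> F i" by blast
          then show "x \<in> (\<Union>i. U i - F i)" using i by blast
        qed
      qed (use m in auto)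
      also have "\<dots> \<le> (\<Sum>i. measure M (U i - F i))"
        using m sm' by (intro finite_measure_subadditive_countably) auto
      also have "\<dots> \<le> (\<Sum>i. e / 4 * (1/2) ^ i)"
        using UF(5) by (intro suminf_le sm sm') (auto intro: less_imp_le)
      also have "\<dots> = e / 2" by (subst suminf_mult) (auto simp: suminf_geometric)
      finally show ?thesis using Union.prems by simp
    qed
    ultimately have "eventually (\<lambda>n. measure M (?U - ?F n) < e) sequentially" by (rule order_tendstoD)
    then obtain n where n: "measure M (?U - ?F n) < e" by (auto simp: eventually_sequentially)
    have "open ?U" "closed (?F n)" "?F n \<subseteq> \<Union> (range a)" "\<Union> (range a) \<subseteq> ?U"
      using UF by (auto intro!: closed_UN) blast+
    then show ?case using n by blast
  qed
qed

text \<open>Restriction to a ball by a density keeps the Borel sets of the whole space, so that the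
  results on finite measures apply.\<close>

lemma doubling_restrict_finite:
  assumes "doubling_measure \<mu>"
  shows "finite_measure (density \<mu> (indicator (ball x r)))"
    "sets (density \<mu> (indicator (ball x r))) = sets borel"
    "\<And>A. A \<in> sets borel \<Longrightarrow> measure (density \<mu> (indicator (ball x r))) A = measure \<mu> (ball x r \<inter> A)"
proof -
  have m: "ball x r \<in> sets \<mu>" using doubling_sets[OF assms] by simp
  have e: "emeasure (density \<mu> (indicator (ball x r))) A = emeasure \<mu> (ball x r \<inter> A)" if "A \<in> sets borel" for A
    using m that doubling_sets[OF assms] borel_measurable_indicator[OF m]
    by (subst emeasure_density) (auto simp: mult.commute indicator_inter_arith[symmetric] Int_commute)
  show s: "sets (density \<mu> (indicator (ball x r))) = sets borel" by (simp add: doubling_sets[OF assms])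
  show "finite_measure (density \<mu> (indicator (ball x r)))"
    using doubling_ball_fmeasurable[OF assms, of x r]
    by (intro finite_measureI) (simp add: e doubling_space[OF assms] fmeasurable_def less_top[symmetric])
  show "measure (density \<mu> (indicator (ball x r))) A = measure \<mu> (ball x r \<inter> A)" if "A \<in> sets borel" for A
    unfolding measure_def e[OF that] ..
qed

section \<open>Separated nets\<close>

definition separated :: "real \<Rightarrow> 'a::metric_space set \<Rightarrow> bool" where
  "separated s J \<longleftrightarrow> (\<forall>i\<in>J. \<forall>j\<in>J. i \<noteq> j \<longrightarrow> s \<le> dist i j)"

lemma separated_subset: "separated s J \<Longrightarrow> I \<subseteq> J \<Longrightarrow> separated s I"
  unfolding separated_def by blast

lemma separated_disjoint_balls:
  assumes "separated s J" shows "disjoint_family_on (\<lambda>j. ball j (s / 2)) J"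
  unfolding disjoint_family_on_def
proof (intro ballI impI)
  fix i j assume "i \<in> J" "j \<in> J" "i \<noteq> j"
  then have "s \<le> dist i j" using assms unfolding separated_def by blast
  then show "ball i (s / 2) \<inter> ball j (s / 2) = {}" by (intro disjoint_ballI) simp
qed

text \<open>Packing by volume: the balls of radius s / 2 about the points are disjoint and lie in
  the enlarged ball.\<close>

lemma separated_card:
  assumes "doubling_measure \<nu>" "\<And>x r. r > 0 \<Longrightarrow> c * r powr d \<le> measure \<nu> (ball x r)"
    and "finite J" "separated s J" "s > 0" "J \<subseteq> ball x R"
  shows "real (card J) * (c * (s / 2) powr d) \<le> measure \<nu> (ball x (R + s / 2))"
proof -
  have "real (card J) * (c * (s / 2) powr d) = (\<Sum>j\<in>J. c * (s / 2) powr d)" by simp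
  also have "\<dots> \<le> (\<Sum>j\<in>J. measure \<nu> (ball j (s / 2)))"
    using assms by (intro sum_mono) auto
  also have "\<dots> = measure \<nu> (\<Union>j\<in>J. ball j (s / 2))"
  proof (rule measure_finite_Union[symmetric])
    show "emeasure \<nu> (ball j (s / 2)) \<noteq> \<infinity>" for j
      using doubling_ball_fmeasurable[OF assms(1), of j "s/2"] by (simp add: fmeasurable_def top.not_eq_extremum)
  qed (use assms(3,4) separated_disjoint_balls doubling_sets[OF assms(1)] in auto)
  also have "\<dots> \<le> measure \<nu> (ball x (R + s / 2))"
  proof (rule doubling_measure_mono[OF assms(1)])
    show "(\<Union>j\<in>J. ball j (s / 2)) \<subseteq> ball x (R + s / 2)"
    proof (rule UN_least)
      fix j assume "j \<in> J"
      then have "dist x j < R" using assms(6) by auto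
      then show "ball j (s / 2) \<subseteq> ball x (R + s / 2)" by (intro ball_subset_ballI) (simp add: dist_commute)
    qed
  qed (auto intro!: borel_open open_UN)
  finally show ?thesis .
qed

text \<open>Packing caps the cardinality, so a separated subset with the most points exists. It
  cannot be extended, and that is the covering property.\<close>

lemma ex_maximal_separated:
  fixes \<nu> :: "'a::metric_space measure" and S :: "'a set"
  assumes "doubling_measure \<nu>" "ahlfors_regular d \<nu>" "S \<subseteq> ball x R" "s > 0"
  obtains J where "finite J" "J \<subseteq> S" "separated s J" "\<And>y. y \<in> S \<Longrightarrow> \<exists>j\<in>J. dist j y < s"
proof -
  obtain c where c: "c > 0" "\<And>(x::'a) r. r > 0 \<Longrightarrow> c * r powr d \<le> measure \<nu> (ball x r)"
    using assms(2) unfolding ahlfors_regular_def by blast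
  let ?P = "\<lambda>J. finite J \<and> J \<subseteq> S \<and> separated s J"
  obtain N :: nat where N: "measure \<nu> (ball x (R + s / 2)) / (c * (s / 2) powr d) < real N"
    using reals_Archimedean2 by blast
  have "card J \<le> N" if J: "?P J" for J
  proof -
    have "real (card J) * (c * (s / 2) powr d) \<le> measure \<nu> (ball x (R + s / 2))"
      using J assms c by (intro separated_card[OF assms(1)]) auto
    moreover have "c * (s / 2) powr d > 0" using c assms by simp
    ultimately have "real (card J) \<le> measure \<nu> (ball x (R + s / 2)) / (c * (s / 2) powr d)"
      by (simp add: pos_le_divide_eq)
    then show ?thesis using N by linarith
  qed
  moreover have "?P {}" by (simp add: separated_def)
  ultimately have "\<exists>J. ?P J \<and> (\<forall>I. ?P I \<longrightarrow> card I \<le> card J)"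
    by (intro ex_has_greatest_nat[of ?P "{}" card "Suc N"]) (auto simp: less_Suc_eq_le)
  then obtain J where J: "?P J" "\<And>I. ?P I \<Longrightarrow> card I \<le> card J"
    by (elim exE conjE) blast
  have "\<exists>j\<in>J. dist j y < s" if y: "y \<in> S" for y
  proof (rule ccontr)
    assume "\<not> ?thesis"
    then have far: "\<And>j. j \<in> J \<Longrightarrow> s \<le> dist j y" by force
    then have "y \<notin> J" using assms(4) by force
    moreover have "?P (insert y J)" using J(1) y far unfolding separated_def by (auto simp: dist_commute)
    ultimately show False using J(2)[of "insert y J"] J(1) by simp
  qed
  then show ?thesis using that[of J] J(1) by blast
qed

text \<open>Replaces Lebesgue's density theorem, and with it any covering lemma for balls of varying radii.\<close>

lemma single_scale_density:
  fixes \<mu> \<nu> :: "'a::metric_space measure"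
  assumes "doubling_measure \<nu>" "ahlfors_regular d \<nu>" and \<mu>: "doubling_measure \<mu>"
    and E: "E \<in> sets borel" "E \<subseteq> ball x\<^sub>0 R" and "\<theta> > 0" "\<eta> > 0"
  obtains r\<^sub>0 where "r\<^sub>0 > 0" "\<And>r. 0 < r \<Longrightarrow> r < r\<^sub>0 \<Longrightarrow> \<exists>W\<in>sets borel. measure \<mu> W < \<eta> \<and> W \<in> fmeasurable \<mu> \<and>
      (\<forall>x\<in>E - W. measure \<mu> (ball x r - E) \<le> \<theta> * measure \<mu> (ball x r))"
proof -
  obtain D where D: "D \<ge> 1" "\<And>x r. r > 0 \<Longrightarrow> measure \<mu> (ball x (2 * r)) \<le> D * measure \<mu> (ball x r)"
    using doubling_constant[OF \<mu>] by blast
  let ?B = "ball x\<^sub>0 R" let ?M = "density \<mu> (indicator ?B)"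
  have fM: "finite_measure ?M" by (rule doubling_restrict_finite[OF \<mu>])
  note sM = doubling_restrict_finite(2)[OF \<mu>, of x\<^sub>0 R]
  \<comment> \<open>The covering argument below loses a factor D / \<theta>, so this \<tau> makes it
    cost \<eta> / 2. The other half of \<eta> goes to the points of U that are not deep.\<close>
  define \<tau> where "\<tau> = \<eta> * \<theta> / (2 * D)"
  have "\<tau> > 0" unfolding \<tau>_def using assms D by simp
  from finite_borel_regular[OF fM sM E(1) this]
  obtain V F where VF: "open V" "closed F" "F \<subseteq> E" "E \<subseteq> V" "measure ?M (V - F) < \<tau>"
    by (elim exE conjE)
  define U where "U = ?B \<inter> V"
  have U: "open U" "E \<subseteq> U" "U \<subseteq> ?B" using VF E unfolding U_def by auto
  have UE: "measure \<mu> (U - E) < \<tau>"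
  proof -
    have "measure \<mu> (U - E) \<le> measure \<mu> (?B \<inter> (V - F))"
      using VF E by (intro doubling_measure_mono[OF \<mu>, where x=x\<^sub>0 and r=R]) (auto simp: U_def)
    also have "\<dots> = measure ?M (V - F)" using VF by (subst doubling_restrict_finite(3)[OF \<mu>]) auto
    finally show ?thesis using VF(5) by simp
  qed
  obtain n :: nat where n: "measure ?M (U - {x. ball x (1 / Suc n) \<subseteq> U}) < \<eta> / 2"
    using measure_diff_shrink[OF fM sM U(1), of "\<eta> / 2"] \<open>\<eta> > 0\<close> by auto
  define G where "G = {x. ball x (1 / Suc n) \<subseteq> U}"
  have cG: "closed G" unfolding G_def by (rule open_shrink[OF U(1)])
  have UG: "measure \<mu> (U - G) < \<eta> / 2"
  proof -
    have "?B \<inter> (U - G) = U - G" using U(3) by blast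
    moreover have "measure ?M (U - G) = measure \<mu> (?B \<inter> (U - G))"
      using U(1) cG by (intro doubling_restrict_finite(3)[OF \<mu>]) auto
    ultimately show ?thesis using n unfolding G_def[symmetric] by simp
  qed
  show ?thesis
  proof (rule that[of "1 / Suc n"])
    fix r :: real assume r: "0 < r" "r < 1 / Suc n"
    \<comment> \<open>Bad points deep in U: the ball of radius r about such a point stays in U and
      has more than the proportion \<theta> of its measure in U - E, a set of measure below
      \<tau>.\<close>
    define S where "S = {x \<in> E \<inter> G. measure \<mu> (ball x r - E) > \<theta> * measure \<mu> (ball x r)}"
    have "S \<subseteq> ball x\<^sub>0 R" using E unfolding S_def by auto
    \<comment> \<open>Separation 2 r makes the balls of radius r disjoint and the balls of radius 2
      r a cover of S; doubling at the common radius r links the two.\<close>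
    then obtain J where J: "finite J" "J \<subseteq> S" "separated (2 * r) J" "\<And>y. y \<in> S \<Longrightarrow> \<exists>j\<in>J. dist j y < 2 * r"
      using ex_maximal_separated[OF assms(1,2), of S x\<^sub>0 R "2 * r"] r by auto
    define W where "W = (U - G) \<union> (\<Union>j\<in>J. ball j (2 * r))"
    have bU: "ball j r \<subseteq> U" if "j \<in> J" for j
    proof -
      have "ball j r \<subseteq> ball j (1 / Suc n)" using r by (intro subset_ball) simp
      then show ?thesis using that J(2) unfolding S_def G_def by blast
    qed
    have fm: "ball j r - E \<in> fmeasurable \<mu>" for j
      using E by (intro doubling_subset_fmeasurable[OF \<mu>, where x=j and r=r]) auto
    have "measure \<mu> (\<Union>j\<in>J. ball j (2 * r)) \<le> (\<Sum>j\<in>J. measure \<mu> (ball j (2 * r)))"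
      using J(1) doubling_sets[OF \<mu>] by (intro measure_UNION_le) auto
    also have "\<dots> \<le> (\<Sum>j\<in>J. D / \<theta> * measure \<mu> (ball j r - E))"
    proof (intro sum_mono)
      fix j assume "j \<in> J"
      then have "\<theta> * measure \<mu> (ball j r) \<le> measure \<mu> (ball j r - E)" using J(2) unfolding S_def by auto
      then have "D * measure \<mu> (ball j r) \<le> D * (measure \<mu> (ball j r - E) / \<theta>)"
        using D(1) \<open>\<theta> > 0\<close> by (intro mult_left_mono) (auto simp: pos_le_divide_eq mult.commute)
      then show "measure \<mu> (ball j (2 * r)) \<le> D / \<theta> * measure \<mu> (ball j r - E)"
        using D(2)[OF r(1), of j] by simp
    qed
    also have "\<dots> = D / \<theta> * measure \<mu> (\<Union>j\<in>J. ball j r - E)"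
    proof -
      have "measure \<mu> (\<Union>j\<in>J. ball j r - E) = (\<Sum>j\<in>J. measure \<mu> (ball j r - E))"
      proof (rule measure_finite_Union[OF J(1)])
        have "disjoint_family_on (\<lambda>j. ball j r) J" using separated_disjoint_balls[OF J(3)] by simp
        then show "disjoint_family_on (\<lambda>j. ball j r - E) J" unfolding disjoint_family_on_def by blast
        show "emeasure \<mu> (ball j r - E) \<noteq> \<infinity>" for j using fmeasurableD2[OF fm[of j]] by simp
      qed (use fm in \<open>auto simp: fmeasurable_def\<close>)
      then show ?thesis by (simp add: sum_distrib_left)
    qed
    also have "\<dots> \<le> D / \<theta> * measure \<mu> (U - E)"
    proof (intro mult_left_mono doubling_measure_mono[OF \<mu>, where x=x\<^sub>0 and r=R])
      have "(\<Union>j\<in>J. ball j r) - E \<in> sets borel" by (intro sets.Diff E(1) borel_open open_UN) auto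
      then show "(\<Union>j\<in>J. ball j r - E) \<in> sets borel" by simp
    qed (use D(1) \<open>\<theta> > 0\<close> bU U E J(1) in auto)
    also have "\<dots> \<le> D / \<theta> * \<tau>"
      using UE D(1) \<open>\<theta> > 0\<close> by (intro mult_left_mono) auto
    also have "\<dots> = \<eta> / 2" unfolding \<tau>_def using D(1) \<open>\<theta> > 0\<close> by simp
    finally have balls: "measure \<mu> (\<Union>j\<in>J. ball j (2 * r)) \<le> \<eta> / 2" .
    have fW: "U - G \<in> fmeasurable \<mu>" "(\<Union>j\<in>J. ball j (2 * r)) \<in> fmeasurable \<mu>"
      using U cG J(1) by (auto intro!: doubling_subset_fmeasurable[OF \<mu>, where x=x\<^sub>0 and r=R] fmeasurable.finite_UN doubling_ball_fmeasurable[OF \<mu>])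
    have "measure \<mu> W \<le> measure \<mu> (U - G) + measure \<mu> (\<Union>j\<in>J. ball j (2 * r))"
      unfolding W_def using fW by (intro measure_Un_le) (auto simp: fmeasurable_def)
    then have "measure \<mu> W < \<eta>" using UG balls by simp
    moreover have "W \<in> fmeasurable \<mu>" unfolding W_def using fW by (rule fmeasurable.Un)
    moreover have "W \<in> sets borel" using calculation(2) doubling_sets[OF \<mu>] by (auto simp: fmeasurable_def)
    moreover have "measure \<mu> (ball x r - E) \<le> \<theta> * measure \<mu> (ball x r)" if x: "x \<in> E - W" for x
    proof (rule ccontr)
      assume n: "\<not> ?thesis"
      have "x \<in> G" using x U(2) unfolding W_def by blast
      then have "x \<in> S" using n x unfolding S_def by simp
      then show False using J(4)[of x] x unfolding W_def by auto
    qed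
    ultimately show "\<exists>W\<in>sets borel. measure \<mu> W < \<eta> \<and> W \<in> fmeasurable \<mu> \<and>
      (\<forall>x\<in>E - W. measure \<mu> (ball x r - E) \<le> \<theta> * measure \<mu> (ball x r))" by blast
  qed simp
qed

section \<open>Transfer between \<mu> and \<nu> through the A_infinity relation\<close>

text \<open>Suppose E is null for \<nu>. At a point x where \<open>ball x r - E\<close> has at most
  the proportion \<epsilon> of \<mu>, the relation says that this set has lost part of the \<nu>
  measure of the ball, although it carries all of it. Such an x exists because the exceptional set W
  has smaller \<mu> measure than E.\<close>

lemma A_infinity_positive:
  fixes \<mu> \<nu> :: "'a::metric_space measure"
  assumes \<nu>: "doubling_measure \<nu>" "ahlfors_regular d \<nu>" and \<mu>: "doubling_measure \<mu>" and "A_infinity \<mu> \<nu>"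
    and E: "E \<in> sets borel" "E \<subseteq> ball x\<^sub>0 R" "measure \<mu> E > 0"
  shows "measure \<nu> E > 0"
proof (rule ccontr)
  assume "\<not> ?thesis"
  then have z: "measure \<nu> E = 0" using measure_nonneg[of \<nu> E] by linarith
  obtain \<epsilon> \<delta> where ed: "\<epsilon> > 0" "\<delta> > 0" "\<And>x r F. r > 0 \<Longrightarrow> F \<in> sets borel \<Longrightarrow> F \<subseteq> ball x r \<Longrightarrow>
        measure \<mu> F \<le> \<epsilon> * measure \<mu> (ball x r) \<Longrightarrow> measure \<nu> F \<le> (1 - \<delta>) * measure \<nu> (ball x r)"
    using assms(4) unfolding A_infinity_def by metis
  obtain r\<^sub>0 where r0: "r\<^sub>0 > 0" "\<And>r. 0 < r \<Longrightarrow> r < r\<^sub>0 \<Longrightarrow> \<exists>W\<in>sets borel. measure \<mu> W < measure \<mu> E \<and> W \<in> fmeasurable \<mu> \<and>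
      (\<forall>x\<in>E - W. measure \<mu> (ball x r - E) \<le> \<epsilon> * measure \<mu> (ball x r))"
    using single_scale_density[OF \<nu> \<mu> E(1,2) ed(1) E(3)] by blast
  define r where "r = r\<^sub>0 / 2"
  have r: "0 < r" "r < r\<^sub>0" unfolding r_def using r0 by auto
  obtain W where W: "measure \<mu> W < measure \<mu> E" "W \<in> fmeasurable \<mu>"
    "\<And>x. x \<in> E - W \<Longrightarrow> measure \<mu> (ball x r - E) \<le> \<epsilon> * measure \<mu> (ball x r)"
    using r0(2)[OF r] by blast
  have "\<not> E \<subseteq> W"
  proof
    assume "E \<subseteq> W"
    then have "measure \<mu> E \<le> measure \<mu> W" using E W(2) doubling_sets[OF \<mu>] by (intro measure_mono_fmeasurable) auto
    then show False using W(1) by simp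
  qed
  then obtain x where x: "x \<in> E - W" by blast
  have 1: "measure \<nu> (ball x r - E) \<le> (1 - \<delta>) * measure \<nu> (ball x r)"
    using E W(3)[OF x] r by (intro ed(3)) auto
  have "measure \<nu> (ball x r) \<le> measure \<nu> (ball x r - E) + measure \<nu> E"
  proof -
    have "measure \<nu> (ball x r) \<le> measure \<nu> ((ball x r - E) \<union> E)"
      using E doubling_sets[OF \<nu>(1)]
      by (intro measure_mono_fmeasurable fmeasurable.Un doubling_subset_fmeasurable[OF \<nu>(1)]) auto
    also have "\<dots> \<le> measure \<nu> (ball x r - E) + measure \<nu> E"
      using E doubling_sets[OF \<nu>(1)] by (intro measure_Un_le) auto
    finally show ?thesis .
  qed
  then have "\<delta> * measure \<nu> (ball x r) \<le> 0" using 1 z by (simp add: algebra_simps)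
  then show False using ed(2) doubling_ball_pos[OF \<nu>(1) r(1), of x] by (simp add: mult_le_0_iff)
qed

text \<open>The contrapositive of the relation, applied to \<open>ball x r \<inter> E\<close>; it
  turns density for \<nu> into a fixed proportion for \<mu>. Halving \<delta> makes the two pieces
  of the ball fall strictly short of the whole.\<close>

lemma A_infinity_reverse:
  fixes \<mu> \<nu> :: "'a::metric_space measure"
  assumes \<nu>: "doubling_measure \<nu>" and "A_infinity \<mu> \<nu>"
  obtains \<epsilon> \<delta> where "\<epsilon> > 0" "\<delta> > 0" "\<And>x r E. r > 0 \<Longrightarrow> E \<in> sets borel \<Longrightarrow>
        measure \<nu> (ball x r - E) \<le> \<delta> * measure \<nu> (ball x r) \<Longrightarrow> \<epsilon> * measure \<mu> (ball x r) < measure \<mu> (ball x r \<inter> E)"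
proof -
  obtain \<epsilon> \<delta> where ed: "\<epsilon> > 0" "\<delta> > 0" "\<And>x r F. r > 0 \<Longrightarrow> F \<in> sets borel \<Longrightarrow> F \<subseteq> ball x r \<Longrightarrow>
        measure \<mu> F \<le> \<epsilon> * measure \<mu> (ball x r) \<Longrightarrow> measure \<nu> F \<le> (1 - \<delta>) * measure \<nu> (ball x r)"
    using assms(2) unfolding A_infinity_def by metis
  have "\<epsilon> * measure \<mu> (ball x r) < measure \<mu> (ball x r \<inter> E)"
    if r: "r > 0" and E: "E \<in> sets borel" and le: "measure \<nu> (ball x r - E) \<le> \<delta> / 2 * measure \<nu> (ball x r)" for x r E
  proof (rule ccontr)
    assume "\<not> ?thesis"
    then have 1: "measure \<nu> (ball x r \<inter> E) \<le> (1 - \<delta>) * measure \<nu> (ball x r)"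
      using E r by (intro ed(3)) auto
    have "measure \<nu> (ball x r) \<le> measure \<nu> (ball x r - E) + measure \<nu> (ball x r \<inter> E)"
      using measure_Un_le[of "ball x r - E" \<nu> "ball x r \<inter> E"] E doubling_sets[OF \<nu>] by (simp add: Un_Diff_Int)
    then have "\<delta> / 2 * measure \<nu> (ball x r) \<le> 0" using 1 le by (simp add: algebra_simps)
    then show False using ed(2) doubling_ball_pos[OF \<nu>(1) r(1), of x] by (simp add: mult_le_0_iff)
  qed
  then show ?thesis using that[of \<epsilon> "\<delta> / 2"] ed by auto
qed

subsection \<open>Concentration and separation of values\<close>

definition concentrated :: "'a measure \<Rightarrow> real \<Rightarrow> 'a set \<Rightarrow> ('a \<Rightarrow> complex) \<Rightarrow> complex \<Rightarrow> real \<Rightarrow> bool" where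
  "concentrated \<mu> \<theta> Q b z r \<longleftrightarrow> measure \<mu> {x \<in> Q. r < cmod (b x - z)} \<le> \<theta> * measure \<mu> Q"

lemma value_sets:
  assumes "b \<in> borel_measurable \<mu>" "Q \<in> sets \<mu>"
  shows "{x \<in> Q. r < cmod (b x - z)} \<in> sets \<mu>" "{x \<in> Q. cmod (b x - z) \<le> r} \<in> sets \<mu>"
    "{x \<in> Q. cmod (b x - z) < r} \<in> sets \<mu>"
    "{x \<in> Q. r < cmod (b x - z) \<and> \<bar>Im (w * (b x - z))\<bar> \<le> Re (w * (b x - z))} \<in> sets \<mu>"
proof -
  have Q: "Q \<subseteq> space \<mu>" using assms(2) sets.sets_into_space by blast
  have *: "{x \<in> Q. P x} = Q \<inter> {x \<in> space \<mu>. P x}" for P using Q by blast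
  note [measurable] = assms(1)
  show "{x \<in> Q. r < cmod (b x - z)} \<in> sets \<mu>" "{x \<in> Q. cmod (b x - z) \<le> r} \<in> sets \<mu>"
    "{x \<in> Q. cmod (b x - z) < r} \<in> sets \<mu>"
    "{x \<in> Q. r < cmod (b x - z) \<and> \<bar>Im (w * (b x - z))\<bar> \<le> Re (w * (b x - z))} \<in> sets \<mu>"
    unfolding * by (intro sets.Int assms(2); measurable)+
qed

lemma concentrated_mono:
  assumes "b \<in> borel_measurable \<mu>" "Q \<in> fmeasurable \<mu>" "concentrated \<mu> \<theta> Q b z r" "cmod (z' - z) + r \<le> r'"
  shows "concentrated \<mu> \<theta> Q b z' r'"
proof -
  have Q: "Q \<in> sets \<mu>" using assms(2) by (simp add: fmeasurable_def)
  have "measure \<mu> {x \<in> Q. r' < cmod (b x - z')} \<le> measure \<mu> {x \<in> Q. r < cmod (b x - z)}"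
  proof (rule measure_mono_fmeasurable)
    have "r < cmod (u - z)" if "r' < cmod (u - z')" for u
      using norm_triangle_ineq4[of "u - z" "z' - z"] that assms(4) by simp
    then show "{x \<in> Q. r' < cmod (b x - z')} \<subseteq> {x \<in> Q. r < cmod (b x - z)}" by blast
    show "{x \<in> Q. r < cmod (b x - z)} \<in> fmeasurable \<mu>"
      by (rule fmeasurableI2[OF assms(2)]) (use value_sets[OF assms(1) Q] in auto)
  qed (rule value_sets[OF assms(1) Q])
  then show ?thesis using assms(3) unfolding concentrated_def by linarith
qed

lemma ex_concentrated:
  assumes b: "b \<in> borel_measurable \<mu>" and Q: "Q \<in> fmeasurable \<mu>" "measure \<mu> Q > 0" and "\<theta> > 0"
  shows "\<exists>r. concentrated \<mu> \<theta> Q b 0 r"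
proof -
  have Qs: "Q \<in> sets \<mu>" using Q by (simp add: fmeasurable_def)
  let ?A = "\<lambda>n::nat. {x \<in> Q. real n < cmod (b x - 0)}"
  have fm: "?A n \<in> fmeasurable \<mu>" for n
    by (rule fmeasurableI2[OF Q(1) _ value_sets(1)[OF b Qs]]) auto
  have "(\<lambda>n. measure \<mu> (?A n)) \<longlonglongrightarrow> measure \<mu> (\<Inter>n. ?A n)"
  proof (rule Lim_measure_decseq)
    show "range ?A \<subseteq> sets \<mu>" using value_sets[OF b Qs] by blast
    show "decseq ?A" by (rule decseq_SucI) auto
    show "emeasure \<mu> (?A n) \<noteq> \<infinity>" for n using fmeasurableD2[OF fm[of n]] by simp
  qed
  moreover have "(\<Inter>n. ?A n) = {}"
  proof -
    have "\<exists>n. \<not> real n < cmod (b x - 0)" for x using reals_Archimedean2[of "cmod (b x - 0)"] by (meson not_less_iff_gr_or_eq)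
    then show ?thesis by blast
  qed
  ultimately have "eventually (\<lambda>n. measure \<mu> (?A n) < \<theta> * measure \<mu> Q) sequentially"
    using Q(2) \<open>\<theta> > 0\<close> by (intro order_tendstoD(2)[where y="measure \<mu> (\<Inter>n. ?A n)"]) auto
  then obtain n where "measure \<mu> (?A n) < \<theta> * measure \<mu> Q" by (auto simp: eventually_sequentially)
  then show ?thesis unfolding concentrated_def by (intro exI[of _ "real n"]) simp
qed

text \<open>The sectors of slope at most 1 around the four half-axes cover the plane; w turns one
  that contains z onto the positive real axis.\<close>

lemma sector_cases: "\<exists>w\<in>{1, -1, \<i>, -\<i>}. \<bar>Im (w * z)\<bar> \<le> Re (w * z)"
proof (cases "\<bar>Im z\<bar> \<le> \<bar>Re z\<bar>")
  case True then show ?thesis by (cases "Re z \<ge> 0") auto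
next
  case False then show ?thesis by (cases "Im z \<ge> 0") auto
qed

text \<open>Pigeonhole over the four sectors: the points whose values are more than r from p have
  measure above \<open>\<theta> * measure \<mu> Q\<close>, and one sector gets a quarter of
  that.\<close>

lemma popular_sector:
  assumes b: "b \<in> borel_measurable \<mu>" and Q: "Q \<in> fmeasurable \<mu>" and n: "\<not> concentrated \<mu> \<theta> Q b p r"
  shows "\<exists>w. cmod w = 1 \<and>
    \<theta> / 4 * measure \<mu> Q \<le> measure \<mu> {x \<in> Q. r < cmod (b x - p) \<and> \<bar>Im (w * (b x - p))\<bar> \<le> Re (w * (b x - p))}"
proof (rule ccontr)
  assume no: "\<not> ?thesis"
  have Qs: "Q \<in> sets \<mu>" using Q by (simp add: fmeasurable_def)
  let ?W = "{1, -1, \<i>, -\<i>}"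
  let ?A = "\<lambda>w. {x \<in> Q. r < cmod (b x - p) \<and> \<bar>Im (w * (b x - p))\<bar> \<le> Re (w * (b x - p))}"
  have As: "?A w \<in> sets \<mu>" for w by (rule value_sets[OF b Qs])
  have Af: "?A w \<in> fmeasurable \<mu>" for w by (rule fmeasurableI2[OF Q _ As]) auto
  have small: "measure \<mu> (?A w) \<le> \<theta> / 4 * measure \<mu> Q" if "w \<in> ?W" for w
  proof -
    have "cmod w = 1" using that by auto
    then show ?thesis using no by (meson le_cases)
  qed
  have c4: "card ?W = 4"
  proof -
    have "(1::complex) \<noteq> -1" "1 \<noteq> \<i>" "1 \<noteq> -\<i>" "-1 \<noteq> \<i>" "-1 \<noteq> -\<i>" "\<i> \<noteq> -\<i>" by (auto simp: complex_eq_iff)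
    then show ?thesis by simp
  qed
  have "{x \<in> Q. r < cmod (b x - p)} \<subseteq> (\<Union>w\<in>?W. ?A w)"
  proof
    fix x assume "x \<in> {x \<in> Q. r < cmod (b x - p)}"
    then show "x \<in> (\<Union>w\<in>?W. ?A w)" using sector_cases[of "b x - p"] by blast
  qed
  moreover have "(\<Union>w\<in>?W. ?A w) \<in> fmeasurable \<mu>" by (intro fmeasurable.finite_UN Af) auto
  ultimately have "measure \<mu> {x \<in> Q. r < cmod (b x - p)} \<le> measure \<mu> (\<Union>w\<in>?W. ?A w)"
    using value_sets(1)[OF b Qs] by (intro measure_mono_fmeasurable) auto
  also have "\<dots> \<le> (\<Sum>w\<in>?W. measure \<mu> (?A w))" by (intro measure_UNION_le As) auto
  also have "\<dots> \<le> (\<Sum>w\<in>?W. \<theta> / 4 * measure \<mu> Q)" by (intro sum_mono small)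
  also have "\<dots> = \<theta> * measure \<mu> Q" unfolding sum_constant c4 by simp
  finally show False using n unfolding concentrated_def by simp
qed

text \<open>Pigeonhole over small discs: T is a net of mesh 1/100 in the unit disc, scaled to the
  disc about z of radius r, which receives the values of b on at least half of Q.\<close>

lemma popular_disc:
  fixes T :: "complex set"
  assumes T: "finite T" "cball 0 1 \<subseteq> (\<Union>t\<in>T. ball t (1/100))" "T \<subseteq> cball 0 1"
    and b: "b \<in> borel_measurable \<mu>" and Q: "Q \<in> fmeasurable \<mu>" and r: "r > 0"
    and c: "concentrated \<mu> \<theta> Q b z r" "\<theta> \<le> 1/2"
  shows "\<exists>p. cmod (p - z) \<le> r \<and> measure \<mu> Q / (2 * card T) \<le> measure \<mu> {x \<in> Q. cmod (b x - p) < r / 100}"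
proof (rule ccontr)
  assume no: "\<not> ?thesis"
  have Qs: "Q \<in> sets \<mu>" using Q by (simp add: fmeasurable_def)
  note vs = value_sets[OF b Qs]
  have fm: "A \<in> fmeasurable \<mu>" if "A \<in> sets \<mu>" "A \<subseteq> Q" for A using fmeasurableI2[OF Q that(2,1)] .
  let ?A = "\<lambda>t. {x \<in> Q. cmod (b x - (z + of_real r * t)) < r / 100}"
  have small: "measure \<mu> (?A t) < measure \<mu> Q / (2 * card T)" if "t \<in> T" for t
  proof -
    have "cmod (z + of_real r * t - z) \<le> r" using T(3) that r by (auto simp: norm_mult mult_le_cancel_left1)
    then show ?thesis using no by (meson not_less)
  qed
  have T0: "T \<noteq> {}" using T(2) by auto
  have sub: "{x \<in> Q. cmod (b x - z) \<le> r} \<subseteq> (\<Union>t\<in>T. ?A t)"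
  proof
    fix x assume x: "x \<in> {x \<in> Q. cmod (b x - z) \<le> r}"
    define y where "y = (b x - z) / of_real r"
    have "y \<in> cball 0 1" using x r by (simp add: y_def norm_divide)
    then obtain t where t: "t \<in> T" "y \<in> ball t (1/100)" using T(2) by blast
    have "b x - (z + of_real r * t) = of_real r * (y - t)" using r by (simp add: y_def field_simps)
    then have "cmod (b x - (z + of_real r * t)) = r * cmod (y - t)" using r by (simp add: norm_mult)
    also have "\<dots> < r * (1 / 100)" using t(2) r by (intro mult_strict_left_mono) (auto simp: dist_norm norm_minus_commute)
    finally show "x \<in> (\<Union>t\<in>T. ?A t)" using x t(1) by auto
  qed
  have "measure \<mu> Q \<le> measure \<mu> {x \<in> Q. r < cmod (b x - z)} + measure \<mu> {x \<in> Q. cmod (b x - z) \<le> r}"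
  proof -
    have "measure \<mu> Q = measure \<mu> ({x \<in> Q. r < cmod (b x - z)} \<union> {x \<in> Q. cmod (b x - z) \<le> r})"
      by (rule arg_cong[where f="measure \<mu>"]) auto
    also have "\<dots> \<le> measure \<mu> {x \<in> Q. r < cmod (b x - z)} + measure \<mu> {x \<in> Q. cmod (b x - z) \<le> r}"
      by (rule measure_Un_le[OF vs(1,2)])
    finally show ?thesis .
  qed
  also have "\<dots> \<le> measure \<mu> Q / 2 + measure \<mu> {x \<in> Q. cmod (b x - z) \<le> r}"
    using c mult_right_mono[OF c(2), of "measure \<mu> Q"] unfolding concentrated_def by simp
  finally have "measure \<mu> Q / 2 \<le> measure \<mu> {x \<in> Q. cmod (b x - z) \<le> r}" by simp
  also have "\<dots> \<le> measure \<mu> (\<Union>t\<in>T. ?A t)"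
    using T(1) by (intro measure_mono_fmeasurable sub vs fmeasurable.finite_UN fm) auto
  also have "\<dots> \<le> (\<Sum>t\<in>T. measure \<mu> (?A t))" by (intro measure_UNION_le vs T(1))
  also have "\<dots> < (\<Sum>t\<in>T. measure \<mu> Q / (2 * card T))" by (intro sum_strict_mono small T(1) T0)
  also have "\<dots> = measure \<mu> Q / 2" using T(1) T0 by simp
  finally show False by simp
qed

text \<open>Moving the vertex of a cone of slope 1 from p to a nearby v widens the slope to 3/2.
  Inside the cone the modulus is at most sqrt 2, rounded up to 3/2, times the real part, so the real
  part exceeds \<kappa> / 12; a shift by \<kappa> / 100 leaves more than \<kappa> / 20.\<close>

lemma cone_perturb:
  assumes "cmod w = 1" "\<kappa> / 8 < cmod (u - p)" "\<bar>Im (w * (u - p))\<bar> \<le> Re (w * (u - p))" "cmod (v - p) < \<kappa> / 100"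
  shows "\<kappa> / 20 \<le> Re (w * (u - v)) \<and> \<bar>Im (w * (u - v))\<bar> \<le> 3/2 * Re (w * (u - v))"
proof -
  define \<zeta> where "\<zeta> = w * (u - p)" define e where "e = w * (v - p)"
  have eq: "w * (u - v) = \<zeta> - e" by (simp add: \<zeta>_def e_def algebra_simps)
  have z: "\<kappa> / 8 < cmod \<zeta>" "\<bar>Im \<zeta>\<bar> \<le> Re \<zeta>"
    unfolding \<zeta>_def norm_mult assms(1) using assms(2,3) by (simp_all only: mult_1)
  have e: "cmod e < \<kappa> / 100" unfolding e_def norm_mult assms(1) using assms(4) by (simp only: mult_1)
  have "(cmod \<zeta>)\<^sup>2 \<le> (3/2 * Re \<zeta>)\<^sup>2"
  proof -
    have "(cmod \<zeta>)\<^sup>2 = (Re \<zeta>)\<^sup>2 + (Im \<zeta>)\<^sup>2" by (rule cmod_power2)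
    moreover have "(Im \<zeta>)\<^sup>2 \<le> (Re \<zeta>)\<^sup>2" using power_mono[OF z(2), of 2] by simp
    moreover have "(3/2 * Re \<zeta>)\<^sup>2 = 9/4 * (Re \<zeta>)\<^sup>2" by (simp add: power2_eq_square)
    moreover have "0 \<le> (Re \<zeta>)\<^sup>2" by simp
    ultimately show ?thesis by linarith
  qed
  then have "cmod \<zeta> \<le> 3/2 * Re \<zeta>" by (rule power2_le_imp_le) (use z(2) in linarith)
  then have R: "\<kappa> / 12 < Re \<zeta>" using z(1) by linarith
  have "\<bar>Re e\<bar> \<le> cmod e" "\<bar>Im e\<bar> \<le> cmod e" using abs_Re_le_cmod abs_Im_le_cmod by blast+
  then have r: "\<bar>Re e\<bar> < \<kappa> / 100" "\<bar>Im e\<bar> < \<kappa> / 100" using e by linarith+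
  have "\<kappa> / 20 \<le> Re \<zeta> - Re e" using R r(1) by linarith
  moreover have "\<bar>Im \<zeta> - Im e\<bar> \<le> Re \<zeta> + \<kappa> / 100" using z(2) r(2) by linarith
  moreover have "Re \<zeta> + \<kappa> / 100 \<le> 3/2 * (Re \<zeta> - Re e)" using R r(1) by argo
  ultimately show ?thesis unfolding eq minus_complex.sel by linarith
qed

text \<open>Take the least dyadic multiple r of \<kappa> at which both sets are concentrated about a
  common centre. If r exceeds \<kappa>, no common centre exists at r / 2, so the values on the two
  sets must be apart somewhere: a popular disc of one set faces a popular sector of the other. The
  constant depends on \<theta> and on the mesh of the net in the unit disc only.\<close>

lemma concentration_or_separation:
  fixes \<theta> :: real
  assumes "0 < \<theta>" "\<theta> < 1/2"
  obtains c where "c > 0" "\<And>(\<mu> :: 'a measure) Q1 Q2 b \<kappa>. b \<in> borel_measurable \<mu> \<Longrightarrow> Q1 \<in> fmeasurable \<mu> \<Longrightarrow> Q2 \<in> fmeasurable \<mu>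
    \<Longrightarrow> measure \<mu> Q1 > 0 \<Longrightarrow> measure \<mu> Q2 > 0 \<Longrightarrow> \<kappa> > 0 \<Longrightarrow>
    \<exists>z r. 0 < r \<and> concentrated \<mu> \<theta> Q1 b z r \<and> concentrated \<mu> \<theta> Q2 b z r \<and> (r \<le> \<kappa> \<or>
      (\<exists>A1 A2 w. A1 \<in> sets \<mu> \<and> A2 \<in> sets \<mu> \<and> A1 \<subseteq> Q1 \<and> A2 \<subseteq> Q2 \<and> cmod w = 1 \<and>
         c * measure \<mu> Q1 \<le> measure \<mu> A1 \<and> c * measure \<mu> Q2 \<le> measure \<mu> A2 \<and>
         (\<forall>x\<in>A1. \<forall>y\<in>A2. c * r \<le> Re (w * (b x - b y)) \<and> \<bar>Im (w * (b x - b y))\<bar> \<le> 3/2 * Re (w * (b x - b y)))))"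
proof -
  have "compact (cball (0::complex) 1)" by simp
  moreover have "cball (0::complex) 1 \<subseteq> (\<Union>t\<in>cball 0 1. ball t (1/100))" by force
  ultimately obtain T :: "complex set" where T: "T \<subseteq> cball 0 1" "finite T" "cball 0 1 \<subseteq> (\<Union>t\<in>T. ball t (1/100))"
    using compactE_image[of "cball (0::complex) 1" "cball 0 1" "\<lambda>t. ball t (1/100)"] by auto
  have "T \<noteq> {}" using T(3) by auto
  then have N: "card T > 0" using T(2) by (simp add: card_gt_0_iff)
  define c where "c = min (\<theta> / 4) (min (1 / (2 * card T)) (1 / 20))"
  have c: "c > 0" "c \<le> \<theta> / 4" "c \<le> 1 / (2 * card T)" "c \<le> 1 / 20" using N assms by (auto simp: c_def)
  show ?thesis
  proof (rule that[OF c(1)])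
    fix \<mu> :: "'a measure" and Q1 Q2 and b :: "'a \<Rightarrow> complex" and \<kappa> :: real
    assume b: "b \<in> borel_measurable \<mu>" and Q1: "Q1 \<in> fmeasurable \<mu>" and Q2: "Q2 \<in> fmeasurable \<mu>"
      and pos: "measure \<mu> Q1 > 0" "measure \<mu> Q2 > 0" and \<kappa>: "\<kappa> > 0"
    let ?conc = "\<lambda>z r. concentrated \<mu> \<theta> Q1 b z r \<and> concentrated \<mu> \<theta> Q2 b z r"
    have Qs: "Q1 \<in> sets \<mu>" "Q2 \<in> sets \<mu>" using Q1 Q2 by (auto simp: fmeasurable_def)
    define P where "P k = (\<exists>z. ?conc z (2 ^ k * \<kappa>))" for k :: nat
    have "\<exists>k. P k"
    proof -
      obtain r1 r2 where r: "concentrated \<mu> \<theta> Q1 b 0 r1" "concentrated \<mu> \<theta> Q2 b 0 r2"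
        using ex_concentrated[OF b Q1 pos(1) assms(1)] ex_concentrated[OF b Q2 pos(2) assms(1)] by blast
      obtain k where k: "max r1 r2 / \<kappa> < 2 ^ k" using real_arch_pow[of 2] by auto
      then have "max r1 r2 \<le> 2 ^ k * \<kappa>" using \<kappa> by (simp add: pos_divide_less_eq less_imp_le)
      then have "?conc 0 (2 ^ k * \<kappa>)"
        using concentrated_mono[OF b Q1 r(1)] concentrated_mono[OF b Q2 r(2)] by simp
      then show ?thesis unfolding P_def by blast
    qed
    then obtain k where k: "P k" "\<And>i. i < k \<Longrightarrow> \<not> P i" using LeastI_ex[of P] not_less_Least[of _ P] by blast
    define r where "r = 2 ^ k * \<kappa>"
    have r: "r > 0" using \<kappa> by (simp add: r_def)
    obtain z where z: "concentrated \<mu> \<theta> Q1 b z r" "concentrated \<mu> \<theta> Q2 b z r" using k(1) unfolding P_def r_def by blast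
    have "r \<le> \<kappa> \<or>
      (\<exists>A1 A2 w. A1 \<in> sets \<mu> \<and> A2 \<in> sets \<mu> \<and> A1 \<subseteq> Q1 \<and> A2 \<subseteq> Q2 \<and> cmod w = 1 \<and>
         c * measure \<mu> Q1 \<le> measure \<mu> A1 \<and> c * measure \<mu> Q2 \<le> measure \<mu> A2 \<and>
         (\<forall>x\<in>A1. \<forall>y\<in>A2. c * r \<le> Re (w * (b x - b y)) \<and> \<bar>Im (w * (b x - b y))\<bar> \<le> 3/2 * Re (w * (b x - b y))))"
    proof (cases k)
      case 0 then show ?thesis by (simp add: r_def)
    next
      case (Suc m)
      \<comment> \<open>Minimality of k, used at its predecessor m.\<close>
      have no: "\<not> ?conc p (r / 2)" for p using k(2)[of m] Suc unfolding P_def r_def by auto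
      have cr: "c * r \<le> r / 20" using c(4) r mult_right_mono[of c "1/20" r] by simp
      have cQ: "c * measure \<mu> Q \<le> \<theta> / 4 * measure \<mu> Q" "c * measure \<mu> Q \<le> measure \<mu> Q / (2 * card T)" for Q
        using mult_right_mono[OF c(2), of "measure \<mu> Q"] mult_right_mono[OF c(3), of "measure \<mu> Q"] by auto
      obtain p' where p': "measure \<mu> Q2 / (2 * card T) \<le> measure \<mu> {x \<in> Q2. cmod (b x - p') < r / 100}"
        using popular_disc[OF T(2,3,1) b Q2 r z(2)] assms by auto
      show ?thesis
      proof (cases "concentrated \<mu> \<theta> Q1 b p' (r / 8)")
        case False
        obtain w where w: "cmod w = 1"
          "\<theta> / 4 * measure \<mu> Q1 \<le> measure \<mu> {x \<in> Q1. r / 8 < cmod (b x - p') \<and> \<bar>Im (w * (b x - p'))\<bar> \<le> Re (w * (b x - p'))}"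
          using popular_sector[OF b Q1 False] by blast
        let ?A1 = "{x \<in> Q1. r / 8 < cmod (b x - p') \<and> \<bar>Im (w * (b x - p'))\<bar> \<le> Re (w * (b x - p'))}"
        let ?A2 = "{x \<in> Q2. cmod (b x - p') < r / 100}"
        have "c * r \<le> Re (w * (b x - b y)) \<and> \<bar>Im (w * (b x - b y))\<bar> \<le> 3/2 * Re (w * (b x - b y))"
          if "x \<in> ?A1" "y \<in> ?A2" for x y
        proof -
          have "r / 20 \<le> Re (w * (b x - b y)) \<and> \<bar>Im (w * (b x - b y))\<bar> \<le> 3/2 * Re (w * (b x - b y))"
            by (rule cone_perturb[OF w(1), where p=p']) (use that in auto)
          then show ?thesis using cr by simp
        qed
        moreover have "?A1 \<in> sets \<mu>" "?A2 \<in> sets \<mu>" by (rule value_sets[OF b Qs(1)] value_sets[OF b Qs(2)])+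
        moreover have "?A1 \<subseteq> Q1" "?A2 \<subseteq> Q2" by auto
        moreover have "c * measure \<mu> Q1 \<le> measure \<mu> ?A1" "c * measure \<mu> Q2 \<le> measure \<mu> ?A2"
          by (rule order_trans[OF cQ(1) w(2)] order_trans[OF cQ(2) p'])+
        ultimately show ?thesis using w(1) by blast
      next
        \<comment> \<open>Q1 sits near p', so the roles are exchanged. A popular disc of Q1 has its
          centre p within r / 8 of p'; Q1 is then concentrated about p at radius r / 2, and
          minimality forbids the same for Q2. As the distant set is now Q2, the rotation becomes
          -w.\<close>
        case True
        have "r / 8 > 0" using r by simp
        then obtain p where p: "cmod (p - p') \<le> r / 8"
          "measure \<mu> Q1 / (2 * card T) \<le> measure \<mu> {x \<in> Q1. cmod (b x - p) < r / 8 / 100}"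
          using popular_disc[OF T(2,3,1) b Q1 _ True] assms by auto
        have "concentrated \<mu> \<theta> Q1 b p (r / 2)" by (rule concentrated_mono[OF b Q1 True]) (use p(1) r in simp)
        then have "\<not> concentrated \<mu> \<theta> Q2 b p (r / 2)" using no by blast
        then have "\<not> concentrated \<mu> \<theta> Q2 b p (r / 8)"
          using concentrated_mono[OF b Q2, of \<theta> p "r / 8" p "r / 2"] r by auto
        then obtain w where w: "cmod w = 1"
          "\<theta> / 4 * measure \<mu> Q2 \<le> measure \<mu> {x \<in> Q2. r / 8 < cmod (b x - p) \<and> \<bar>Im (w * (b x - p))\<bar> \<le> Re (w * (b x - p))}"
          using popular_sector[OF b Q2] by blast
        let ?A2 = "{x \<in> Q2. r / 8 < cmod (b x - p) \<and> \<bar>Im (w * (b x - p))\<bar> \<le> Re (w * (b x - p))}"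
        let ?A1 = "{x \<in> Q1. cmod (b x - p) < r / 8 / 100}"
        have "c * r \<le> Re ((-w) * (b x - b y)) \<and> \<bar>Im ((-w) * (b x - b y))\<bar> \<le> 3/2 * Re ((-w) * (b x - b y))"
          if "x \<in> ?A1" "y \<in> ?A2" for x y
        proof -
          have "r / 20 \<le> Re (w * (b y - b x)) \<and> \<bar>Im (w * (b y - b x))\<bar> \<le> 3/2 * Re (w * (b y - b x))"
            by (rule cone_perturb[OF w(1), where p=p]) (use that r in auto)
          moreover have "(-w) * (b x - b y) = w * (b y - b x)" by (simp add: algebra_simps)
          ultimately show ?thesis using cr by (simp only:) simp
        qed
        moreover have "?A1 \<in> sets \<mu>" "?A2 \<in> sets \<mu>" by (rule value_sets[OF b Qs(1)] value_sets[OF b Qs(2)])+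
        moreover have "?A1 \<subseteq> Q1" "?A2 \<subseteq> Q2" by auto
        moreover have "c * measure \<mu> Q1 \<le> measure \<mu> ?A1" "c * measure \<mu> Q2 \<le> measure \<mu> ?A2"
          by (rule order_trans[OF cQ(2) p(2)] order_trans[OF cQ(1) w(2)])+
        moreover have "cmod (- w) = 1" using w(1) by simp
        ultimately show ?thesis by blast
      qed
    qed
    then show "\<exists>z r. 0 < r \<and> concentrated \<mu> \<theta> Q1 b z r \<and> concentrated \<mu> \<theta> Q2 b z r \<and> (r \<le> \<kappa> \<or>
      (\<exists>A1 A2 w. A1 \<in> sets \<mu> \<and> A2 \<in> sets \<mu> \<and> A1 \<subseteq> Q1 \<and> A2 \<subseteq> Q2 \<and> cmod w = 1 \<and>
         c * measure \<mu> Q1 \<le> measure \<mu> A1 \<and> c * measure \<mu> Q2 \<le> measure \<mu> A2 \<and>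
         (\<forall>x\<in>A1. \<forall>y\<in>A2. c * r \<le> Re (w * (b x - b y)) \<and> \<bar>Im (w * (b x - b y))\<bar> \<le> 3/2 * Re (w * (b x - b y)))))"
      using r z by blast
  qed
qed

subsection \<open>Discrete convolution\<close>

definition bump :: "real \<Rightarrow> 'a::metric_space \<Rightarrow> 'a \<Rightarrow> real" where
  "bump s j x = max 0 (2 - dist j x / s)"

text \<open>A combination of the values Z by a partition of unity on the net. Where the net covers,
  the bumps add up to at least 1 and the maximum is inactive; elsewhere it prevents division by
  small numbers and keeps the function Lipschitz on the whole space.\<close>

definition discrete_convolution :: "real \<Rightarrow> 'a::metric_space set \<Rightarrow> ('a \<Rightarrow> complex) \<Rightarrow> 'a \<Rightarrow> complex" where
  "discrete_convolution s J Z x =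
     (\<Sum>j\<in>J. of_real (bump s j x) * Z j) / of_real (max 1 (\<Sum>j\<in>J. bump s j x))"

lemma bump_nonneg [simp]: "0 \<le> bump s j x"
  by (simp add: bump_def)

lemma bump_le: "s > 0 \<Longrightarrow> bump s j x \<le> 2"
  by (simp add: bump_def)

lemma bump_zero: "s > 0 \<Longrightarrow> 2 * s \<le> dist j x \<Longrightarrow> bump s j x = 0"
  by (simp add: bump_def max_def field_simps)

lemma bump_ge_one: "s > 0 \<Longrightarrow> dist j x \<le> s \<Longrightarrow> 1 \<le> bump s j x"
  by (simp add: bump_def max_def field_simps)

lemma bump_lipschitz:
  assumes "s > 0" shows "\<bar>bump s j x - bump s j y\<bar> \<le> dist x y / s"
proof -
  have "\<bar>dist j x - dist j y\<bar> \<le> dist x y"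
    by (metis abs_dist_diff_le dist_commute)
  then have "\<bar>dist j x / s - dist j y / s\<bar> \<le> dist x y / s"
    using assms by (simp add: diff_divide_distrib[symmetric] divide_right_mono)
  then show ?thesis unfolding bump_def by linarith
qed

text \<open>A qualitative fact, whose constant grows with \<open>card J\<close>: it admits the
  function to the Poincare inequality and makes it integrable on balls. The sharp local estimate is
  \<open>lower_lip_discrete_convolution\<close>.\<close>

lemma discrete_convolution_lipschitz:
  assumes "finite J" "s > 0"
  shows "\<exists>L. L-lipschitz_on UNIV (discrete_convolution s J Z)"
proof -
  define S where "S x = (\<Sum>j\<in>J. bump s j x)" for x
  define N where "N x = (\<Sum>j\<in>J. of_real (bump s j x) * Z j)" for x
  define B where "B = (\<Sum>j\<in>J. cmod (Z j))"
  have B: "B \<ge> 0" unfolding B_def by (intro sum_nonneg) auto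
  have S1: "\<bar>S x - S y\<bar> \<le> card J * (dist x y / s)" for x y
  proof -
    have "\<bar>S x - S y\<bar> \<le> (\<Sum>j\<in>J. \<bar>bump s j x - bump s j y\<bar>)"
      unfolding S_def sum_subtractf[symmetric] by (rule sum_abs)
    also have "\<dots> \<le> (\<Sum>j\<in>J. dist x y / s)" by (intro sum_mono bump_lipschitz assms)
    finally show ?thesis by simp
  qed
  have N1: "cmod (N x - N y) \<le> dist x y / s * B" for x y
  proof -
    have "N x - N y = (\<Sum>j\<in>J. of_real (bump s j x - bump s j y) * Z j)"
      unfolding N_def sum_subtractf[symmetric] by (simp add: left_diff_distrib)
    then have "cmod (N x - N y) \<le> (\<Sum>j\<in>J. cmod (of_real (bump s j x - bump s j y) * Z j))" by (simp only: norm_sum)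
    also have "\<dots> = (\<Sum>j\<in>J. \<bar>bump s j x - bump s j y\<bar> * cmod (Z j))" by (simp only: norm_mult norm_of_real)
    also have "\<dots> \<le> (\<Sum>j\<in>J. dist x y / s * cmod (Z j))" by (intro sum_mono mult_right_mono bump_lipschitz assms) auto
    finally show ?thesis unfolding B_def sum_distrib_left .
  qed
  have N2: "cmod (N x) \<le> 2 * B" for x
  proof -
    have "cmod (N x) \<le> (\<Sum>j\<in>J. cmod (of_real (bump s j x) * Z j))" unfolding N_def by (rule norm_sum)
    also have "\<dots> = (\<Sum>j\<in>J. bump s j x * cmod (Z j))" by (simp add: norm_mult)
    also have "\<dots> \<le> (\<Sum>j\<in>J. 2 * cmod (Z j))" by (intro sum_mono mult_right_mono bump_le assms) auto
    finally show ?thesis unfolding B_def sum_distrib_left .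
  qed
  define L where "L = B / s + 2 * B * card J / s"
  have "L-lipschitz_on UNIV (discrete_convolution s J Z)"
  proof (rule lipschitz_onI)
    show "0 \<le> L" unfolding L_def using B assms by simp
    fix x y :: 'a
    define m n where "m = max 1 (S x)" and "n = max 1 (S y)"
    have mn: "m \<ge> 1" "n \<ge> 1" "\<bar>m - n\<bar> \<le> card J * (dist x y / s)"
      using S1[of x y] unfolding m_def n_def by linarith+
    have "discrete_convolution s J Z x - discrete_convolution s J Z y = N x / of_real m - N y / of_real n"
      unfolding discrete_convolution_def N_def m_def n_def S_def ..
    also have "\<dots> = (N x - N y) / of_real m + N y * of_real (n - m) / of_real (m * n)"
      using mn by (simp add: field_simps)
    finally have "cmod (discrete_convolution s J Z x - discrete_convolution s J Z y)
        \<le> cmod ((N x - N y) / of_real m) + cmod (N y * of_real (n - m) / of_real (m * n))"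
      by (simp only: norm_triangle_ineq)
    moreover have "cmod ((N x - N y) / of_real m) \<le> dist x y / s * B"
    proof -
      have "cmod (N x - N y) / m \<le> cmod (N x - N y) / 1" using mn by (intro divide_left_mono) auto
      then show ?thesis using N1[of x y] mn by (simp add: norm_divide)
    qed
    moreover have "cmod (N y * of_real (n - m) / of_real (m * n)) \<le> 2 * B * (card J * (dist x y / s))"
    proof -
      have "1 \<le> m * n" using mn mult_mono[of 1 m 1 n] by simp
      then have "cmod (N y) * \<bar>n - m\<bar> / (m * n) \<le> cmod (N y) * \<bar>n - m\<bar> / 1"
        by (intro divide_left_mono) auto
      also have "\<dots> \<le> 2 * B * (card J * (dist x y / s))"
        unfolding div_by_1 using mn(3) N2[of y] B by (intro mult_mono) (auto simp: abs_minus_commute)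
      finally show ?thesis using \<open>1 \<le> m * n\<close> by (simp only: norm_mult norm_divide norm_of_real abs_of_pos[of "m * n"])
    qed
    ultimately show "dist (discrete_convolution s J Z x) (discrete_convolution s J Z y) \<le> L * dist x y"
      unfolding dist_norm L_def by (simp add: algebra_simps)
  qed
  then show ?thesis by blast
qed

text \<open>The quotients are squeezed between 0, from the choice z = y, and L for all small t.
  Nonnegativity is what makes the passage from extended reals to reals monotone.\<close>

lemma lower_lip_le:
  assumes "\<delta> > 0" "0 \<le> L" "\<And>z. dist y z < \<delta> \<Longrightarrow> cmod (f y - f z) \<le> L * dist y z"
  shows "0 \<le> lower_lip f y" "lower_lip f y \<le> L"
proof -
  let ?g = "\<lambda>t. SUP z\<in>ball y t. ereal (cmod (f y - f z) / t)"
  have up: "eventually (\<lambda>t. ?g t \<le> ereal L) (at_right 0)"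
    unfolding eventually_at_right_field
  proof (intro exI[of _ \<delta>] conjI allI impI)
    fix t :: real assume t: "0 < t" "t < \<delta>"
    show "?g t \<le> ereal L"
    proof (rule SUP_least)
      fix z assume z: "z \<in> ball y t"
      have "cmod (f y - f z) \<le> L * dist y z" using z t by (intro assms(3)) auto
      also have "\<dots> \<le> L * t" using z assms(2) by (intro mult_left_mono) auto
      finally show "ereal (cmod (f y - f z) / t) \<le> ereal L" using t by (simp add: pos_divide_le_eq)
    qed
  qed (rule assms(1))
  have lo: "eventually (\<lambda>t. 0 \<le> ?g t) (at_right 0)"
    unfolding eventually_at_right_field
  proof (intro exI[of _ 1] conjI allI impI)
    fix t :: real assume t: "0 < t" "t < 1"
    have "ereal (cmod (f y - f y) / t) \<le> ?g t" using t by (intro SUP_upper) auto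
    then show "0 \<le> ?g t" by (simp add: zero_ereal_def)
  qed simp
  have nb: "at_right (0::real) \<noteq> bot" by (rule trivial_limit_at_right_real)
  have "Liminf (at_right 0) ?g \<le> Liminf (at_right 0) (\<lambda>t::real. ereal L)" by (rule Liminf_mono) (use up in simp)
  then have u: "Liminf (at_right 0) ?g \<le> ereal L" using nb by (simp add: Liminf_const)
  have "Liminf (at_right 0) (\<lambda>t::real. 0) \<le> Liminf (at_right 0) ?g" by (rule Liminf_mono) (use lo in simp)
  then have l: "0 \<le> Liminf (at_right 0) ?g" using nb by (simp add: Liminf_const)
  show "0 \<le> lower_lip f y" unfolding lower_lip_def using l by (rule real_of_ereal_pos)
  show "lower_lip f y \<le> L" unfolding lower_lip_def using real_of_ereal_positive_mono[OF l u] by simp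
qed

text \<open>Within s of a net point the weights sum to 1, so any constant can be subtracted under
  the sum.\<close>

lemma discrete_convolution_eq:
  assumes J: "finite J" "s > 0" and "j \<in> J" "dist j x \<le> s"
  shows "(\<Sum>j\<in>J. bump s j x) \<ge> 1"
    "discrete_convolution s J Z x - a = (\<Sum>j\<in>J. of_real (bump s j x / (\<Sum>j\<in>J. bump s j x)) * (Z j - a))"
proof -
  let ?S = "\<Sum>j\<in>J. bump s j x"
  have "bump s j x \<le> ?S" using J assms(3) by (intro member_le_sum) auto
  then show S: "?S \<ge> 1" using bump_ge_one[OF J(2) assms(4)] by linarith
  have "(\<Sum>j\<in>J. of_real (bump s j x / ?S) * (Z j - a)) = (\<Sum>j\<in>J. of_real (bump s j x) * Z j / of_real ?S - of_real (bump s j x / ?S) * a)"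
    by (intro sum.cong refl) (simp add: right_diff_distrib)
  also have "\<dots> = (\<Sum>j\<in>J. of_real (bump s j x) * Z j) / of_real ?S - of_real (\<Sum>j\<in>J. bump s j x / ?S) * a"
    by (simp only: sum_subtractf sum_divide_distrib sum_distrib_right of_real_sum)
  also have "(\<Sum>j\<in>J. bump s j x / ?S) = 1" using S by (simp flip: sum_divide_distrib)
  finally show "discrete_convolution s J Z x - a = (\<Sum>j\<in>J. of_real (bump s j x / ?S) * (Z j - a))"
    unfolding discrete_convolution_def using S by (simp add: max_absorb2)
qed

lemma discrete_convolution_near:
  assumes J: "finite J" "s > 0" and "j \<in> J" "dist j x \<le> s"
    and t: "\<And>i. i \<in> J \<Longrightarrow> dist i x < 2 * s \<Longrightarrow> cmod (Z i - a) \<le> t"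
  shows "cmod (discrete_convolution s J Z x - a) \<le> t"
proof -
  let ?S = "\<Sum>j\<in>J. bump s j x"
  have S: "?S \<ge> 1" by (rule discrete_convolution_eq(1)[OF assms(1-4)])
  have "cmod (discrete_convolution s J Z x - a) \<le> (\<Sum>i\<in>J. cmod (of_real (bump s i x / ?S) * (Z i - a)))"
    unfolding discrete_convolution_eq(2)[OF assms(1-4)] by (rule norm_sum)
  also have "\<dots> \<le> (\<Sum>i\<in>J. bump s i x / ?S * t)"
  proof (intro sum_mono)
    fix i assume i: "i \<in> J"
    show "cmod (of_real (bump s i x / ?S) * (Z i - a)) \<le> bump s i x / ?S * t"
    proof (cases "dist i x < 2 * s")
      case True
      have "0 \<le> bump s i x / ?S" using S by simp
      then show ?thesis using mult_left_mono[OF t[OF i True], of "bump s i x / ?S"]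
        by (simp only: norm_mult norm_of_real abs_of_nonneg)
    next
      case False
      then show ?thesis using bump_zero[OF J(2), of i x] by simp
    qed
  qed
  also have "\<dots> = t" using S by (simp flip: sum_distrib_right sum_divide_distrib)
  finally show ?thesis .
qed

text \<open>Relative to \<open>Z i\<close> the convolution is a sum over at most N net points, with
  weights that vary at rate (N + 1) / s and coefficients bounded by the sum of the nearby \<kappa>.
  The bound involves the local count N and not \<open>card J\<close>.\<close>

lemma lower_lip_discrete_convolution:
  assumes J: "finite J" "s > 0" and i: "i \<in> J" "dist i y < s"
    and N: "card {j \<in> J. dist j y < 3 * s} \<le> N"
    and K: "\<And>j. j \<in> J \<Longrightarrow> 0 \<le> \<kappa> j"
    and Z: "\<And>j. j \<in> J \<Longrightarrow> dist j y < 3 * s \<Longrightarrow> cmod (Z j - Z i) \<le> \<kappa> j + \<kappa> i"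
  shows "0 \<le> lower_lip (discrete_convolution s J Z) y"
    "lower_lip (discrete_convolution s J Z) y \<le> real N * (real N + 1) / s * (\<Sum>j\<in>{j \<in> J. dist j y < 3 * s}. \<kappa> j)"
proof -
  let ?I = "{j \<in> J. dist j y < 3 * s}"
  define M where "M = (\<Sum>j\<in>?I. \<kappa> j)"
  define S where "S x = (\<Sum>j\<in>J. bump s j x)" for x
  \<comment> \<open>Within this distance of y the net point i still covers.\<close>
  define \<delta> where "\<delta> = s - dist i y"
  have d: "\<delta> > 0" "\<delta> \<le> s" using i by (auto simp: \<delta>_def)
  have fI: "finite ?I" using J by simp
  have M0: "0 \<le> M" unfolding M_def using K by (intro sum_nonneg) auto
  have ZM: "cmod (Z j - Z i) \<le> M" if "j \<in> ?I" for j
  proof (cases "j = i")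
    case True then show ?thesis using M0 by simp
  next
    case False
    have "\<kappa> j + \<kappa> i = (\<Sum>k\<in>{j, i}. \<kappa> k)" using False by simp
    also have "\<dots> \<le> M" unfolding M_def using that i J(2) K fI by (intro sum_mono2) auto
    finally show ?thesis using Z[of j] that by auto
  qed
  have main: "cmod (discrete_convolution s J Z y - discrete_convolution s J Z z)
      \<le> real N * (real N + 1) / s * M * dist y z" if z: "dist y z < \<delta>" for z
  proof -
    have iz: "dist i z \<le> s" using z dist_triangle[of i z y] by (simp add: \<delta>_def)
    have iy: "dist i y \<le> s" using i by simp
    have Sy: "S y \<ge> 1" and Sz: "S z \<ge> 1"
      unfolding S_def using discrete_convolution_eq(1)[OF J i(1)] iy iz by blast+
    \<comment> \<open>Net points outside \<open>?I\<close> are at least 3 s from y, hence at least 2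
      s from any z this close to y, where their bumps vanish.\<close>
    have out: "bump s j x = 0" if "j \<in> J - ?I" "x \<in> {y, z}" for j x
    proof -
      have "3 * s \<le> dist j y" using that by auto
      moreover have "dist j y \<le> dist j z + dist y z" by (metis dist_commute dist_triangle)
      ultimately have "2 * s \<le> dist j x" using that z d by auto
      then show ?thesis by (rule bump_zero[OF J(2)])
    qed
    have SI: "S x = (\<Sum>j\<in>?I. bump s j x)" if "x \<in> {y, z}" for x
      unfolding S_def using out[OF _ that] J by (intro sum.mono_neutral_right) auto
    have cI: "real (card ?I) \<le> real N" using N by simp
    have dS: "\<bar>S z - S y\<bar> \<le> real N * (dist y z / s)"
    proof -
      have "\<bar>S z - S y\<bar> \<le> (\<Sum>j\<in>?I. \<bar>bump s j z - bump s j y\<bar>)"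
        using SI[of y] SI[of z] by (simp flip: sum_subtractf)
      also have "\<dots> \<le> (\<Sum>j\<in>?I. dist y z / s)"
        by (intro sum_mono order_trans[OF bump_lipschitz]) (simp_all add: J dist_commute)
      also have "\<dots> \<le> real N * (dist y z / s)" using mult_right_mono[OF cI, of "dist y z / s"] J by simp
      finally show ?thesis .
    qed
    have coef: "\<bar>bump s j y / S y - bump s j z / S z\<bar> \<le> (real N + 1) / s * dist y z" if j: "j \<in> ?I" for j
    proof -
      \<comment> \<open>Quotient rule for differences: the bump varies at rate 1 / s, the
        denominator at rate N / s, and \<open>bump s j z \<le> S z\<close>.\<close>
      have "bump s j y / S y - bump s j z / S z = (bump s j y - bump s j z) / S y + (bump s j z / S z) * ((S z - S y) / S y)"
        using Sy Sz by (simp add: field_simps)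
      then have "\<bar>bump s j y / S y - bump s j z / S z\<bar> \<le> \<bar>bump s j y - bump s j z\<bar> / S y + (bump s j z / S z) * (\<bar>S z - S y\<bar> / S y)"
        using Sy Sz abs_triangle_ineq[of "(bump s j y - bump s j z) / S y" "(bump s j z / S z) * ((S z - S y) / S y)"]
        by (simp only: abs_mult abs_divide abs_of_nonneg[OF bump_nonneg] abs_of_pos)
      also have "\<dots> \<le> dist y z / s / 1 + 1 * (real N * (dist y z / s) / 1)"
      proof (intro add_mono mult_mono frac_le bump_lipschitz dS Sy J)
        have "bump s j z \<le> S z" using j fI by (subst SI) (auto intro!: member_le_sum)
        then show "bump s j z / S z \<le> 1" using Sz by simp
      qed (use J Sy Sz in auto)
      also have "\<dots> = (real N + 1) / s * dist y z" using J by (simp add: field_simps)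
      finally show ?thesis .
    qed
    have e: "discrete_convolution s J Z x - Z i = (\<Sum>j\<in>?I. of_real (bump s j x / S x) * (Z j - Z i))"
      if x: "x \<in> {y, z}" for x
    proof -
      have "dist i x \<le> s" using x iy iz by auto
      then have "discrete_convolution s J Z x - Z i = (\<Sum>j\<in>J. of_real (bump s j x / S x) * (Z j - Z i))"
        unfolding S_def by (rule discrete_convolution_eq(2)[OF J i(1)])
      also have "\<dots> = (\<Sum>j\<in>?I. of_real (bump s j x / S x) * (Z j - Z i))"
        using out[OF _ x] J by (intro sum.mono_neutral_right) auto
      finally show ?thesis .
    qed
    have "discrete_convolution s J Z y - discrete_convolution s J Z z
        = (discrete_convolution s J Z y - Z i) - (discrete_convolution s J Z z - Z i)" by simp
    also have "\<dots> = (\<Sum>j\<in>?I. of_real (bump s j y / S y) * (Z j - Z i)) - (\<Sum>j\<in>?I. of_real (bump s j z / S z) * (Z j - Z i))"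
      using e[of y] e[of z] by simp
    also have "\<dots> = (\<Sum>j\<in>?I. of_real (bump s j y / S y - bump s j z / S z) * (Z j - Z i))"
      by (simp only: sum_subtractf[symmetric] of_real_diff left_diff_distrib)
    finally have "cmod (discrete_convolution s J Z y - discrete_convolution s J Z z)
        \<le> (\<Sum>j\<in>?I. cmod (of_real (bump s j y / S y - bump s j z / S z) * (Z j - Z i)))" by (simp only: norm_sum)
    also have "\<dots> \<le> (\<Sum>j\<in>?I. (real N + 1) / s * dist y z * M)"
      unfolding norm_mult norm_of_real using coef ZM J by (intro sum_mono mult_mono) auto
    also have "\<dots> \<le> real N * ((real N + 1) / s * dist y z * M)"
      using mult_right_mono[OF cI, of "(real N + 1) / s * dist y z * M"] J M0 by simp
    finally show ?thesis by (simp add: mult_ac)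
  qed
  have L0: "0 \<le> real N * (real N + 1) / s * M" using J M0 by simp
  show "0 \<le> lower_lip (discrete_convolution s J Z) y"
    by (rule lower_lip_le(1)[OF d(1) L0 main])
  show "lower_lip (discrete_convolution s J Z) y \<le> real N * (real N + 1) / s * (\<Sum>j\<in>?I. \<kappa> j)"
    unfolding M_def[symmetric] by (rule lower_lip_le(2)[OF d(1) L0 main])
qed

subsection \<open>Testing the commutator on indicator functions\<close>

lemma doubling_sigma_finite:
  fixes \<mu> :: "'a::metric_space measure"
  assumes "doubling_measure \<mu>" shows "sigma_finite_measure \<mu>"
proof
  let ?A = "range (\<lambda>n::nat. ball (undefined::'a) (real n))"
  have "\<Union> ?A = UNIV"
  proof -
    have "\<exists>n::nat. dist undefined x < real n" for x :: 'a by (rule reals_Archimedean2)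
    then show ?thesis by auto
  qed
  moreover have "emeasure \<mu> a \<noteq> \<infinity>" if "a \<in> ?A" for a
    using that doubling_ball_fmeasurable[OF assms] by (auto simp: fmeasurable_def less_top[symmetric])
  ultimately show "\<exists>A. countable A \<and> A \<subseteq> sets \<mu> \<and> \<Union> A = space \<mu> \<and> (\<forall>a\<in>A. emeasure \<mu> a \<noteq> \<infinity>)"
    using doubling_sets[OF assms] doubling_space[OF assms] by (intro exI[of _ ?A]) auto
qed

lemma locally_integrable_measurable:
  fixes \<mu> :: "'a::metric_space measure"
  assumes "doubling_measure \<mu>" "locally_integrable \<mu> b" shows "b \<in> borel_measurable \<mu>"
proof (rule borel_measurable_LIMSEQ_metric)
  let ?f = "\<lambda>n::nat. \<lambda>x. indicator (ball (undefined::'a) (real n)) x *\<^sub>R b x"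
  show "?f n \<in> borel_measurable \<mu>" for n
    using assms(2) unfolding locally_integrable_def set_integrable_def by (auto intro: borel_measurable_integrable)
  show "(\<lambda>n. ?f n x) \<longlonglongrightarrow> b x" for x
  proof -
    obtain N :: nat where N: "dist undefined x < real N" using reals_Archimedean2 by blast
    have "eventually (\<lambda>n. ?f n x = b x) sequentially"
      unfolding eventually_sequentially
    proof (intro exI[of _ N] allI impI)
      fix n assume "N \<le> n"
      then have "dist undefined x < real n" using N by (meson less_le_trans of_nat_mono)
      then show "?f n x = b x" by simp
    qed
    then show ?thesis by (rule tendsto_eventually)
  qed
qed

lemma ess_support_indicator: "ess_support \<mu> (indicator F) \<subseteq> closure F"
proof
  fix x assume x: "x \<in> ess_support \<mu> (indicator F)"
  show "x \<in> closure F"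
    unfolding closure_approachable
  proof (intro allI impI)
    fix e :: real assume e: "e > 0"
    show "\<exists>y\<in>F. dist y x < e"
    proof (rule ccontr)
      assume "\<not> ?thesis"
      then have "y \<in> ball x e \<longrightarrow> indicator F y = (0::complex)" for y by (auto simp: indicator_def dist_commute)
      then have "AE y in \<mu>. y \<in> ball x e \<longrightarrow> indicator F y = (0::complex)" by simp
      then show False using x e unfolding ess_support_def by blast
    qed
  qed
qed

lemma indicator_bounded_bounded_support:
  fixes \<mu> :: "'a::metric_space measure"
  assumes "sets \<mu> = sets borel" "F \<in> sets borel" "F \<subseteq> ball x r"
  shows "(indicator F :: 'a \<Rightarrow> complex) \<in> bounded_bounded_support \<mu>"
proof -
  have "bounded F" using bounded_subset[OF bounded_ball assms(3)] .
  then have "bounded (ess_support \<mu> (indicator F))"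
    using bounded_subset[OF bounded_closure ess_support_indicator] by blast
  moreover have "bounded (range (indicator F :: 'a \<Rightarrow> complex))"
    by (rule boundedI[of _ 1]) (auto simp: indicator_def)
  ultimately show ?thesis
    using assms unfolding bounded_bounded_support_def by auto
qed

text \<open>The angle pi/9 is relaxed to pi/6, where the cosine is at least 0.86 and the sine at
  most 1/2. Against the slope 3/2 this leaves 0.86 - 1/2 * 3/2 = 0.11, more than the claimed
  1/10.\<close>

lemma sector_product:
  assumes "\<bar>Arg q\<bar> \<le> pi / 9" "\<bar>Im p\<bar> \<le> 3/2 * Re p"
  shows "cmod q * Re p / 10 \<le> Re (q * p)"
proof -
  have q: "q = rcis (cmod q) (Arg q)" by (simp add: rcis_cmod_Arg)
  have Rp: "0 \<le> Re p" using assms(2) by linarith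
  have a: "\<bar>Arg q\<bar> \<le> pi / 6" using assms(1) pi_gt_zero by linarith
  have "cos (pi / 6) \<le> cos \<bar>Arg q\<bar>" using a pi_gt_zero by (intro cos_monotone_0_pi_le) auto
  then have c: "sqrt 3 / 2 \<le> cos (Arg q)" by (simp add: cos_30)
  have "(1.72::real) \<le> sqrt 3" by (rule real_le_rsqrt) (simp add: power2_eq_square)
  then have c': "0.86 \<le> cos (Arg q)" using c by simp
  have "sin \<bar>Arg q\<bar> \<le> sin (pi / 6)" using a pi_gt_zero by (intro sin_monotone_2pi_le) auto
  moreover have "\<bar>sin (Arg q)\<bar> = sin \<bar>Arg q\<bar>"
    using a pi_gt_zero sin_ge_zero[of "\<bar>Arg q\<bar>"] by (cases "Arg q \<ge> 0") auto
  ultimately have s: "\<bar>sin (Arg q)\<bar> \<le> 1/2" by (simp add: sin_30)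
  have Rq: "Re q = cmod q * cos (Arg q)" and Iq: "Im q = cmod q * sin (Arg q)"
    by (metis q Re_rcis) (metis q Im_rcis)
  have 1: "0.86 * Re p \<le> cos (Arg q) * Re p" using c' Rp by (rule mult_right_mono)
  have "\<bar>sin (Arg q) * Im p\<bar> \<le> 1/2 * (3/2 * Re p)"
    unfolding abs_mult using s assms(2) by (intro mult_mono) auto
  then have "Re p / 10 \<le> cos (Arg q) * Re p - sin (Arg q) * Im p" using 1 Rp by (simp add: abs_le_iff)
  then have "cmod q * (Re p / 10) \<le> cmod q * (cos (Arg q) * Re p - sin (Arg q) * Im p)"
    by (intro mult_left_mono) auto
  then show ?thesis using Rq Iq by (simp add: right_diff_distrib mult.assoc)
qed

text \<open>No cancellation is possible: up to one fixed rotation, all values of the kernel times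
  the difference of b on \<open>E \<times> F\<close> lie in a sector about the positive axis. The
  distance \<delta> lets the commutator be represented by its kernel, and the lower bound on
  \<open>V\<close> keeps that kernel bounded.\<close>

lemma pairing_lower_bound:
  fixes \<mu> :: "'a::metric_space measure"
  assumes \<mu>: "doubling_measure \<mu>" and b: "locally_integrable \<mu> b" and K: "singular_kernel \<mu> K"
    and R: "realises_commutator \<mu> K b R"
    and E: "E \<in> sets borel" "E \<subseteq> ball x\<^sub>0 \<rho>" and F: "F \<in> sets borel" "F \<subseteq> ball x\<^sub>0 \<rho>"
    and dist: "\<delta> > 0" "\<And>x y. x \<in> E \<Longrightarrow> y \<in> F \<Longrightarrow> \<delta> \<le> dist x y"
    and V: "0 < v\<^sub>0" "\<And>x y. x \<in> E \<Longrightarrow> y \<in> F \<Longrightarrow> v\<^sub>0 \<le> V \<mu> x y \<and> V \<mu> x y \<le> W"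
    and v: "cmod v = 1" "0 < c" "\<And>x y. x \<in> E \<Longrightarrow> y \<in> F \<Longrightarrow> c / V \<mu> x y \<le> cmod (K x y) \<and> \<bar>Arg (cnj v * K x y)\<bar> \<le> pi / 9"
    and u: "cmod u = 1" "0 \<le> m" "\<And>x y. x \<in> E \<Longrightarrow> y \<in> F \<Longrightarrow> m \<le> Re (u * (b y - b x)) \<and> \<bar>Im (u * (b y - b x))\<bar> \<le> 3/2 * Re (u * (b y - b x))"
  shows "c / W * m / 10 * measure \<mu> E * measure \<mu> F \<le> cmod (LINT x|\<mu>. R (indicator F) x * indicator E x)"
proof (cases "E = {} \<or> F = {}")
  case True then show ?thesis by auto
next
  case False
  then have W: "0 < W" using V by (meson equals0I less_le_trans)
  interpret sigma_finite_measure \<mu> by (rule doubling_sigma_finite[OF \<mu>])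
  note sets = doubling_sets[OF \<mu>] and space = doubling_space[OF \<mu>]
  have Em[measurable]: "E \<in> sets \<mu>" and Fm[measurable]: "F \<in> sets \<mu>" using E F sets by auto
  have bm[measurable]: "b \<in> borel_measurable \<mu>" by (rule locally_integrable_measurable[OF \<mu> b])
  have Ef: "E \<in> fmeasurable \<mu>" and Ff: "F \<in> fmeasurable \<mu>"
    using doubling_subset_fmeasurable[OF \<mu>] E F by blast+
  have bi: "integrable \<mu> (\<lambda>x. indicator A x * cmod (b x))" if "A \<in> sets \<mu>" "A \<subseteq> ball x\<^sub>0 \<rho>" for A
  proof -
    have "set_integrable \<mu> (ball x\<^sub>0 \<rho>) b" using b unfolding locally_integrable_def by blast
    then have "set_integrable \<mu> A b" by (rule set_integrable_subset) (use that in auto)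
    then have "integrable \<mu> (\<lambda>x. norm (indicator A x *\<^sub>R b x))" unfolding set_integrable_def by (rule integrable_norm)
    then show ?thesis by simp
  qed
  obtain C where C: "\<And>x y. x \<noteq> y \<Longrightarrow> cmod (K x y) \<le> C / V \<mu> x y"
    using K unfolding singular_kernel_def by blast
  define k where "k = \<bar>C\<bar> / v\<^sub>0"
  have k0: "k \<ge> 0" using V by (simp add: k_def)
  have ne: "x \<noteq> y" if "x \<in> E" "y \<in> F" for x y using dist(1) dist(2)[OF that] by auto
  have Kb: "cmod (K x y) \<le> k" if "x \<in> E" "y \<in> F" for x y
  proof -
    have "cmod (K x y) \<le> C / V \<mu> x y" by (rule C[OF ne[OF that]])
    also have "\<dots> \<le> \<bar>C\<bar> / v\<^sub>0" using V that by (intro frac_le) auto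
    finally show ?thesis by (simp add: k_def)
  qed
  define h where "h x y = K x y * (b y - b x) * indicator F y * (indicator E x :: complex)" for x y
  \<comment> \<open>Measurability of the kernel is known off the diagonal, which
    \<open>E \<times> F\<close> avoids because E and F are \<delta> apart.\<close>
  have Kmeas: "(\<lambda>(x, y). indicator (E \<times> F) (x, y) *\<^sub>R K x y) \<in> borel_measurable (\<mu> \<Otimes>\<^sub>M \<mu>)"
  proof -
    have sub: "E \<times> F \<subseteq> {(x, y). x \<noteq> y}" using ne by auto
    have "(\<lambda>(x, y). K x y) \<in> borel_measurable (restrict_space (\<mu> \<Otimes>\<^sub>M \<mu>) {(x, y). x \<noteq> y})"
      using K unfolding singular_kernel_def by blast
    then have "(\<lambda>(x, y). K x y) \<in> borel_measurable (restrict_space (\<mu> \<Otimes>\<^sub>M \<mu>) (E \<times> F))"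
      by (rule measurable_restrict_mono[OF _ sub])
    then have "(\<lambda>z. indicator (E \<times> F) z *\<^sub>R (case z of (x, y) \<Rightarrow> K x y)) \<in> borel_measurable (\<mu> \<Otimes>\<^sub>M \<mu>)"
      by (subst (asm) borel_measurable_restrict_space_iff) (auto simp: space)
    then show ?thesis by (simp add: case_prod_unfold)
  qed
  have heq: "case_prod h = (\<lambda>z. (case z of (x, y) \<Rightarrow> indicator (E \<times> F) (x, y) *\<^sub>R K x y) * (b (snd z) - b (fst z)))"
    by (auto simp: h_def indicator_def split: prod.split)
  have hm: "case_prod h \<in> borel_measurable (\<mu> \<Otimes>\<^sub>M \<mu>)"
    unfolding heq using Kmeas by measurable
  have hs: "h x \<in> borel_measurable \<mu>" for x
    using measurable_compose[OF measurable_Pair1' hm, of x] by (simp add: space)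
  have hb: "cmod (h x y) \<le> indicator E x * (k * (indicator F y * cmod (b y)) + k * cmod (b x) * indicator F y)" for x y
  proof (cases "x \<in> E \<and> y \<in> F")
    case True
    have "cmod (h x y) = cmod (K x y) * cmod (b y - b x)" using True by (simp add: h_def norm_mult)
    also have "\<dots> \<le> k * (cmod (b y) + cmod (b x))"
      using Kb True k0 by (intro mult_mono norm_triangle_ineq4) auto
    finally show ?thesis using True by (simp add: distrib_left)
  next
    case False then show ?thesis by (auto simp: h_def)
  qed
  have Fi: "integrable \<mu> (indicator F :: 'a \<Rightarrow> real)" "integrable \<mu> (indicator E :: 'a \<Rightarrow> real)"
    using Ef Ff by (auto simp: fmeasurable_def)
  have dom: "integrable \<mu> (\<lambda>y. indicator E x * (k * (indicator F y * cmod (b y)) + k * cmod (b x) * indicator F y))" for x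
    using bi[OF Fm F(2)] Fi by auto
  have hi: "integrable \<mu> (h x)" for x
    by (rule integrable_norm_bound[OF dom[of x] hs hb])
  define H where "H x = (LINT y|\<mu>. h x y)" for x
  have Hm: "H \<in> borel_measurable \<mu>"
    unfolding H_def by (rule borel_measurable_lebesgue_integral[OF hm])
  have Hb: "cmod (H x) \<le> k * (LINT y|\<mu>. indicator F y * cmod (b y)) * indicator E x + k * measure \<mu> F * (indicator E x * cmod (b x))" for x
  proof -
    have "cmod (H x) \<le> (LINT y|\<mu>. cmod (h x y))" unfolding H_def by (rule integral_norm_bound)
    also have "\<dots> \<le> (LINT y|\<mu>. indicator E x * (k * (indicator F y * cmod (b y)) + k * cmod (b x) * indicator F y))"
      by (intro integral_mono integrable_norm hi dom hb)
    also have "\<dots> = indicator E x * (k * (LINT y|\<mu>. indicator F y * cmod (b y)) + k * cmod (b x) * measure \<mu> F)"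
      using bi[OF Fm F(2)] Fi by (simp add: space)
    finally show ?thesis by (simp add: algebra_simps)
  qed
  have Hi: "integrable \<mu> H"
    by (rule integrable_norm_bound[OF _ Hm Hb]) (use Fi bi[OF Em E(2)] in simp)
  \<comment> \<open>One rotation serves all of \<open>E \<times> F\<close>: \<open>cnj v\<close>
    aligns the kernel, u aligns the difference of values.\<close>
  define \<gamma> where "\<gamma> = cnj v * u"
  have g1: "cmod \<gamma> = 1" using u v by (simp add: \<gamma>_def norm_mult)
  define t where "t = c / W * m / 10"
  have hlow: "t * indicator F y \<le> Re (\<gamma> * h x y)" if x: "x \<in> E" for x y
  proof (cases "y \<in> F")
    case True
    have "c / W \<le> c / V \<mu> x y" using V(1) V(2)[OF x True] v W by (intro divide_left_mono) auto
    then have K1: "c / W \<le> cmod (cnj v * K x y)" using v(1) v(3)[OF x True] by (simp add: norm_mult)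
    have "t \<le> cmod (cnj v * K x y) * Re (u * (b y - b x)) / 10"
      unfolding t_def using K1 u(2) u(3)[OF x True] v W by (intro divide_right_mono mult_mono) auto
    also have "\<dots> \<le> Re ((cnj v * K x y) * (u * (b y - b x)))"
      by (rule sector_product) (use v(3)[OF x True] u(3)[OF x True] in auto)
    also have "(cnj v * K x y) * (u * (b y - b x)) = \<gamma> * h x y" using x True by (simp add: h_def \<gamma>_def)
    finally show ?thesis using True by simp
  next
    case False then show ?thesis by (simp add: h_def)
  qed
  have Hlow: "t * measure \<mu> F * indicator E x \<le> Re (\<gamma> * H x)" for x
  proof (cases "x \<in> E")
    case True
    have "t * measure \<mu> F = (LINT y|\<mu>. t * indicator F y)" by (simp add: space)
    also have "\<dots> \<le> (LINT y|\<mu>. Re (\<gamma> * h x y))"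
      using hi[of x] Fi by (intro integral_mono hlow[OF True]) auto
    also have "\<dots> = Re (LINT y|\<mu>. \<gamma> * h x y)" using hi[of x] by (intro integral_Re) simp
    also have "(LINT y|\<mu>. \<gamma> * h x y) = \<gamma> * H x" by (simp add: H_def)
    finally show ?thesis using True by simp
  next
    case False then show ?thesis by (simp add: H_def h_def)
  qed
  have "t * measure \<mu> F * measure \<mu> E = (LINT x|\<mu>. t * measure \<mu> F * indicator E x)" by (simp add: space)
  also have "\<dots> \<le> (LINT x|\<mu>. Re (\<gamma> * H x))" using Hi Fi by (intro integral_mono Hlow) auto
  also have "\<dots> = Re (LINT x|\<mu>. \<gamma> * H x)" using Hi by (intro integral_Re) simp
  also have "\<dots> = Re (\<gamma> * (LINT x|\<mu>. H x))" by simp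
  also have "\<dots> \<le> cmod (\<gamma> * (LINT x|\<mu>. H x))" by (rule complex_Re_le_cmod)
  also have "\<dots> = cmod (LINT x|\<mu>. H x)" using g1 by (simp add: norm_mult)
  also have "(LINT x|\<mu>. H x) = (LINT x|\<mu>. R (indicator F) x * indicator E x)"
  proof -
    have "\<exists>\<delta>>0. \<forall>x\<in>ess_support \<mu> (indicator E). \<forall>y\<in>ess_support \<mu> (indicator F). \<delta> \<le> dist x y"
    \<comment> \<open>Essential supports may reach into the closures of E and F; two approximations
      within \<delta> / 4 cost half of the distance.\<close>
    proof (intro exI[of _ "\<delta> / 2"] conjI ballI)
      fix x y assume "x \<in> ess_support \<mu> (indicator E)" "y \<in> ess_support \<mu> (indicator F)"
      then have "x \<in> closure E" "y \<in> closure F" using ess_support_indicator by blast+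
      moreover have "\<delta> / 4 > 0" using dist(1) by simp
      ultimately obtain x' y' where xy: "x' \<in> E" "dist x' x < \<delta> / 4" "y' \<in> F" "dist y' y < \<delta> / 4"
        unfolding closure_approachable by blast
      have "dist x' y' \<le> dist x' x + dist x y + dist y y'"
        using dist_triangle[of x' y' x] dist_triangle[of x y' y] by linarith
      then show "\<delta> / 2 \<le> dist x y" using dist(2)[OF xy(1,3)] xy by (simp add: dist_commute)
    qed (use dist in simp)
    then have "(LINT x|\<mu>. R (indicator F) x * indicator E x) = (LINT x|\<mu>. LINT y|\<mu>. K x y * (b y - b x) * indicator F y * indicator E x)"
      using R indicator_bounded_bounded_support[OF sets E] indicator_bounded_bounded_support[OF sets F]
      unfolding realises_commutator_def by blast
    then show ?thesis unfolding H_def h_def by simp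
  qed
  finally show ?thesis by (simp add: t_def mult_ac)
qed

text \<open>The dichotomy is applied to \<open>ball x s\<close> and to the ball of the same radius
  about the partner point that non-degeneracy provides. Either the radius is at most the slack
  \<tau>, or the separated sets are test sets for \<open>pairing_lower_bound\<close>; doubling
  expresses all measures through that of \<open>ball x (A * s)\<close>.\<close>

lemma oscillation_pairing:
  fixes \<mu> :: "'a::metric_space measure"
  assumes \<mu>: "doubling_measure \<mu>" and b: "locally_integrable \<mu> b" and K: "singular_kernel \<mu> K"
    and nd: "strongly_nondegenerate \<mu> K" and R: "realises_commutator \<mu> K b R"
    and \<theta>: "0 < \<theta>" "\<theta> < 1/2"
  obtains A C where "A \<ge> 1" "C > 0" "\<And>x s \<tau>. s > 0 \<Longrightarrow> \<tau> > 0 \<Longrightarrow> \<exists>z \<kappa> E F. E \<in> sets borel \<and> F \<in> sets borel \<and>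
    E \<subseteq> ball x (A * s) \<and> F \<subseteq> ball x (A * s) \<and> 0 < \<kappa> \<and> concentrated \<mu> \<theta> (ball x s) b z \<kappa> \<and>
    \<kappa> \<le> \<tau> + C * (cmod (LINT y|\<mu>. R (indicator F) y * indicator E y) / measure \<mu> (ball x (A * s)))"
proof -
  obtain \<alpha> c c\<^sub>0 C\<^sub>0 where pos: "\<alpha> > 0" "c > 0" "c\<^sub>0 > 0" and
    nd': "\<And>x\<^sub>0 r. r > 0 \<Longrightarrow> \<exists>y\<^sub>0 v. c\<^sub>0 * r \<le> dist x\<^sub>0 y\<^sub>0 \<and> dist x\<^sub>0 y\<^sub>0 \<le> C\<^sub>0 * r \<and> cmod v = 1 \<and>
           ((\<forall>x y. x \<noteq> y \<and> (x, y) \<in> ball x\<^sub>0 (\<alpha> * r) \<times> ball y\<^sub>0 (\<alpha> * r) \<longrightarrow>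
               cmod (K x y) \<ge> c / V \<mu> x y \<and> \<bar>Arg (cnj v * K x y)\<bar> \<le> pi / 9) \<or>
            (\<forall>x y. x \<noteq> y \<and> (y, x) \<in> ball x\<^sub>0 (\<alpha> * r) \<times> ball y\<^sub>0 (\<alpha> * r) \<longrightarrow>
               cmod (K x y) \<ge> c / V \<mu> x y \<and> \<bar>Arg (cnj v * K x y)\<bar> \<le> pi / 9))"
    using nd unfolding strongly_nondegenerate_def by metis
  obtain c' where c': "c' > 0" and sep: "\<And>(\<mu> :: 'a measure) Q1 Q2 b \<kappa>. b \<in> borel_measurable \<mu> \<Longrightarrow> Q1 \<in> fmeasurable \<mu> \<Longrightarrow> Q2 \<in> fmeasurable \<mu>
    \<Longrightarrow> measure \<mu> Q1 > 0 \<Longrightarrow> measure \<mu> Q2 > 0 \<Longrightarrow> \<kappa> > 0 \<Longrightarrow>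
    \<exists>z r. 0 < r \<and> concentrated \<mu> \<theta> Q1 b z r \<and> concentrated \<mu> \<theta> Q2 b z r \<and> (r \<le> \<kappa> \<or>
      (\<exists>A1 A2 w. A1 \<in> sets \<mu> \<and> A2 \<in> sets \<mu> \<and> A1 \<subseteq> Q1 \<and> A2 \<subseteq> Q2 \<and> cmod w = 1 \<and>
         c' * measure \<mu> Q1 \<le> measure \<mu> A1 \<and> c' * measure \<mu> Q2 \<le> measure \<mu> A2 \<and>
         (\<forall>x\<in>A1. \<forall>y\<in>A2. c' * r \<le> Re (w * (b x - b y)) \<and> \<bar>Im (w * (b x - b y))\<bar> \<le> 3/2 * Re (w * (b x - b y)))))"
    using concentration_or_separation[OF \<theta>] by blast
  have bm: "b \<in> borel_measurable \<mu>" by (rule locally_integrable_measurable[OF \<mu> b])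
  \<comment> \<open>With s = \<beta> r, the bound \<beta> \<le> \<alpha> puts the balls of radius s
    inside those of the non-degeneracy condition, and 4 s is at most the distance of their centres,
    so that their points are at least s apart. The factor A below makes
    \<open>ball x (A * s)\<close> contain both.\<close>
  define \<beta> where "\<beta> = min \<alpha> (c\<^sub>0 / 4)"
  have \<beta>: "\<beta> > 0" "\<beta> \<le> \<alpha>" "\<beta> \<le> c\<^sub>0 / 4" using pos by (auto simp: \<beta>_def)
  define A where "A = max 1 (C\<^sub>0 / \<beta> + 2)"
  obtain D1 where D1: "D1 \<ge> 1" "\<And>(x::'a) y r R. r > 0 \<Longrightarrow> dist x y + R \<le> 2 * r \<Longrightarrow> measure \<mu> (ball x R) \<le> D1 * measure \<mu> (ball y r)"
    using doubling_ball_ratio[OF \<mu>, of 2] by blast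
  obtain D2 where D2: "D2 \<ge> 1" "\<And>(x::'a) y r R. r > 0 \<Longrightarrow> dist x y + R \<le> (2 * A) * r \<Longrightarrow> measure \<mu> (ball x R) \<le> D2 * measure \<mu> (ball y r)"
    using doubling_ball_ratio[OF \<mu>, of "2 * A"] by blast
  \<comment> \<open>The inverse of what the pairing yields: c' enters once through the separation
    \<open>c' * \<kappa>\<close> and twice through the measures of the test sets, each of which also
    costs D2; D1 bounds \<open>V\<close> from above.\<close>
  define C where "C = 10 * D1 * D2\<^sup>2 / (c * c' ^ 3)"
  have C0: "C > 0" unfolding C_def using pos c' D1 D2 by simp
  show ?thesis
  proof (rule that[of A C])
    show "A \<ge> 1" by (simp add: A_def)
    show "C > 0" by (rule C0)
    fix x :: 'a and s \<tau> :: real assume s: "s > 0" and \<tau>: "\<tau> > 0"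
    define r where "r = s / \<beta>"
    have r: "r > 0" "s = \<beta> * r" using s \<beta> by (auto simp: r_def)
    obtain y v where y: "c\<^sub>0 * r \<le> dist x y" "dist x y \<le> C\<^sub>0 * r" and v: "cmod v = 1" and
      alt: "(\<forall>p q. p \<noteq> q \<and> (p, q) \<in> ball x (\<alpha> * r) \<times> ball y (\<alpha> * r) \<longrightarrow>
               cmod (K p q) \<ge> c / V \<mu> p q \<and> \<bar>Arg (cnj v * K p q)\<bar> \<le> pi / 9) \<or>
            (\<forall>p q. p \<noteq> q \<and> (q, p) \<in> ball x (\<alpha> * r) \<times> ball y (\<alpha> * r) \<longrightarrow>
               cmod (K p q) \<ge> c / V \<mu> p q \<and> \<bar>Arg (cnj v * K p q)\<bar> \<le> pi / 9)"
      using nd'[OF r(1), of x] by (elim exE conjE) (rule that)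
    have s\<alpha>: "s \<le> \<alpha> * r" using \<beta>(2) r by (simp add: mult_right_mono)
    have sc: "4 * s \<le> c\<^sub>0 * r" using \<beta>(3) r mult_right_mono[of \<beta> "c\<^sub>0 / 4" r] by simp
    have Cr: "C\<^sub>0 * r + 2 * s \<le> A * s"
    proof -
      have "C\<^sub>0 * r + 2 * s = (C\<^sub>0 / \<beta> + 2) * s" unfolding r_def by (simp add: distrib_right)
      also have "\<dots> \<le> A * s" using s by (intro mult_right_mono) (auto simp: A_def)
      finally show ?thesis .
    qed
    define M where "M = measure \<mu> (ball x (A * s))"
    have As: "A * s > 0" using s by (simp add: A_def)
    have M: "M > 0" unfolding M_def by (rule doubling_ball_pos[OF \<mu> As])
    obtain z \<kappa> where zk: "0 < \<kappa>" "concentrated \<mu> \<theta> (ball x s) b z \<kappa>" and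
      kk: "\<kappa> \<le> \<tau> \<or>
      (\<exists>A1 A2 w. A1 \<in> sets \<mu> \<and> A2 \<in> sets \<mu> \<and> A1 \<subseteq> ball x s \<and> A2 \<subseteq> ball y s \<and> cmod w = 1 \<and>
         c' * measure \<mu> (ball x s) \<le> measure \<mu> A1 \<and> c' * measure \<mu> (ball y s) \<le> measure \<mu> A2 \<and>
         (\<forall>x\<in>A1. \<forall>y\<in>A2. c' * \<kappa> \<le> Re (w * (b x - b y)) \<and> \<bar>Im (w * (b x - b y))\<bar> \<le> 3/2 * Re (w * (b x - b y))))"
      using sep[OF bm doubling_ball_fmeasurable[OF \<mu>] doubling_ball_fmeasurable[OF \<mu>] doubling_ball_pos[OF \<mu> s] doubling_ball_pos[OF \<mu> s] \<tau>, of x y] by blast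
    have "\<exists>E F. E \<in> sets borel \<and> F \<in> sets borel \<and> E \<subseteq> ball x (A * s) \<and> F \<subseteq> ball x (A * s) \<and>
       \<kappa> \<le> \<tau> + C * (cmod (LINT y|\<mu>. R (indicator F) y * indicator E y) / M)"
      using kk
    proof
      assume "\<kappa> \<le> \<tau>"
      \<comment> \<open>With empty test sets the pairing vanishes and \<tau> alone is the
        bound.\<close>
      then show ?thesis by (intro exI[of _ "{}"]) auto
    next
      assume "\<exists>A1 A2 w. A1 \<in> sets \<mu> \<and> A2 \<in> sets \<mu> \<and> A1 \<subseteq> ball x s \<and> A2 \<subseteq> ball y s \<and> cmod w = 1 \<and>
         c' * measure \<mu> (ball x s) \<le> measure \<mu> A1 \<and> c' * measure \<mu> (ball y s) \<le> measure \<mu> A2 \<and>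
         (\<forall>x\<in>A1. \<forall>y\<in>A2. c' * \<kappa> \<le> Re (w * (b x - b y)) \<and> \<bar>Im (w * (b x - b y))\<bar> \<le> 3/2 * Re (w * (b x - b y)))"
      then obtain A1 A2 w where A: "A1 \<in> sets borel" "A2 \<in> sets borel" "A1 \<subseteq> ball x s" "A2 \<subseteq> ball y s" and w: "cmod w = 1"
        and mA: "c' * measure \<mu> (ball x s) \<le> measure \<mu> A1" "c' * measure \<mu> (ball y s) \<le> measure \<mu> A2"
        and cone: "\<And>x y. x \<in> A1 \<Longrightarrow> y \<in> A2 \<Longrightarrow> c' * \<kappa> \<le> Re (w * (b x - b y)) \<and> \<bar>Im (w * (b x - b y))\<bar> \<le> 3/2 * Re (w * (b x - b y))"
        unfolding doubling_sets[OF \<mu>] by (elim exE conjE) blast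
      have dxy: "dist p q \<le> A * s" "s \<le> dist p q" "dist x q + s \<le> A * s" "dist x p + s \<le> A * s" if "p \<in> A1" "q \<in> A2" for p q
      proof -
        have p: "dist x p < s" and q: "dist y q < s" using A that by auto
        show "dist p q \<le> A * s" using dist_triangle[of p q x] dist_triangle[of x q y] p q y(2) Cr by (simp add: dist_commute)
        show "s \<le> dist p q" using dist_triangle[of x y p] dist_triangle[of p y q] p q y(1) sc s by (simp add: dist_commute)
        show "dist x q + s \<le> A * s" using dist_triangle[of x q y] q y(2) Cr by (simp add: dist_commute)
        have "0 \<le> dist x y" by simp
        then show "dist x p + s \<le> A * s" using p y(2) Cr by linarith
      qed
      have sub: "A1 \<subseteq> ball x (A * s)" "A2 \<subseteq> ball x (A * s)"
      proof -
        have "0 \<le> dist x y" by simp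
        then have "s \<le> A * s" "dist x y + s \<le> A * s" using y(2) Cr s by linarith+
        then show "A1 \<subseteq> ball x (A * s)" "A2 \<subseteq> ball x (A * s)"
          using A ball_subset_ballI[of x x s "A * s"] ball_subset_ballI[of y x s "A * s"] by (auto simp: dist_commute)
      qed
      have big: "M \<le> D2 * measure \<mu> (ball q s)" if "dist x q \<le> A * s" for q
        unfolding M_def by (rule D2(2)) (use that s in auto)
      have Vlow: "M / D2 \<le> V \<mu> p q" if "dist x p \<le> A * s" "s \<le> dist p q" for p q
      proof -
        have "M \<le> D2 * measure \<mu> (ball p s)" by (rule big[OF that(1)])
        also have "\<dots> \<le> D2 * V \<mu> p q"
          unfolding V_def using D2(1) that(2) by (intro mult_left_mono doubling_ball_mono[OF \<mu>] subset_ball) auto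
        finally show ?thesis using D2(1) by (simp add: pos_divide_le_eq mult.commute)
      qed
      have Vup: "V \<mu> p q \<le> D1 * M" if "dist x p \<le> A * s" "dist p q \<le> A * s" for p q
        unfolding V_def M_def by (rule D1(2)) (use that As in \<open>auto simp: dist_commute\<close>)
      have mM: "c' / D2 * M \<le> measure \<mu> A1" "c' / D2 * M \<le> measure \<mu> A2"
      proof -
        have "c' * M \<le> c' * (D2 * measure \<mu> (ball x s))" using c' As by (intro mult_left_mono big) auto
        also have "\<dots> \<le> D2 * measure \<mu> A1" using mA(1) D2(1) mult_left_mono[OF mA(1), of D2] by (simp add: mult_ac)
        finally show "c' / D2 * M \<le> measure \<mu> A1" using D2(1) by (simp add: pos_divide_le_eq mult.commute)
        have "dist x y \<le> A * s" using y(2) Cr s by linarith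
        then have "c' * M \<le> c' * (D2 * measure \<mu> (ball y s))" using c' by (intro mult_left_mono big) auto
        also have "\<dots> \<le> D2 * measure \<mu> A2" using mA(2) D2(1) mult_left_mono[OF mA(2), of D2] by (simp add: mult_ac)
        finally show "c' / D2 * M \<le> measure \<mu> A2" using D2(1) by (simp add: pos_divide_le_eq mult.commute)
      qed
      have v0: "0 < M / D2" using M D2 by simp
      have fin: "\<kappa> \<le> \<tau> + C * (I / M)"
        if "c / (D1 * M) * (c' * \<kappa>) / 10 * a1 * a2 \<le> I" "c' / D2 * M \<le> a1" "c' / D2 * M \<le> a2" for I a1 a2
      proof -
        have nn: "0 \<le> c / (D1 * M) * (c' * \<kappa>) / 10" using pos c' zk M D1 by simp
        have "c / (D1 * M) * (c' * \<kappa>) / 10 * (c' / D2 * M) * (c' / D2 * M) \<le> c / (D1 * M) * (c' * \<kappa>) / 10 * a1 * a2"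
        proof -
          have l: "0 \<le> c' / D2 * M" using c' D2(1) M by simp
          then have "(c' / D2 * M) * (c' / D2 * M) \<le> a1 * a2" using that(2,3) by (intro mult_mono) linarith+
          from mult_left_mono[OF this nn] show ?thesis by (simp only: mult.assoc)
        qed
        then have "c / (D1 * M) * (c' * \<kappa>) / 10 * (c' / D2 * M) * (c' / D2 * M) \<le> I" using that(1) by linarith
        moreover have "c / (D1 * M) * (c' * \<kappa>) / 10 * (c' / D2 * M) * (c' / D2 * M) = \<kappa> * M / C"
          unfolding C_def using M D1 D2 c' pos by (simp add: field_simps power2_eq_square power3_eq_cube)
        ultimately have "\<kappa> * M \<le> C * I" using C0 by (simp add: pos_divide_le_eq mult.commute)
        then have "\<kappa> \<le> C * (I / M)" using M by (simp add: pos_le_divide_eq)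
        then show ?thesis using \<tau> by linarith
      qed
      from alt show ?thesis
      proof
        assume k: "\<forall>p q. p \<noteq> q \<and> (p, q) \<in> ball x (\<alpha> * r) \<times> ball y (\<alpha> * r) \<longrightarrow>
               cmod (K p q) \<ge> c / V \<mu> p q \<and> \<bar>Arg (cnj v * K p q)\<bar> \<le> pi / 9"
        have "c / (D1 * M) * (c' * \<kappa>) / 10 * measure \<mu> A1 * measure \<mu> A2 \<le> cmod (LINT x|\<mu>. R (indicator A2) x * indicator A1 x)"
        proof (rule pairing_lower_bound[OF \<mu> b K R A(1) sub(1) A(2) sub(2) s dxy(2) v0 _ v pos(2), where u="-w"])
          show "cmod (- w) = 1" using w by simp
          show "0 \<le> c' * \<kappa>" using c' zk by simp
        next
          fix p q assume pq: "p \<in> A1" "q \<in> A2"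
          show "M / D2 \<le> V \<mu> p q \<and> V \<mu> p q \<le> D1 * M" using Vlow Vup dxy[OF pq] s by simp
          have "p \<noteq> q" using dxy(2)[OF pq] s by auto
          moreover have "p \<in> ball x (\<alpha> * r)" "q \<in> ball y (\<alpha> * r)" using pq A s\<alpha> by auto
          ultimately show "c / V \<mu> p q \<le> cmod (K p q) \<and> \<bar>Arg (cnj v * K p q)\<bar> \<le> pi / 9" using k by blast
          have "- w * (b q - b p) = w * (b p - b q)" by (simp add: algebra_simps)
          then show "c' * \<kappa> \<le> Re (- w * (b q - b p)) \<and> \<bar>Im (- w * (b q - b p))\<bar> \<le> 3/2 * Re (- w * (b q - b p))"
            using cone[OF pq] by (simp only:)
        qed
        from fin[OF this mM] show ?thesis using A sub by blast
      next
        assume k: "\<forall>p q. p \<noteq> q \<and> (q, p) \<in> ball x (\<alpha> * r) \<times> ball y (\<alpha> * r) \<longrightarrow>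
               cmod (K p q) \<ge> c / V \<mu> p q \<and> \<bar>Arg (cnj v * K p q)\<bar> \<le> pi / 9"
        \<comment> \<open>Here the first variable of the kernel runs near y, so the test sets change
          places and the rotation is w in place of -w.\<close>
        have "c / (D1 * M) * (c' * \<kappa>) / 10 * measure \<mu> A2 * measure \<mu> A1 \<le> cmod (LINT x|\<mu>. R (indicator A1) x * indicator A2 x)"
        proof (rule pairing_lower_bound[OF \<mu> b K R A(2) sub(2) A(1) sub(1) s _ v0 _ v pos(2), where u="w"])
          show "cmod w = 1" by (rule w)
          show "0 \<le> c' * \<kappa>" using c' zk by simp
        next
          fix q p assume pq: "q \<in> A2" "p \<in> A1"
          show "s \<le> dist q p" using dxy(2)[OF pq(2,1)] by (simp add: dist_commute)
          show "M / D2 \<le> V \<mu> q p \<and> V \<mu> q p \<le> D1 * M" using Vlow[of q p] Vup[of q p] dxy[OF pq(2,1)] s by (simp add: dist_commute)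
          have "q \<noteq> p" using dxy(2)[OF pq(2,1)] s by auto
          moreover have "p \<in> ball x (\<alpha> * r)" "q \<in> ball y (\<alpha> * r)" using pq A s\<alpha> by auto
          ultimately show "c / V \<mu> q p \<le> cmod (K q p) \<and> \<bar>Arg (cnj v * K q p)\<bar> \<le> pi / 9" using k by blast
          show "c' * \<kappa> \<le> Re (w * (b p - b q)) \<and> \<bar>Im (w * (b p - b q))\<bar> \<le> 3/2 * Re (w * (b p - b q))"
            by (rule cone[OF pq(2,1)])
        qed
        from fin[OF this mM(2,1)] show ?thesis using A sub by blast
      qed
    qed
    then show "\<exists>z \<kappa> E F. E \<in> sets borel \<and> F \<in> sets borel \<and>
      E \<subseteq> ball x (A * s) \<and> F \<subseteq> ball x (A * s) \<and> 0 < \<kappa> \<and> concentrated \<mu> \<theta> (ball x s) b z \<kappa> \<and>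
      \<kappa> \<le> \<tau> + C * (cmod (LINT y|\<mu>. R (indicator F) y * indicator E y) / measure \<mu> (ball x (A * s)))"
      unfolding M_def using zk by blast
  qed
qed

subsection \<open>Oscillations at a single scale\<close>

lemma indicator_L2:
  assumes "F \<in> fmeasurable \<mu>"
  shows "(\<lambda>x. of_real a * indicator F x) \<in> L2 \<mu>"
    "L2_norm \<mu> (\<lambda>x. of_real a * indicator F x) = \<bar>a\<bar> * sqrt (measure \<mu> F)"
proof -
  have F: "F \<in> sets \<mu>" "emeasure \<mu> F < \<infinity>" using assms by (auto simp: fmeasurable_def)
  have e: "(\<lambda>x. (cmod (of_real a * indicator F x))\<^sup>2) = (\<lambda>x. a\<^sup>2 * indicator F x)"
    by (auto simp: indicator_def norm_mult)
  show "(\<lambda>x. of_real a * indicator F x) \<in> L2 \<mu>" unfolding L2_def mem_Collect_eq e using F by auto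
  have "F \<inter> space \<mu> = F" using sets.sets_into_space[OF F(1)] by blast
  then show "L2_norm \<mu> (\<lambda>x. of_real a * indicator F x) = \<bar>a\<bar> * sqrt (measure \<mu> F)"
    unfolding L2_norm_def e by (simp add: real_sqrt_mult)
qed

text \<open>At each point at most N terms are nonzero, so Cauchy-Schwarz over these costs a factor
  N.\<close>

lemma overlap_lincomb_bound:
  assumes J: "finite J" and L: "\<And>j. j \<in> J \<Longrightarrow> e j \<in> L2 \<mu>" "\<And>j. j \<in> J \<Longrightarrow> L2_norm \<mu> (e j) \<le> 1"
    and N: "\<And>x. card {j \<in> J. e j x \<noteq> 0} \<le> N"
  shows "(L2_norm \<mu> (\<lambda>x. \<Sum>j\<in>J. c j * e j x))\<^sup>2 \<le> real N * (\<Sum>j\<in>J. (cmod (c j))\<^sup>2)"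
proof -
  have i: "integrable \<mu> (\<lambda>x. (cmod (c j * e j x))\<^sup>2)" if "j \<in> J" for j
    using L2_integrable[OF L2_cmult[OF L(1)[OF that]]] .
  have pt: "(cmod (\<Sum>j\<in>J. c j * e j x))\<^sup>2 \<le> real N * (\<Sum>j\<in>J. (cmod (c j * e j x))\<^sup>2)" for x
  proof -
    let ?I = "{j \<in> J. e j x \<noteq> 0}"
    have "(\<Sum>j\<in>J. c j * e j x) = (\<Sum>j\<in>?I. c j * e j x)"
      using J by (intro sum.mono_neutral_right) auto
    then have "(cmod (\<Sum>j\<in>J. c j * e j x))\<^sup>2 \<le> (\<Sum>j\<in>?I. cmod (c j * e j x))\<^sup>2"
      by (simp only:) (intro power_mono norm_sum norm_ge_zero)
    also have "\<dots> \<le> (\<Sum>j\<in>?I. (cmod (c j * e j x))\<^sup>2) * card ?I" by (rule sum_squared_le_sum_of_squares)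
    also have "\<dots> \<le> (\<Sum>j\<in>J. (cmod (c j * e j x))\<^sup>2) * N"
      using J N[of x] by (intro mult_mono sum_mono2 sum_nonneg) auto
    finally show ?thesis by (simp only: mult.commute)
  qed
  have "(L2_norm \<mu> (\<lambda>x. \<Sum>j\<in>J. c j * e j x))\<^sup>2 \<le> (LINT x|\<mu>. real N * (\<Sum>j\<in>J. (cmod (c j * e j x))\<^sup>2))"
    unfolding L2_norm_sq
  proof (rule integral_mono)
    show "integrable \<mu> (\<lambda>x. (cmod (\<Sum>j\<in>J. c j * e j x))\<^sup>2)"
      by (rule L2_integrable) (intro L2_lincomb J L)
    show "integrable \<mu> (\<lambda>x. real N * (\<Sum>j\<in>J. (cmod (c j * e j x))\<^sup>2))" using i by auto
  qed (rule pt)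
  also have "\<dots> = real N * (\<Sum>j\<in>J. (L2_norm \<mu> (\<lambda>x. c j * e j x))\<^sup>2)"
    unfolding L2_norm_sq using i by (simp add: Bochner_Integration.integral_sum)
  also have "\<dots> \<le> real N * (\<Sum>j\<in>J. (cmod (c j))\<^sup>2)"
  proof (intro mult_left_mono sum_mono)
    fix j assume j: "j \<in> J"
    have "L2_norm \<mu> (\<lambda>x. c j * e j x) \<le> cmod (c j)"
      unfolding L2_norm_cmult using mult_left_mono[OF L(2)[OF j], of "cmod (c j)"] by simp
    then show "(L2_norm \<mu> (\<lambda>x. c j * e j x))\<^sup>2 \<le> (cmod (c j))\<^sup>2" by (intro power_mono) auto
  qed simp
  finally show ?thesis .
qed

text \<open>Each coefficient sees u on \<open>B j\<close> only, and the integrals of |u|^2 over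
  these sets overlap at most N times.\<close>

lemma overlap_coefficient_bound:
  assumes J: "finite J" and L: "\<And>j. j \<in> J \<Longrightarrow> e j \<in> L2 \<mu>" "\<And>j. j \<in> J \<Longrightarrow> L2_norm \<mu> (e j) \<le> 1"
    and B: "\<And>j. j \<in> J \<Longrightarrow> B j \<in> sets \<mu>" "\<And>j x. j \<in> J \<Longrightarrow> x \<notin> B j \<Longrightarrow> e j x = 0"
    and N: "\<And>x. card {j \<in> J. x \<in> B j} \<le> N" and u: "u \<in> L2 \<mu>"
  shows "(\<Sum>j\<in>J. (cmod (ip \<mu> u (e j)))\<^sup>2) \<le> real N * (L2_norm \<mu> u)\<^sup>2"
proof -
  have ui: "integrable \<mu> (\<lambda>x. (cmod (u x))\<^sup>2)" using u by (simp add: L2_def)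
  have um: "u \<in> borel_measurable \<mu>" using u by (simp add: L2_def)
  have bi: "integrable \<mu> (\<lambda>x. (cmod (u x))\<^sup>2 * indicator (B j) x)" if "j \<in> J" for j
    using integrable_real_mult_indicator[OF B(1)[OF that] ui] .
  have "(\<Sum>j\<in>J. (cmod (ip \<mu> u (e j)))\<^sup>2) \<le> (\<Sum>j\<in>J. LINT x|\<mu>. (cmod (u x))\<^sup>2 * indicator (B j) x)"
  proof (intro sum_mono)
    fix j assume j: "j \<in> J"
    let ?v = "\<lambda>x. u x * indicator (B j) x"
    have e: "(\<lambda>x. (cmod (?v x))\<^sup>2) = (\<lambda>x. (cmod (u x))\<^sup>2 * indicator (B j) x)"
      by (auto simp: indicator_def)
    have v: "?v \<in> L2 \<mu>" unfolding L2_def mem_Collect_eq e using bi[OF j] um B(1)[OF j] by auto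
    have "u x * cnj (e j x) = ?v x * cnj (e j x)" for x using B(2)[OF j, of x] by (cases "x \<in> B j") auto
    then have "ip \<mu> u (e j) = ip \<mu> ?v (e j)"
      unfolding ip_def by (rule Bochner_Integration.integral_cong[OF refl])
    then have "cmod (ip \<mu> u (e j)) \<le> L2_norm \<mu> ?v * L2_norm \<mu> (e j)" using Cauchy_Schwarz_L2[OF v L(1)[OF j]] by simp
    also have "\<dots> \<le> L2_norm \<mu> ?v" using mult_left_mono[OF L(2)[OF j], of "L2_norm \<mu> ?v"] by simp
    finally have "(cmod (ip \<mu> u (e j)))\<^sup>2 \<le> (L2_norm \<mu> ?v)\<^sup>2" by (intro power_mono) auto
    then show "(cmod (ip \<mu> u (e j)))\<^sup>2 \<le> (LINT x|\<mu>. (cmod (u x))\<^sup>2 * indicator (B j) x)"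
      unfolding L2_norm_sq e .
  qed
  also have "\<dots> = (LINT x|\<mu>. (\<Sum>j\<in>J. (cmod (u x))\<^sup>2 * indicator (B j) x))"
    using bi by (simp add: Bochner_Integration.integral_sum)
  also have "\<dots> \<le> (LINT x|\<mu>. real N * (cmod (u x))\<^sup>2)"
  proof (rule integral_mono)
    show "integrable \<mu> (\<lambda>x. \<Sum>j\<in>J. (cmod (u x))\<^sup>2 * indicator (B j) x)" using bi by auto
    show "integrable \<mu> (\<lambda>x. real N * (cmod (u x))\<^sup>2)" using ui by simp
    fix x
    have "(\<Sum>j\<in>J. indicator (B j) x) = real (card {j \<in> J. x \<in> B j})"
      using J by (simp add: indicator_def sum.If_cases Int_def)
    then have "(\<Sum>j\<in>J. (cmod (u x))\<^sup>2 * indicator (B j) x) = (cmod (u x))\<^sup>2 * real (card {j \<in> J. x \<in> B j})"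
      by (simp flip: sum_distrib_left)
    also have "\<dots> \<le> (cmod (u x))\<^sup>2 * real N" using N[of x] by (intro mult_left_mono) auto
    finally show "(\<Sum>j\<in>J. (cmod (u x))\<^sup>2 * indicator (B j) x) \<le> real N * (cmod (u x))\<^sup>2" by (simp add: mult.commute)
  qed
  also have "\<dots> = real N * (L2_norm \<mu> u)\<^sup>2" unfolding L2_norm_sq by simp
  finally show ?thesis .
qed

section \<open>Cardinality of nets and choice of parameters\<close>

text \<open>One volume comparison read in two regimes. At radius a s the ratio of volumes is free of
  s and of the centre; at a fixed radius P \<ge> s it grows like \<open>s powr (-d)\<close>, where
  (2 P + s) / s is replaced by 3 P / s.\<close>

lemma separated_card_bounds:
  fixes \<nu> :: "'a::metric_space measure"
  assumes \<nu>: "doubling_measure \<nu>" "ahlfors_regular d \<nu>" and "0 < d"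
  obtains k :: "real \<Rightarrow> nat" and m :: "real \<Rightarrow> real" where
    "\<And>a s J y. finite J \<Longrightarrow> separated s J \<Longrightarrow> 0 < s \<Longrightarrow> 0 < a \<Longrightarrow> card {j \<in> J. dist j (y::'a) < a * s} \<le> k a"
    "\<And>P s J x. finite J \<Longrightarrow> separated s J \<Longrightarrow> 0 < s \<Longrightarrow> s \<le> P \<Longrightarrow> J \<subseteq> ball (x::'a) P \<Longrightarrow> real (card J) \<le> m P * s powr (-d)"
    "\<And>P. 0 < P \<Longrightarrow> 0 < m P"
proof -
  obtain c C where c: "c > 0" and reg: "\<And>(x::'a) r. r > 0 \<Longrightarrow> c * r powr d \<le> measure \<nu> (ball x r)"
    "\<And>(x::'a) r. r > 0 \<Longrightarrow> measure \<nu> (ball x r) \<le> C * r powr d"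
    using \<nu>(2) unfolding ahlfors_regular_def by blast
  have "c * 1 powr d \<le> C * 1 powr d" using reg[of 1] by (meson order_trans zero_less_one)
  then have C: "C > 0" using c by simp
  have key: "real (card J) \<le> C / c * ((2 * R + s) / s) powr d"
    if "finite J" "separated s J" "0 < s" "0 < R" "J \<subseteq> ball x R" for J s R and x :: 'a
  proof -
    have "real (card J) * (c * (s / 2) powr d) \<le> measure \<nu> (ball x (R + s / 2))"
      using separated_card[OF \<nu>(1) reg(1) that(1-3) that(5)] by simp
    also have "\<dots> \<le> C * (R + s / 2) powr d" using that by (intro reg) auto
    also have "R + s / 2 = ((2 * R + s) / s) * (s / 2)" using that by (simp add: field_simps)
    also have "(\<dots>) powr d = ((2 * R + s) / s) powr d * (s / 2) powr d"
      by (rule powr_mult)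
    finally have "(real (card J) * c) * (s / 2) powr d \<le> (C * ((2 * R + s) / s) powr d) * (s / 2) powr d"
      by (simp only: mult_ac)
    then have "real (card J) * c \<le> C * ((2 * R + s) / s) powr d" using that by (subst (asm) mult_le_cancel_right) simp
    then show ?thesis using c by (simp add: pos_le_divide_eq)
  qed
  show ?thesis
  proof (rule that[of "\<lambda>a. nat \<lceil>C / c * (2 * a + 1) powr d\<rceil>" "\<lambda>P. C / c * (3 * P) powr d"])
    fix a s :: real and J :: "'a set" and y :: 'a assume h: "finite J" "separated s J" "0 < s" "0 < a"
    have sub: "{j \<in> J. dist j y < a * s} \<subseteq> ball y (a * s)" by (auto simp: dist_commute)
    have "real (card {j \<in> J. dist j y < a * s}) \<le> C / c * ((2 * (a * s) + s) / s) powr d"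
      by (rule key[OF _ _ h(3) _ sub]) (use h in \<open>auto intro: separated_subset\<close>)
    also have "(2 * (a * s) + s) / s = 2 * a + 1" using h by (simp add: field_simps)
    finally show "card {j \<in> J. dist j y < a * s} \<le> nat \<lceil>C / c * (2 * a + 1) powr d\<rceil>" by linarith
  next
    fix P s :: real and J :: "'a set" and x :: 'a assume h: "finite J" "separated s J" "0 < s" "s \<le> P" "J \<subseteq> ball x P"
    have "real (card J) \<le> C / c * ((2 * P + s) / s) powr d" by (rule key[OF h(1-3) _ h(5)]) (use h in simp)
    also have "\<dots> \<le> C / c * (3 * P * (1 / s)) powr d"
      using h c C assms(3) by (intro mult_left_mono powr_mono2) (auto simp: divide_right_mono)
    also have "\<dots> = C / c * (3 * P) powr d * s powr (-d)"
      using h by (simp only: powr_mult powr_divide powr_minus_divide powr_one_eq_one mult.assoc)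
    finally show "real (card J) \<le> C / c * (3 * P) powr d * s powr (-d)" .
  qed (use c C in simp)
qed

lemma powr_add_le:
  fixes a b q :: real
  assumes "0 \<le> a" "0 \<le> b" "0 \<le> q" shows "(a + b) powr q \<le> 2 powr q * (a powr q + b powr q)"
proof -
  have "(a + b) powr q \<le> (2 * max a b) powr q" using assms by (intro powr_mono2) auto
  also have "\<dots> = 2 powr q * max a b powr q" by (rule powr_mult)
  also have "\<dots> \<le> 2 powr q * (a powr q + b powr q)" by (intro mult_left_mono) (auto simp: max_def)
  finally show ?thesis .
qed

lemma powr_tendsto_zero:
  fixes f :: "real \<Rightarrow> real"
  assumes "(f \<longlongrightarrow> 0) F" "0 < a" "eventually (\<lambda>x. 0 \<le> f x) F" shows "((\<lambda>x. f x powr a) \<longlongrightarrow> 0) F"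
  using tendsto_powr'[OF assms(1) tendsto_const[of a F]] assms by simp

text \<open>The expression is what \<open>small_oscillation\<close> is left with once n has
  cancelled. Every exponent of \<epsilon> in it is positive, the middle one because q < d.\<close>

lemma ex_small_parameter:
  fixes q d m k C \<eta> e0 :: real
  assumes "1 \<le> q" "q < d" "0 \<le> m" "0 \<le> k" "0 < \<eta>" "0 < e0"
  obtains \<epsilon> where "0 < \<epsilon>" "\<epsilon> < e0"
    "2 powr q * (m * \<epsilon> powr (q/2) + C powr q * (k * \<epsilon> powr ((d/q - 1)/2) + m powr (1/q) * \<epsilon> powr (1/2)) powr q) < \<eta>"
proof -
  let ?\<Psi> = "\<lambda>\<epsilon>. 2 powr q * (m * \<epsilon> powr (q/2) + C powr q * (k * \<epsilon> powr ((d/q - 1)/2) + m powr (1/q) * \<epsilon> powr (1/2)) powr q)"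
  have id: "((\<lambda>x::real. x) \<longlongrightarrow> 0) (at_right 0)" by (rule tendsto_ident_at)
  have nn: "eventually (\<lambda>x::real. 0 \<le> x) (at_right 0)"
    using eventually_at_right_less[of "0::real"] by (rule eventually_mono) simp
  have p: "((\<lambda>x::real. x powr a) \<longlongrightarrow> 0) (at_right 0)" if "a > 0" for a by (rule powr_tendsto_zero[OF id that nn])
  have "0 < (d/q - 1)/2" using assms by (simp add: field_simps)
  then have "((\<lambda>\<epsilon>. k * \<epsilon> powr ((d/q - 1)/2) + m powr (1/q) * \<epsilon> powr (1/2)) \<longlongrightarrow> 0) (at_right 0)"
    by (intro tendsto_add_zero tendsto_mult_right_zero p) auto
  then have "((\<lambda>\<epsilon>. (k * \<epsilon> powr ((d/q - 1)/2) + m powr (1/q) * \<epsilon> powr (1/2)) powr q) \<longlongrightarrow> 0) (at_right 0)"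
    by (rule powr_tendsto_zero) (use assms in auto)
  then have "(?\<Psi> \<longlongrightarrow> 0) (at_right 0)"
    using assms by (intro tendsto_mult_right_zero tendsto_add_zero p) auto
  then have "eventually (\<lambda>\<epsilon>. ?\<Psi> \<epsilon> < \<eta>) (at_right 0)"
    using assms(5) by (rule order_tendstoD(2))
  moreover have "eventually (\<lambda>\<epsilon>::real. \<epsilon> < e0) (at_right 0)" using id assms(6) by (rule order_tendstoD(2))
  moreover have "eventually (\<lambda>\<epsilon>::real. 0 < \<epsilon>) (at_right 0)" by (rule eventually_at_right_less)
  ultimately have "eventually (\<lambda>\<epsilon>. 0 < \<epsilon> \<and> \<epsilon> < e0 \<and> ?\<Psi> \<epsilon> < \<eta>) (at_right 0)"
    by eventually_elim simp
  then obtain \<epsilon> where "0 < \<epsilon> \<and> \<epsilon> < e0 \<and> ?\<Psi> \<epsilon> < \<eta>"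
    using eventually_happens'[OF trivial_limit_at_right_real] by blast
  then show ?thesis using that by blast
qed

text \<open>Convergence to zero is a case of the second alternative. A finite maximum extends the
  eventual bound to every n, as is needed for the approximants at all dyadic ranks.\<close>

lemma decay_rate_dichotomy:
  fixes f :: "nat \<Rightarrow> real"
  assumes "(\<lambda>n. f n) \<longlonglongrightarrow> 0 \<or> (limsup (\<lambda>n. ereal (f n)) < \<infinity> \<and> liminf (\<lambda>n. ereal (f n)) = 0)"
  shows "\<exists>C>0. \<forall>n. f n < C" "\<And>e N. e > 0 \<Longrightarrow> \<exists>n\<ge>N. f n < e"
proof -
  have main: "limsup (\<lambda>n. ereal (f n)) < \<infinity> \<and> liminf (\<lambda>n. ereal (f n)) = 0"
  proof (cases "(\<lambda>n. f n) \<longlonglongrightarrow> 0")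
    case True
    then have t: "(\<lambda>n. ereal (f n)) \<longlonglongrightarrow> ereal 0" by simp
    show ?thesis
      using lim_imp_Liminf[OF trivial_limit_sequentially t] lim_imp_Limsup[OF trivial_limit_sequentially t]
      by (simp add: zero_ereal_def)
  next
    case False then show ?thesis using assms by blast
  qed
  obtain C0 where "limsup (\<lambda>n. ereal (f n)) < ereal C0" using main less_PInf_Ex_of_nat by (metis ereal_dense2)
  then have "eventually (\<lambda>n. ereal (f n) < ereal C0) sequentially" by (rule Limsup_lessD)
  then obtain N where N: "\<And>n. n \<ge> N \<Longrightarrow> f n < C0" by (auto simp: eventually_sequentially)
  define C where "C = Max (insert 1 (insert C0 (f ` {..<N}))) + 1"
  have fin: "finite (insert 1 (insert C0 (f ` {..<N})))" by simp
  have ge: "x < C" if "x \<in> insert 1 (insert C0 (f ` {..<N}))" for x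
    unfolding C_def using Max_ge[OF fin that] by linarith
  have "f n < C" for n
    by (cases "n < N") (use ge[of "f n"] ge[of C0] N[of n] in auto)
  moreover have "C > 0" using ge[of 1] by simp
  ultimately show "\<exists>C>0. \<forall>n. f n < C" by blast
  show "\<exists>n\<ge>N. f n < e" if "e > 0" for e N
  proof (rule ccontr)
    assume "\<not> ?thesis"
    then have "eventually (\<lambda>n. ereal e \<le> ereal (f n)) sequentially"
      unfolding eventually_sequentially by (intro exI[of _ N]) (auto simp: not_less)
    then have "ereal e \<le> liminf (\<lambda>n. ereal (f n))" by (rule Liminf_bounded)
    then show False using main that by simp
  qed
qed

text \<open>The last conclusion says that a discretised \<open>L\<^sup>q\<close> norm of \<kappa> /
  s is small: a net point accounts for volume about \<open>s powr d\<close>. The concentration balls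
  have radius 6 s although the net has mesh s, so that nearby net points share a ball of radius 3 s
  about any point between them.\<close>

lemma small_oscillation:
  fixes \<mu> \<nu> :: "'a::metric_space measure"
  assumes \<mu>: "doubling_measure \<mu>" and \<nu>: "doubling_measure \<nu>" "ahlfors_regular d \<nu>"
    and q: "1 \<le> q" "q < d"
    and b: "locally_integrable \<mu> b" and K: "singular_kernel \<mu> K"
    and nd: "strongly_nondegenerate \<mu> K" and R: "realises_commutator \<mu> K b R"
    and an: "(\<lambda>n. real n powr (1 / d) * approximation_number \<mu> R n) \<longlonglongrightarrow> 0
         \<or> (limsup (\<lambda>n. ereal (real n powr (1 / d) * approximation_number \<mu> R n)) < \<infinity>
            \<and> liminf (\<lambda>n. ereal (real n powr (1 / d) * approximation_number \<mu> R n)) = 0)"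
    and \<theta>: "0 < \<theta>" "\<theta> < 1/2" and P: "0 < P" and small: "0 < \<eta>" "0 < s\<^sub>0"
  obtains s J Z \<kappa> where "0 < s" "s < s\<^sub>0" "finite J" "separated s J" "J \<subseteq> ball (x\<^sub>0::'a) P"
    "\<And>y. y \<in> ball x\<^sub>0 P \<Longrightarrow> \<exists>j\<in>J. dist j y < s"
    "\<And>j. j \<in> J \<Longrightarrow> 0 < \<kappa> j" "\<And>j. j \<in> J \<Longrightarrow> concentrated \<mu> \<theta> (ball j (6 * s)) b (Z j) (\<kappa> j)"
    "s powr (d - q) * (\<Sum>j\<in>J. \<kappa> j powr q) < \<eta>"
proof -
  have d: "d > 1" "d > 0" using q by auto
  obtain A C where A: "A \<ge> 1" and C: "C > 0" and osc: "\<And>x s \<tau>. s > 0 \<Longrightarrow> \<tau> > 0 \<Longrightarrow> \<exists>z \<kappa> E F. E \<in> sets borel \<and> F \<in> sets borel \<and>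
    E \<subseteq> ball x (A * s) \<and> F \<subseteq> ball x (A * s) \<and> 0 < \<kappa> \<and> concentrated \<mu> \<theta> (ball x s) b z \<kappa> \<and>
    \<kappa> \<le> \<tau> + C * (cmod (LINT y|\<mu>. R (indicator F) y * indicator E y) / measure \<mu> (ball x (A * s)))"
    using oscillation_pairing[OF \<mu> b K nd R \<theta>] by blast
  obtain k :: "real \<Rightarrow> nat" and m :: "real \<Rightarrow> real" where
    k: "\<And>a s J y. finite J \<Longrightarrow> separated s J \<Longrightarrow> 0 < s \<Longrightarrow> 0 < a \<Longrightarrow> card {j \<in> J. dist j (y::'a) < a * s} \<le> k a" and
    m: "\<And>P s J x. finite J \<Longrightarrow> separated s J \<Longrightarrow> 0 < s \<Longrightarrow> s \<le> P \<Longrightarrow> J \<subseteq> ball (x::'a) P \<Longrightarrow> real (card J) \<le> m P * s powr (-d)"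
    and mpos: "\<And>P. 0 < P \<Longrightarrow> 0 < m P"
    by (rule separated_card_bounds[OF \<nu> d(2)]) (rule that)
  \<comment> \<open>Overlap of the balls of radius 6 A s; adding 1 guarantees N \<ge> 1, as
    \<open>schatten_sum_bound\<close> requires.\<close>
  define N where "N = k (6 * A) + 1"
  obtain Ca where Ca: "Ca > 0" "\<And>n. real n powr (1 / d) * approximation_number \<mu> R n < Ca"
    using decay_rate_dichotomy(1)[OF an] by blast
  have Rb: "L2_bounded_operator \<mu> R" using R by (simp add: realises_commutator_def)
  have conv: "approximation_number \<mu> R n < c * real n powr (-1/d)"
    if "n \<ge> 1" "real n powr (1 / d) * approximation_number \<mu> R n < c" for n c
  proof -
    have "real n powr (1/d) > 0" using that(1) by simp
    then have "approximation_number \<mu> R n < c / real n powr (1/d)" using that(2) by (simp add: pos_less_divide_eq mult.commute)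
    then show ?thesis by (simp add: powr_minus_divide)
  qed
  define G where "G = 16 / (2 powr (1/q - 1/d) - 1) * real N * Ca"
  have qd: "1/q - 1/d > 0" using q d by (simp add: field_simps)
  have G0: "G \<ge> 0" unfolding G_def using Ca gr_one_powr[OF _ qd, of 2] by simp
  obtain \<epsilon> where e: "0 < \<epsilon>" "\<epsilon> < Ca" and
    esmall: "2 powr q * (m P * \<epsilon> powr (q/2) + C powr q * (G * \<epsilon> powr ((d/q - 1)/2) + m P powr (1/q) * \<epsilon> powr (1/2)) powr q) < \<eta>"
    using ex_small_parameter[OF q _ G0 small(1) Ca(1), of "m P" C] mpos[OF P] by (metis less_imp_le)
  have "(\<lambda>n. real n powr (-1/d)) \<longlonglongrightarrow> 0"
    using d by (intro tendsto_neg_powr filterlim_real_sequentially) auto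
  then have "(\<lambda>n. sqrt \<epsilon> * real n powr (-1/d)) \<longlonglongrightarrow> 0" by (rule tendsto_mult_right_zero)
  then have "eventually (\<lambda>n. sqrt \<epsilon> * real n powr (-1/d) < min s\<^sub>0 P) sequentially"
    by (rule order_tendstoD(2)) (use small P in simp)
  then obtain N0 where N0: "\<And>n. n \<ge> N0 \<Longrightarrow> sqrt \<epsilon> * real n powr (-1/d) < min s\<^sub>0 P" by (auto simp: eventually_sequentially)
  \<comment> \<open>The order of choices: \<epsilon> from the target \<eta>, then N0 so that the
    scale stays below its two limits, then some n beyond N0 with a small approximation
    number.\<close>
  obtain n where n: "n \<ge> max N0 1" "real n powr (1 / d) * approximation_number \<mu> R n < \<epsilon>"
    using decay_rate_dichotomy(2)[OF an e(1)] by blast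
  define s where "s = sqrt \<epsilon> * real n powr (-1/d)"
  have s: "0 < s" "s < s\<^sub>0" "s \<le> P" using N0[of n] n e by (auto simp: s_def)
  obtain J where J: "finite J" "J \<subseteq> ball x\<^sub>0 P" "separated s J" "\<And>y. y \<in> ball x\<^sub>0 P \<Longrightarrow> \<exists>j\<in>J. dist j y < s"
    by (rule ex_maximal_separated[OF \<nu> order_refl s(1)]) (rule that)
  \<comment> \<open>A slack of this size, summed over the net and normalised, contributes
    \<open>m P * \<epsilon> powr (q/2)\<close>.\<close>
  define \<tau> where "\<tau> = s * sqrt \<epsilon>"
  have \<tau>: "\<tau> > 0" using s e by (simp add: \<tau>_def)
  define w where "w j = measure \<mu> (ball j (A * (6 * s)))" for j
  have wpos: "w j > 0" for j unfolding w_def using s A by (intro doubling_ball_pos[OF \<mu>]) simp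
  define Q where "Q j z \<kappa> E F \<longleftrightarrow> E \<in> sets borel \<and> F \<in> sets borel \<and>
    E \<subseteq> ball j (A * (6 * s)) \<and> F \<subseteq> ball j (A * (6 * s)) \<and> 0 < \<kappa> \<and> concentrated \<mu> \<theta> (ball j (6 * s)) b z \<kappa> \<and>
    \<kappa> \<le> \<tau> + C * (cmod (LINT y|\<mu>. R (indicator F) y * indicator E y) / w j)" for j z \<kappa> E F
  have "6 * s > 0" using s by simp
  from osc[OF this \<tau>] have "\<forall>j. \<exists>z \<kappa> E F. Q j z \<kappa> E F" unfolding Q_def w_def by blast
  from choice[OF this] obtain Z where "\<forall>j. \<exists>\<kappa> E F. Q j (Z j) \<kappa> E F" ..
  from choice[OF this] obtain \<kappa> where "\<forall>j. \<exists>E F. Q j (Z j) (\<kappa> j) E F" ..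
  from choice[OF this] obtain E where "\<forall>j. \<exists>F. Q j (Z j) (\<kappa> j) (E j) F" ..
  from choice[OF this] obtain F where QQ: "\<forall>j. Q j (Z j) (\<kappa> j) (E j) (F j)" ..
  have EF: "E j \<in> sets borel" "F j \<in> sets borel" "E j \<subseteq> ball j (A * (6 * s))" "F j \<subseteq> ball j (A * (6 * s))" for j
    using QQ unfolding Q_def by blast+
  have kap: "0 < \<kappa> j" "concentrated \<mu> \<theta> (ball j (6 * s)) b (Z j) (\<kappa> j)"
    "\<kappa> j \<le> \<tau> + C * (cmod (LINT y|\<mu>. R (indicator (F j)) y * indicator (E j) y) / w j)" for j
    using QQ unfolding Q_def by blast+
  have fm: "E j \<in> fmeasurable \<mu>" "F j \<in> fmeasurable \<mu>" for j
    by (rule doubling_subset_fmeasurable[OF \<mu> EF(1) EF(3)] doubling_subset_fmeasurable[OF \<mu> EF(2) EF(4)])+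
  \<comment> \<open>Normalising by the surrounding ball, not by the test sets, makes the coefficient
    equal to the pairing divided by \<open>w j\<close> and keeps the norms at most 1.\<close>
  define a where "a j = 1 / sqrt (w j)" for j
  define f where "f j = (\<lambda>x. complex_of_real (a j) * indicator (E j) x)" for j
  define g where "g j = (\<lambda>x. complex_of_real (a j) * indicator (F j) x)" for j
  have L: "f j \<in> L2 \<mu>" "g j \<in> L2 \<mu>" for j unfolding f_def g_def by (rule indicator_L2(1)[OF fm(1)] indicator_L2(1)[OF fm(2)])+
  have ew: "measure \<mu> (E j) \<le> w j" "measure \<mu> (F j) \<le> w j" for j
    unfolding w_def
    by (rule doubling_measure_mono[OF \<mu> EF(1) borel_open[OF open_ball] EF(3) order_refl]
        doubling_measure_mono[OF \<mu> EF(2) borel_open[OF open_ball] EF(4) order_refl])+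
  have nrm: "L2_norm \<mu> (f j) \<le> 1" "L2_norm \<mu> (g j) \<le> 1" for j
  proof -
    have "\<bar>a j\<bar> * sqrt t \<le> 1" if "t \<le> w j" for t
      using that wpos[of j] by (simp add: a_def pos_divide_le_eq)
    then show "L2_norm \<mu> (f j) \<le> 1" "L2_norm \<mu> (g j) \<le> 1"
      unfolding f_def g_def indicator_L2(2)[OF fm(1)] indicator_L2(2)[OF fm(2)] using ew by blast+
  qed
  have cN: "card {j \<in> J. x \<in> ball j (A * (6 * s))} \<le> N" for x
    using k[OF J(1,3) s(1), of "6 * A" x] A unfolding N_def by (simp add: mult_ac)
  have cN': "card {j \<in> J. g j x \<noteq> 0} \<le> N" for x
  proof -
    have "{j \<in> J. g j x \<noteq> 0} \<subseteq> {j \<in> J. x \<in> ball j (A * (6 * s))}"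
    proof
      fix j assume j: "j \<in> {j \<in> J. g j x \<noteq> 0}"
      then have "x \<in> F j" by (cases "x \<in> F j") (simp_all add: g_def)
      then have "x \<in> ball j (A * (6 * s))" using EF(4) by blast
      then show "j \<in> {j \<in> J. x \<in> ball j (A * (6 * s))}" using j by simp
    qed
    then have "card {j \<in> J. g j x \<noteq> 0} \<le> card {j \<in> J. x \<in> ball j (A * (6 * s))}"
      using J(1) by (intro card_mono) auto
    then show ?thesis using cN[of x] by linarith
  qed
  define p where "p j = cmod (ip \<mu> (R (g j)) (f j))" for j
  \<comment> \<open>The pairing is bilinear and \<open>ip\<close> sesquilinear; they agree because
    indicators are real. \<open>R\<close> commutes with the factor \<open>a j\<close> almost
    everywhere only.\<close>
  have pe: "cmod (LINT y|\<mu>. R (indicator (F j)) y * indicator (E j) y) / w j = p j" for j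
  proof -
    obtain B where B: "bounded_by \<mu> R B" using Rb unfolding L2_bounded_operator_iff by blast
    have iF: "(indicator (F j) :: 'a \<Rightarrow> complex) \<in> L2 \<mu>" using indicator_L2(1)[OF fm(2), of 1 j] by simp
    have "AE x in \<mu>. R (g j) x = complex_of_real (a j) * R (indicator (F j)) x"
      unfolding g_def using B iF by (intro linear_AE_cmultD[where D="L2 \<mu>"]) (simp add: bounded_by_def)
    then have "ip \<mu> (R (g j)) (f j) = ip \<mu> (\<lambda>x. complex_of_real (a j) * R (indicator (F j)) x) (f j)"
      by (intro ip_cong L bounded_byD(1)[OF B] L2_cmult iF)
    also have "\<dots> = complex_of_real (a j) * (LINT y|\<mu>. complex_of_real (a j) * (R (indicator (F j)) y * indicator (E j) y))"
    proof -
      have "R (indicator (F j)) y * cnj (complex_of_real (a j) * indicator (E j) y)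
          = complex_of_real (a j) * (R (indicator (F j)) y * indicator (E j) y)" for y
        by (simp add: indicator_def)
      then show ?thesis unfolding ip_cmult ip_def f_def by (simp only:)
    qed
    also have "\<dots> = complex_of_real (a j * a j) * (LINT y|\<mu>. R (indicator (F j)) y * indicator (E j) y)"
      by (simp only: integral_mult_right_zero of_real_mult mult.assoc)
    also have "a j * a j = 1 / w j" using wpos[of j] by (simp add: a_def real_sqrt_mult[symmetric])
    finally show ?thesis unfolding p_def using wpos[of j] by (simp add: norm_mult norm_divide)
  qed
  have kp: "\<kappa> j \<le> \<tau> + C * p j" for j using kap(3)[of j] unfolding pe .
  define X where "X = G * real n powr (1/q - 1/d) + real (card J) powr (1/q) * \<epsilon> * real n powr (-1/d)"
  have X0: "X \<ge> 0" unfolding X_def using G0 e by simp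
  have sumX: "(\<Sum>j\<in>J. p j powr q) \<le> X powr q"
  proof -
    have "(\<Sum>j\<in>J. cmod (ip \<mu> (R (g j)) (f j)) powr q) \<le>
      (16 / (2 powr (1/q - 1/d) - 1) * real N * Ca * real n powr (1/q - 1/d)
       + real (card J) powr (1/q) * \<epsilon> * real n powr (-1/d)) powr q"
    proof (rule schatten_sum_bound[OF Rb Ca(1) _ _ e(1) _ _ q J(1)])
      show "approximation_number \<mu> R k < Ca * real k powr (-1/d)" if "k \<ge> 1" for k by (rule conv[OF that Ca(2)])
      show "n \<ge> 1" "\<epsilon> \<le> Ca" using n e by auto
      show "approximation_number \<mu> R n < \<epsilon> * real n powr (-1/d)" using n by (intro conv) auto
      show "1 \<le> real N" by (simp add: N_def)
      show "(L2_norm \<mu> (\<lambda>x. \<Sum>j\<in>J. c j * g j x))\<^sup>2 \<le> real N * (\<Sum>j\<in>J. (cmod (c j))\<^sup>2)" for c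
        by (rule overlap_lincomb_bound[OF J(1) L(2) nrm(2) cN'])
      show "(\<Sum>j\<in>J. (cmod (ip \<mu> u (f j)))\<^sup>2) \<le> real N * (L2_norm \<mu> u)\<^sup>2" if "u \<in> L2 \<mu>" for u
      proof (rule overlap_coefficient_bound[OF J(1) L(1) nrm(1) _ _ cN that])
        show "ball j (A * (6 * s)) \<in> sets \<mu>" for j by (simp add: doubling_sets[OF \<mu>])
        show "f j x = 0" if "x \<notin> ball j (A * (6 * s))" for j x
        proof -
          have "x \<notin> E j" using that EF(3) by blast
          then show ?thesis by (simp add: f_def)
        qed
      qed
    qed (rule L nrm)+
    then show ?thesis unfolding p_def X_def G_def .
  qed
  have cJ: "real (card J) \<le> m P * s powr (-d)" by (rule m[OF J(1,3) s(1,3) J(2)])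
  have npos: "real n > 0" using n by simp
  have sX: "s powr (d/q - 1) * X \<le> G * \<epsilon> powr ((d/q - 1)/2) + m P powr (1/q) * \<epsilon> powr (1/2)"
  proof -
    \<comment> \<open>All powers of n cancel between the scale and the finite rank part.\<close>
    have 1: "s powr (d/q - 1) * real n powr (1/q - 1/d) = \<epsilon> powr ((d/q - 1)/2)"
    proof -
      have "(-1/d) * (d/q - 1) = -(1/q - 1/d)" using d q by (simp add: field_simps)
      then have "s powr (d/q - 1) = \<epsilon> powr ((d/q - 1)/2) * real n powr (-(1/q - 1/d))"
        unfolding s_def powr_mult using e by (simp add: powr_half_sqrt[symmetric] powr_powr)
      moreover have "real n powr (-(1/q - 1/d)) * real n powr (1/q - 1/d) = 1"
        unfolding powr_add[symmetric] using npos by simp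
      ultimately show ?thesis by (simp only: mult.assoc mult_1_right)
    qed
    \<comment> \<open>The size of the net consumes the normalisation up to 1 / s, and 1 / s against
      \<open>\<epsilon> * real n powr (-1/d)\<close> leaves sqrt \<epsilon>.\<close>
    have "s powr (d/q - 1) * (real (card J) powr (1/q) * \<epsilon> * real n powr (-1/d))
        \<le> s powr (d/q - 1) * ((m P * s powr (-d)) powr (1/q) * \<epsilon> * real n powr (-1/d))"
      using cJ e q by (intro mult_left_mono mult_right_mono powr_mono2) auto
    also have "\<dots> = m P powr (1/q) * (s powr (d/q - 1) * s powr (-d/q)) * (\<epsilon> * real n powr (-1/d))"
      using q by (simp add: powr_mult powr_powr mult_ac)
    also have "s powr (d/q - 1) * s powr (-d/q) = 1 / s"
    proof -
      have "(d/q - 1) + (-d/q) = -1" by simp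
      then show ?thesis unfolding powr_add[symmetric] using s by (simp only: powr_minus_divide powr_one less_imp_le)
    qed
    also have "m P powr (1/q) * (1 / s) * (\<epsilon> * real n powr (-1/d)) = m P powr (1/q) * sqrt \<epsilon>"
    proof -
      have "\<epsilon> * real n powr (-1/d) = sqrt \<epsilon> * s" unfolding s_def using e by (simp flip: mult.assoc)
      then show ?thesis using s by simp
    qed
    also have "sqrt \<epsilon> = \<epsilon> powr (1/2)" using e by (simp add: powr_half_sqrt)
    finally have 2: "s powr (d/q - 1) * (real (card J) powr (1/q) * \<epsilon> * real n powr (-1/d)) \<le> m P powr (1/q) * \<epsilon> powr (1/2)" .
    have "s powr (d/q - 1) * X = G * (s powr (d/q - 1) * real n powr (1/q - 1/d)) + s powr (d/q - 1) * (real (card J) powr (1/q) * \<epsilon> * real n powr (-1/d))"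
      unfolding X_def by (simp add: distrib_left mult_ac)
    then show ?thesis unfolding 1 using 2 by linarith
  qed
  have "(\<Sum>j\<in>J. \<kappa> j powr q) \<le> (\<Sum>j\<in>J. 2 powr q * (\<tau> powr q + C powr q * p j powr q))"
  proof (intro sum_mono)
    fix j
    have "\<kappa> j powr q \<le> (\<tau> + C * p j) powr q" using kap(1)[of j] kp[of j] q by (intro powr_mono2) auto
    also have "\<dots> \<le> 2 powr q * (\<tau> powr q + (C * p j) powr q)"
      using \<tau> C q by (intro powr_add_le) (auto simp: p_def)
    finally show "\<kappa> j powr q \<le> 2 powr q * (\<tau> powr q + C powr q * p j powr q)" by (simp only: powr_mult)
  qed
  also have "\<dots> = 2 powr q * (real (card J) * \<tau> powr q + C powr q * (\<Sum>j\<in>J. p j powr q))"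
    by (simp add: sum_distrib_left[symmetric] sum.distrib)
  also have "\<dots> \<le> 2 powr q * (m P * s powr (-d) * \<tau> powr q + C powr q * X powr q)"
    using cJ sumX by (intro mult_left_mono add_mono mult_right_mono) auto
  finally have "s powr (d - q) * (\<Sum>j\<in>J. \<kappa> j powr q)
      \<le> s powr (d - q) * (2 powr q * (m P * s powr (-d) * \<tau> powr q + C powr q * X powr q))"
    by (rule mult_left_mono) simp
  also have "\<dots> = 2 powr q * (m P * (s powr (d - q) * s powr (-d) * \<tau> powr q) + C powr q * (s powr (d - q) * X powr q))"
    by (simp add: algebra_simps)
  also have "s powr (d - q) * s powr (-d) * \<tau> powr q = \<epsilon> powr (q/2)"
  proof -
    have "s powr (d - q) * s powr (-d) = s powr (-q)" unfolding powr_add[symmetric] by simp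
    then have "s powr (d - q) * s powr (-d) * \<tau> powr q = (s powr (-q) * s powr q) * sqrt \<epsilon> powr q"
      unfolding \<tau>_def powr_mult by simp
    also have "s powr (-q) * s powr q = 1" unfolding powr_add[symmetric] using s by simp
    finally show ?thesis using e by (simp add: powr_half_sqrt[symmetric] powr_powr)
  qed
  also have "s powr (d - q) * X powr q = (s powr (d/q - 1) * X) powr q"
    using q by (simp add: powr_mult powr_powr left_diff_distrib)
  also have "2 powr q * (m P * \<epsilon> powr (q/2) + C powr q * (s powr (d/q - 1) * X) powr q)
    \<le> 2 powr q * (m P * \<epsilon> powr (q/2) + C powr q * (G * \<epsilon> powr ((d/q - 1)/2) + m P powr (1/q) * \<epsilon> powr (1/2)) powr q)"
    using sX X0 q by (intro mult_left_mono add_left_mono powr_mono2) auto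
  also have "\<dots> < \<eta>" by (rule esmall)
  finally have "s powr (d - q) * (\<Sum>j\<in>J. \<kappa> j powr q) < \<eta>" .
  then show ?thesis using that[of s J \<kappa> Z] s J kap by blast
qed

subsection \<open>Constancy\<close>

text \<open>Two points of the essential range. If it had no point except possibly c, every other
  value would have a ball that b avoids almost everywhere; by Lindelof countably many of these cover
  the complement of c, forcing b = c almost everywhere.\<close>

lemma nonconstant_two_values:
  fixes b :: "'a \<Rightarrow> complex"
  assumes "\<not> (\<exists>c. AE x in \<mu>. b x = c)"
  obtains w1 w2 where "w1 \<noteq> w2" "\<And>r. r > 0 \<Longrightarrow> \<not> (AE x in \<mu>. b x \<notin> ball w1 r)" "\<And>r. r > 0 \<Longrightarrow> \<not> (AE x in \<mu>. b x \<notin> ball w2 r)"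
proof -
  define S where "S = {w. \<forall>r>0. \<not> (AE x in \<mu>. b x \<notin> ball w r)}"
  have "\<exists>w1\<in>S. \<exists>w2\<in>S. w1 \<noteq> w2"
  proof (rule ccontr)
    assume "\<not> ?thesis"
    then obtain c where "S \<subseteq> {c}" by blast
    then have "\<forall>w. \<exists>r. w \<noteq> c \<longrightarrow> r > 0 \<and> (AE x in \<mu>. b x \<notin> ball w r)" unfolding S_def by blast
    from choice[OF this] obtain r where r: "\<And>w. w \<noteq> c \<Longrightarrow> r w > 0" "\<And>w. w \<noteq> c \<Longrightarrow> AE x in \<mu>. b x \<notin> ball w (r w)"
      by blast
    let ?F = "(\<lambda>w. ball w (r w)) ` (- {c})"
    obtain F where F: "F \<subseteq> ?F" "countable F" "\<Union> F = \<Union> ?F" using Lindelof[of ?F] by auto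
    have F0: "AE x in \<mu>. \<forall>B\<in>F. b x \<notin> B"
      unfolding AE_ball_countable[OF F(2)]
    proof
      fix B assume "B \<in> F"
      then obtain w where "w \<noteq> c" "B = ball w (r w)" using F(1) by blast
      then show "AE x in \<mu>. b x \<notin> B" using r(2) by simp
    qed
    have Fc: "z \<in> \<Union> F" if "z \<noteq> c" for z unfolding F(3) using r(1)[OF that] that by force
    from F0 have "AE x in \<mu>. b x = c"
    proof eventually_elim
      case (elim x)
      then show ?case using Fc[of "b x"] by blast
    qed
    then show False using assms by blast
  qed
  then show ?thesis using that unfolding S_def by blast
qed

text \<open>The value is taken on a set that is not null, and countably many balls exhaust the
  space; beyond some radius each ball must see it.\<close>

lemma level_set_positive:
  fixes \<mu> :: "'a::metric_space measure" and b :: "'a \<Rightarrow> complex"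
  assumes \<mu>: "doubling_measure \<mu>" and b: "b \<in> borel_measurable \<mu>" and w: "\<not> (AE x in \<mu>. b x \<notin> ball w r)"
  shows "\<exists>\<rho>\<^sub>0. \<forall>\<rho>\<ge>\<rho>\<^sub>0. 0 < measure \<mu> {x \<in> ball x\<^sub>0 \<rho>. b x \<in> ball w r}"
proof (rule ccontr)
  let ?E = "\<lambda>\<rho>. {x \<in> ball x\<^sub>0 \<rho>. b x \<in> ball w r}"
  assume "\<not> ?thesis"
  then have no: "\<exists>\<rho>\<ge>\<rho>\<^sub>0. \<not> 0 < measure \<mu> (?E \<rho>)" for \<rho>\<^sub>0 by blast
  have s: "?E \<rho> \<in> sets borel" for \<rho>
  proof -
    have "{x \<in> ball x\<^sub>0 \<rho>. cmod (b x - w) < r} \<in> sets \<mu>"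
      by (rule value_sets(3)[OF b]) (simp add: doubling_sets[OF \<mu>])
    then show ?thesis by (simp add: doubling_sets[OF \<mu>] dist_norm norm_minus_commute)
  qed
  have nul: "AE x in \<mu>. x \<notin> ?E (real n)" for n :: nat
  proof -
    obtain \<rho> where \<rho>: "\<rho> \<ge> real n" "\<not> 0 < measure \<mu> (?E \<rho>)" using no by blast
    have fm: "?E \<rho> \<in> fmeasurable \<mu>" by (rule doubling_subset_fmeasurable[OF \<mu> s]) auto
    have "measure \<mu> (?E \<rho>) = 0" using \<rho>(2) measure_nonneg[of \<mu> "?E \<rho>"] by linarith
    then have "emeasure \<mu> (?E \<rho>) = 0" using emeasure_eq_measure2[OF fm] by simp
    then have "?E \<rho> \<in> null_sets \<mu>" using s[of \<rho>] by (simp add: null_sets_def doubling_sets[OF \<mu>])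
    then have "AE x in \<mu>. x \<notin> ?E \<rho>" by (rule AE_not_in)
    then show ?thesis by eventually_elim (use \<rho>(1) in auto)
  qed
  have "AE x in \<mu>. \<forall>n::nat. x \<notin> ?E (real n)" unfolding AE_all_countable using nul by blast
  then have "AE x in \<mu>. b x \<notin> ball w r"
  proof eventually_elim
    case (elim x)
    obtain n :: nat where "dist x\<^sub>0 x < real n" using reals_Archimedean2 by blast
    then show ?case using elim by auto
  qed
  then show False using w by blast
qed

text \<open>A is too large to fit into the exceptional set. B serves as the smaller reference ball
  against which A is measured.\<close>

lemma concentrated_meets:
  fixes \<mu> :: "'a::metric_space measure"
  assumes \<mu>: "doubling_measure \<mu>" and b: "b \<in> borel_measurable \<mu>" and "0 \<le> \<theta>"
    and D: "measure \<mu> (ball j t) \<le> D * measure \<mu> B" and c: "concentrated \<mu> \<theta> (ball j t) b z \<kappa>"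
    and A: "A \<in> sets borel" "A \<subseteq> ball j t" "\<theta> * D * measure \<mu> B < measure \<mu> A"
  shows "\<exists>x\<in>A. cmod (b x - z) \<le> \<kappa>"
proof (rule ccontr)
  assume "\<not> ?thesis"
  then have sub: "A \<subseteq> {x \<in> ball j t. \<kappa> < cmod (b x - z)}" using A(2) by force
  have bs: "ball j t \<in> sets \<mu>" using doubling_sets[OF \<mu>] by simp
  have "{x \<in> ball j t. \<kappa> < cmod (b x - z)} \<in> sets borel"
    using value_sets(1)[OF b bs] by (simp add: doubling_sets[OF \<mu>])
  then have "measure \<mu> A \<le> measure \<mu> {x \<in> ball j t. \<kappa> < cmod (b x - z)}"
    using A(1) sub by (intro doubling_measure_mono[OF \<mu>, where x=j and r=t]) auto
  also have "\<dots> \<le> \<theta> * measure \<mu> (ball j t)" using c by (simp add: concentrated_def)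
  also have "\<dots> \<le> \<theta> * (D * measure \<mu> B)" using D \<open>0 \<le> \<theta>\<close> by (rule mult_left_mono)
  finally show False using A(3) by simp
qed

text \<open>Both balls of radius 6 s contain \<open>ball y (3 * s)\<close>, of which each
  exceptional set takes at most the proportion \<open>\<theta> * D < 1/2\<close>. Some point of it
  is good for both centres.\<close>

lemma concentrated_values_close:
  fixes \<mu> :: "'a::metric_space measure"
  assumes \<mu>: "doubling_measure \<mu>" and b: "b \<in> borel_measurable \<mu>" and \<theta>: "0 \<le> \<theta>" "\<theta> * D < 1/2" and s: "0 < s"
    and D: "measure \<mu> (ball i (6 * s)) \<le> D * measure \<mu> (ball y (3 * s))" "measure \<mu> (ball j (6 * s)) \<le> D * measure \<mu> (ball y (3 * s))"
    and ij: "dist i y < 3 * s" "dist j y < 3 * s"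
    and c: "concentrated \<mu> \<theta> (ball i (6 * s)) b z \<kappa>" "concentrated \<mu> \<theta> (ball j (6 * s)) b z' \<kappa>'"
  shows "cmod (z' - z) \<le> \<kappa>' + \<kappa>"
proof -
  let ?B = "ball y (3 * s)"
  have sub: "?B \<subseteq> ball i (6 * s)" "?B \<subseteq> ball j (6 * s)" using ij by (auto intro!: ball_subset_ballI simp: dist_commute)
  have Bs: "?B \<in> sets \<mu>" using doubling_sets[OF \<mu>] by simp
  let ?G = "{x \<in> ?B. cmod (b x - z) \<le> \<kappa>}" and ?H = "{x \<in> ?B. \<kappa> < cmod (b x - z)}"
  have G: "?G \<in> sets \<mu>" and H: "?H \<in> sets \<mu>" by (rule value_sets[OF b Bs])+
  have is': "ball i (6 * s) \<in> sets \<mu>" using doubling_sets[OF \<mu>] by simp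
  have "measure \<mu> ?H \<le> measure \<mu> {x \<in> ball i (6 * s). \<kappa> < cmod (b x - z)}"
    using H value_sets(1)[OF b is'] sub(1) unfolding doubling_sets[OF \<mu>]
    by (intro doubling_measure_mono[OF \<mu>, where x=i and r="6 * s"]) auto
  also have "\<dots> \<le> \<theta> * measure \<mu> (ball i (6 * s))" using c(1) by (simp add: concentrated_def)
  also have "\<dots> \<le> \<theta> * (D * measure \<mu> ?B)" using D(1) \<theta>(1) by (rule mult_left_mono)
  finally have h: "measure \<mu> ?H \<le> \<theta> * D * measure \<mu> ?B" by simp
  have "measure \<mu> ?B = measure \<mu> (?H \<union> ?G)" by (rule arg_cong[where f="measure \<mu>"]) auto
  also have "\<dots> \<le> measure \<mu> ?H + measure \<mu> ?G" by (rule measure_Un_le[OF H G])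
  finally have g: "measure \<mu> ?B \<le> \<theta> * D * measure \<mu> ?B + measure \<mu> ?G" using h by linarith
  have "0 < measure \<mu> ?B" using s by (intro doubling_ball_pos[OF \<mu>]) simp
  then have "\<theta> * D * measure \<mu> ?B < 1/2 * measure \<mu> ?B" using \<theta>(2) by (intro mult_strict_right_mono) auto
  then have "\<theta> * D * measure \<mu> ?B < measure \<mu> ?G" using g by linarith
  then have "\<exists>x\<in>?G. cmod (b x - z') \<le> \<kappa>'"
    using G sub(2) unfolding doubling_sets[OF \<mu>]
    by (intro concentrated_meets[OF \<mu> b \<theta>(1) D(2) c(2)]) auto
  then obtain x where "cmod (b x - z) \<le> \<kappa>" "cmod (b x - z') \<le> \<kappa>'" by blast
  then show ?thesis using norm_triangle_ineq4[of "b x - z" "b x - z'"] by simp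
qed

lemma lipschitz_set_integrable:
  fixes f :: "'a::metric_space \<Rightarrow> complex"
  assumes \<nu>: "doubling_measure \<nu>" and "L-lipschitz_on UNIV f"
  shows "set_integrable \<nu> (ball x r) (\<lambda>y. cmod (f y - c))"
proof -
  have "continuous_on UNIV f" using assms(2) by (rule lipschitz_on_continuous_on)
  then have "f \<in> borel_measurable borel" by (rule borel_measurable_continuous_onI)
  then have fm: "f \<in> borel_measurable \<nu>" by (simp add: measurable_cong_sets[OF doubling_sets[OF \<nu>] refl])
  have Bm: "ball x r \<in> sets \<nu>" by (simp add: doubling_sets[OF \<nu>])
  have Bf: "integrable \<nu> (indicator (ball x r) :: 'a \<Rightarrow> real)"
    using doubling_ball_fmeasurable[OF \<nu>, of x r] by (simp add: fmeasurable_def)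
  have L: "0 \<le> L" using assms(2) by (rule lipschitz_on_nonneg)
  show ?thesis
    unfolding set_integrable_def
  proof (rule integrable_norm_bound)
    show "integrable \<nu> (\<lambda>y. (L * \<bar>r\<bar> + cmod (f x - c)) * indicator (ball x r) y)" using Bf by simp
    show "(\<lambda>y. indicator (ball x r) y *\<^sub>R cmod (f y - c)) \<in> borel_measurable \<nu>" using fm Bm by measurable
    show "norm (indicator (ball x r) y *\<^sub>R cmod (f y - c)) \<le> (L * \<bar>r\<bar> + cmod (f x - c)) * indicator (ball x r) y" for y
    proof (cases "y \<in> ball x r")
      case True
      have "cmod (f y - c) \<le> cmod (f y - f x) + cmod (f x - c)" using norm_triangle_ineq[of "f y - f x" "f x - c"] by simp
      also have "cmod (f y - f x) \<le> L * dist y x" using lipschitz_onD[OF assms(2), of y x] by (simp add: dist_norm)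
      also have "L * dist y x \<le> L * \<bar>r\<bar>" using True L by (intro mult_left_mono) (auto simp: dist_commute)
      finally show ?thesis using True by simp
    qed simp
  qed
qed

text \<open>The contradiction is between two integrals at one small scale. On most of a set where b
  is near w, the convolution u stays near w; the Poincare inequality makes u close in the mean to a
  single c, and one of two essential values w is far from c. Every constant is fixed before the
  scale.\<close>

lemma decay_imp_constant:
  fixes \<mu> \<nu> :: "'a::metric_space measure"
  assumes \<mu>: "doubling_measure \<mu>" and \<nu>: "doubling_measure \<nu>" "ahlfors_regular d \<nu>" and Ai: "A_infinity \<mu> \<nu>"
    and q: "1 \<le> q" "q < d" and pc: "poincare_inequality q \<nu>"
    and b: "locally_integrable \<mu> b" and K: "singular_kernel \<mu> K"
    and nd: "strongly_nondegenerate \<mu> K" and R: "realises_commutator \<mu> K b R"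
    and an: "(\<lambda>n. real n powr (1 / d) * approximation_number \<mu> R n) \<longlonglongrightarrow> 0
         \<or> (limsup (\<lambda>n. ereal (real n powr (1 / d) * approximation_number \<mu> R n)) < \<infinity>
            \<and> liminf (\<lambda>n. ereal (real n powr (1 / d) * approximation_number \<mu> R n)) = 0)"
  shows "\<exists>c. AE x in \<mu>. b x = c"
proof (rule ccontr)
  assume "\<not> ?thesis"
  then obtain w1 w2 where w12: "w1 \<noteq> w2" and wpos: "\<And>r. r > 0 \<Longrightarrow> \<not> (AE x in \<mu>. b x \<notin> ball w1 r)" "\<And>r. r > 0 \<Longrightarrow> \<not> (AE x in \<mu>. b x \<notin> ball w2 r)"
    by (rule nonconstant_two_values) (rule that)
  have bm: "b \<in> borel_measurable \<mu>" by (rule locally_integrable_measurable[OF \<mu> b])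
  have d: "0 < d" using q by simp
  \<comment> \<open>Any c is then at distance at least 5 s1 from w1 or from w2.\<close>
  define s1 where "s1 = dist w1 w2 / 10"
  have s1: "s1 > 0" using w12 by (simp add: s1_def)
  define x0 :: 'a where "x0 = undefined"
  obtain \<rho>1 where \<rho>1: "\<And>\<rho>. \<rho> \<ge> \<rho>1 \<Longrightarrow> 0 < measure \<mu> {x \<in> ball x0 \<rho>. b x \<in> ball w1 s1}"
    using level_set_positive[OF \<mu> bm wpos(1)[OF s1]] by blast
  obtain \<rho>2 where \<rho>2: "\<And>\<rho>. \<rho> \<ge> \<rho>2 \<Longrightarrow> 0 < measure \<mu> {x \<in> ball x0 \<rho>. b x \<in> ball w2 s1}"
    using level_set_positive[OF \<mu> bm wpos(2)[OF s1]] by blast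
  define \<rho> where "\<rho> = max 1 (max \<rho>1 \<rho>2)"
  have \<rho>: "\<rho> > 0" "\<rho> \<ge> \<rho>1" "\<rho> \<ge> \<rho>2" by (auto simp: \<rho>_def)
  define E where "E w = {x \<in> ball x0 \<rho>. b x \<in> ball w s1}" for w
  have Es: "E w \<in> sets borel" for w
  proof -
    have "{x \<in> ball x0 \<rho>. cmod (b x - w) < s1} \<in> sets \<mu>"
      by (rule value_sets(3)[OF bm]) (simp add: doubling_sets[OF \<mu>])
    then show ?thesis by (simp add: E_def doubling_sets[OF \<mu>] dist_norm norm_minus_commute)
  qed
  have Eb: "E w \<subseteq> ball x0 \<rho>" for w by (auto simp: E_def)
  have Em: "0 < measure \<nu> (E w)" if "w \<in> {w1, w2}" for w
  proof (rule A_infinity_positive[OF \<nu> \<mu> Ai Es Eb])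
    show "0 < measure \<mu> (E w)" using that \<rho>1[OF \<rho>(2)] \<rho>2[OF \<rho>(3)] unfolding E_def by blast
  qed
  define m0 where "m0 = min (measure \<nu> (E w1)) (measure \<nu> (E w2))"
  have m0: "m0 > 0" "\<And>w. w \<in> {w1, w2} \<Longrightarrow> m0 \<le> measure \<nu> (E w)" using Em by (auto simp: m0_def)
  obtain \<epsilon> \<delta> where ed: "\<epsilon> > 0" "\<delta> > 0" and rev: "\<And>x r E. r > 0 \<Longrightarrow> E \<in> sets borel \<Longrightarrow>
        measure \<nu> (ball x r - E) \<le> \<delta> * measure \<nu> (ball x r) \<Longrightarrow> \<epsilon> * measure \<mu> (ball x r) < measure \<mu> (ball x r \<inter> E)"
    by (rule A_infinity_reverse[OF \<nu>(1) Ai]) (rule that)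
  have "m0 / 2 > 0" using m0 by simp
  note dens = single_scale_density[OF \<nu> \<nu>(1) Es Eb ed(2) this]
  obtain r1 where r1: "r1 > 0" "\<And>r. 0 < r \<Longrightarrow> r < r1 \<Longrightarrow> \<exists>W\<in>sets borel. measure \<nu> W < m0 / 2 \<and> W \<in> fmeasurable \<nu> \<and>
      (\<forall>x\<in>E w1 - W. measure \<nu> (ball x r - E w1) \<le> \<delta> * measure \<nu> (ball x r))"
    by (rule dens) (rule that)
  obtain r2 where r2: "r2 > 0" "\<And>r. 0 < r \<Longrightarrow> r < r2 \<Longrightarrow> \<exists>W\<in>sets borel. measure \<nu> W < m0 / 2 \<and> W \<in> fmeasurable \<nu> \<and>
      (\<forall>x\<in>E w2 - W. measure \<nu> (ball x r - E w2) \<le> \<delta> * measure \<nu> (ball x r))"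
    by (rule dens) (rule that)
  obtain \<Lambda> Cp where \<Lambda>: "\<Lambda> \<ge> 1" and poin: "\<And>f :: 'a \<Rightarrow> complex. \<And>x r. (\<exists>L. L-lipschitz_on UNIV f) \<Longrightarrow> r > 0 \<Longrightarrow>
          (INF c. average \<nu> (ball x r) (\<lambda>y. cmod (f y - c)))
            \<le> Cp * r * average \<nu> (ball x (\<Lambda> * r)) (\<lambda>y. lower_lip f y powr q) powr (1 / q)"
    using pc unfolding poincare_inequality_def by blast
  obtain C where up: "\<And>(x::'a) r. r > 0 \<Longrightarrow> measure \<nu> (ball x r) \<le> C * r powr d"
    using \<nu>(2) unfolding ahlfors_regular_def by blast
  have C: "C \<ge> 0" using order_trans[OF measure_nonneg up[of 1 x0]] by simp
  obtain k :: "real \<Rightarrow> nat" where k: "\<And>a s J y. finite J \<Longrightarrow> separated s J \<Longrightarrow> 0 < s \<Longrightarrow> 0 < a \<Longrightarrow> card {j \<in> J. dist j (y::'a) < a * s} \<le> k a"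
    by (rule separated_card_bounds[OF \<nu> d]) (rule that)
  define N where "N = real (k 3)"
  define L where "L = N * (N + 1)"
  have NL: "N \<ge> 0" "L \<ge> 0" by (auto simp: N_def L_def)
  \<comment> \<open>The factor 3 serves \<open>ball j (6 * s)\<close>, which lies in
    \<open>ball y (9 * s)\<close> when j is within 3 s of y.\<close>
  obtain D where D: "D \<ge> 1" "\<And>(x::'a) y r R. r > 0 \<Longrightarrow> dist x y + R \<le> 3 * r \<Longrightarrow> measure \<mu> (ball x R) \<le> D * measure \<mu> (ball y r)"
    by (rule doubling_ball_ratio[OF \<mu>, of 3]) (rule that)
  \<comment> \<open>Two tasks: \<open>\<theta> * D < 1/2\<close> makes neighbouring centres
    comparable, and \<open>\<theta> * D < \<epsilon>\<close> makes each exceptional set smaller than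
    the proportion provided by \<open>rev\<close>.\<close>
  define \<theta> where "\<theta> = min 1 \<epsilon> / (4 * D)"
  have \<theta>: "0 < \<theta>" "\<theta> < 1/2" "\<theta> * D < 1/2" "\<theta> * D < \<epsilon>"
  proof -
    show "0 < \<theta>" unfolding \<theta>_def using ed D by simp
    have t: "\<theta> * D = min 1 \<epsilon> / 4" unfolding \<theta>_def using D by simp
    show "\<theta> * D < 1/2" "\<theta> * D < \<epsilon>" unfolding t using ed by (auto simp: min_def)
    have "\<theta> * 1 \<le> \<theta> * D" using D \<open>0 < \<theta>\<close> by (intro mult_left_mono) auto
    then show "\<theta> < 1/2" using \<open>\<theta> * D < 1/2\<close> by simp
  qed
  define V1 where "V1 = measure \<nu> (ball x0 \<rho>)"
  define V2 where "V2 = measure \<nu> (ball x0 (\<Lambda> * \<rho>))"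
  have P: "\<Lambda> * \<rho> > 0" "\<rho> \<le> \<Lambda> * \<rho>" using \<Lambda> \<rho> by auto
  have V12: "V1 > 0" "V2 > 0" unfolding V1_def V2_def using doubling_ball_pos[OF \<nu>(1)] \<rho> P by auto
  \<comment> \<open>None of these constants involves s or J: \<open>k3 * t powr q\<close> will bound
    the average of the q-th power of \<open>lower_lip u\<close>, \<open>k1 * t\<close> the integral
    of \<open>cmod (u y - c)\<close>, and \<open>k2 * t\<close> the contribution of G. The parameter
    t then makes \<open>(k1 + k2) * t\<close> smaller than the lower bound
    \<open>3/2 * (s1 * m0)\<close>.\<close>
  define k3 where "k3 = (L * N) powr q * (C * 3 powr d) / V2"
  define k1 where "k1 = V1 * (\<bar>Cp\<bar> * \<rho> * k3 powr (1/q) + 1)"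
  define k2 where "k2 = s1 powr (1 - q) * N powr q * (C * 3 powr d)"
  have kk: "k3 \<ge> 0" "k1 \<ge> 0" "k2 \<ge> 0" unfolding k1_def k2_def k3_def using C V12 \<rho> NL by auto
  define t where "t = min 1 (s1 * m0 / (k1 + k2 + 1))"
  have t: "0 < t" "t \<le> 1" "(k1 + k2) * t \<le> s1 * m0"
  proof -
    show "0 < t" "t \<le> 1" unfolding t_def using s1 m0 kk by auto
    have "(k1 + k2) * t \<le> (k1 + k2 + 1) * (s1 * m0 / (k1 + k2 + 1))"
      using kk s1 m0 \<open>0 < t\<close> by (intro mult_mono) (auto simp: t_def)
    then show "(k1 + k2) * t \<le> s1 * m0" using kk by simp
  qed
  have tq: "0 < t powr q" "t powr q \<le> t" using t q powr_mono'[of 1 q t] by auto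
  \<comment> \<open>The radius 3 s must be admissible in both density statements, and s < 1 lets
    \<open>s powr q\<close> be dropped.\<close>
  have "0 < min 1 (min r1 r2 / 3)" using r1 r2 by simp
  then obtain s J Z \<kappa> where s: "0 < s" "s < min 1 (min r1 r2 / 3)" and J: "finite J" "separated s J" "J \<subseteq> ball x0 (\<Lambda> * \<rho>)"
    and cov: "\<And>y. y \<in> ball x0 (\<Lambda> * \<rho>) \<Longrightarrow> \<exists>j\<in>J. dist j y < s"
    and \<kappa>: "\<And>j. j \<in> J \<Longrightarrow> 0 < \<kappa> j" and conc: "\<And>j. j \<in> J \<Longrightarrow> concentrated \<mu> \<theta> (ball j (6 * s)) b (Z j) (\<kappa> j)"
    and small: "s powr (d - q) * (\<Sum>j\<in>J. \<kappa> j powr q) < t powr q"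
    by (rule small_oscillation[OF \<mu> \<nu> q b K nd R an \<theta>(1,2) P(1) tq(1)]) (rule that)
  define u where "u = discrete_convolution s J Z"
  obtain Lu where Lu: "Lu-lipschitz_on UNIV u" using discrete_convolution_lipschitz[OF J(1) s(1), of Z] unfolding u_def by blast
  define M where "M y = (\<Sum>j\<in>{j \<in> J. dist j y < 3 * s}. \<kappa> j)" for y
  \<comment> \<open>A combination of indicators, hence easily integrated, that dominates
    \<open>M y powr q\<close> up to the factor \<open>N powr q\<close> because at most N terms are
    present at y.\<close>
  define G where "G y = (\<Sum>j\<in>J. \<kappa> j powr q * indicator (ball j (3 * s)) y)" for y
  have cN: "real (card {j \<in> J. dist j y < 3 * s}) \<le> N" for y
    using k[OF J(1,2) s(1), of 3 y] by (simp add: N_def)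
  have M0: "0 \<le> M y" for y unfolding M_def using \<kappa> by (intro sum_nonneg) (auto intro: less_imp_le)
  have G0: "0 \<le> G y" for y unfolding G_def by (intro sum_nonneg) auto
  have kM: "\<kappa> j \<le> M y" if "j \<in> J" "dist j y < 3 * s" for j y
    unfolding M_def using that J \<kappa> by (intro member_le_sum) (auto intro: less_imp_le)
  have MG: "M y powr q \<le> N powr q * G y" for y
  proof -
    have each: "\<kappa> j \<le> G y powr (1/q)" if j: "j \<in> J" "dist j y < 3 * s" for j
    proof -
      have "\<kappa> j powr q * indicator (ball j (3 * s)) y \<le> G y"
        unfolding G_def using j J by (intro member_le_sum) auto
      then have "(\<kappa> j powr q) powr (1/q) \<le> G y powr (1/q)" using j q by (intro powr_mono2) auto
      then show ?thesis using q \<kappa>[OF j(1)] by (simp add: powr_powr)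
    qed
    have "M y \<le> (\<Sum>j\<in>{j \<in> J. dist j y < 3 * s}. G y powr (1/q))" unfolding M_def by (intro sum_mono each) auto
    also have "\<dots> \<le> N * G y powr (1/q)" using cN[of y] by (simp add: mult_right_mono)
    finally have "M y powr q \<le> (N * G y powr (1/q)) powr q" using M0[of y] q by (intro powr_mono2) auto
    also have "\<dots> = N powr q * G y" using q G0[of y] by (simp add: powr_mult powr_powr)
    finally show ?thesis .
  qed
  have Gi: "integrable \<nu> G"
    unfolding G_def using doubling_ball_fmeasurable[OF \<nu>(1)] by (auto simp: fmeasurable_def)
  have GI: "(LINT y|\<nu>. G y) \<le> C * 3 powr d * s powr q * t powr q"
  proof -
    have "(LINT y|\<nu>. G y) = (\<Sum>j\<in>J. \<kappa> j powr q * measure \<nu> (ball j (3 * s)))"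
      unfolding G_def using doubling_ball_fmeasurable[OF \<nu>(1)]
      by (subst Bochner_Integration.integral_sum) (auto simp: fmeasurable_def doubling_space[OF \<nu>(1)])
    also have "\<dots> \<le> (\<Sum>j\<in>J. \<kappa> j powr q * (C * (3 * s) powr d))"
      using s by (intro sum_mono mult_left_mono up) auto
    also have "\<dots> = C * 3 powr d * (s powr d * (\<Sum>j\<in>J. \<kappa> j powr q))"
      by (simp add: powr_mult mult_ac flip: sum_distrib_left sum_distrib_right)
    also have "s powr d = s powr q * s powr (d - q)" by (simp flip: powr_add)
    also have "C * 3 powr d * (s powr q * s powr (d - q) * (\<Sum>j\<in>J. \<kappa> j powr q)) \<le> C * 3 powr d * (s powr q * t powr q)"
      unfolding mult.assoc[of "s powr q"] using small C by (intro mult_left_mono) auto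
    finally show ?thesis by (simp add: mult.assoc)
  qed
  have D3: "measure \<mu> (ball j (6 * s)) \<le> D * measure \<mu> (ball y (3 * s))" if "dist j y < 3 * s" for j y
    by (rule D(2)) (use that s in auto)
  have lip: "0 \<le> lower_lip u y \<and> lower_lip u y \<le> L / s * M y" if y: "y \<in> ball x0 (\<Lambda> * \<rho>)" for y
  proof -
    obtain i where i: "i \<in> J" "dist i y < s" using cov[OF y] by blast
    have i3: "dist i y < 3 * s" using i s by simp
    have c3: "card {j \<in> J. dist j y < 3 * s} \<le> k 3" using k[OF J(1,2) s(1), of 3 y] by simp
    have cl: "cmod (Z j - Z i) \<le> \<kappa> j + \<kappa> i" if "j \<in> J" "dist j y < 3 * s" for j
      by (rule concentrated_values_close[OF \<mu> bm _ \<theta>(3) s(1) D3[OF i3] D3[OF that(2)] i3 that(2) conc[OF i(1)] conc[OF that(1)]])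
        (use \<theta> in simp)
    have \<kappa>0: "0 \<le> \<kappa> j" if "j \<in> J" for j using \<kappa>[OF that] by simp
    show ?thesis
      using lower_lip_discrete_convolution[where Z=Z and \<kappa>=\<kappa>, OF J(1) s(1) i c3 \<kappa>0 cl] unfolding u_def M_def L_def N_def by blast
  qed
  have lipG: "lower_lip u y powr q \<le> (L * N / s) powr q * G y" if y: "y \<in> ball x0 (\<Lambda> * \<rho>)" for y
  proof -
    have "lower_lip u y powr q \<le> (L / s * M y) powr q" using lip[OF y] q by (intro powr_mono2) auto
    also have "\<dots> = (L / s) powr q * M y powr q" by (rule powr_mult)
    also have "\<dots> \<le> (L / s) powr q * (N powr q * G y)" by (intro mult_left_mono MG) simp
    also have "\<dots> = (L / s * N) powr q * G y" by (simp only: powr_mult mult.assoc)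
    finally show ?thesis by simp
  qed
  have avg: "0 \<le> average \<nu> (ball x0 (\<Lambda> * \<rho>)) (\<lambda>y. lower_lip u y powr q)"
    "average \<nu> (ball x0 (\<Lambda> * \<rho>)) (\<lambda>y. lower_lip u y powr q) \<le> k3 * t powr q"
  proof -
    have "(LINT y:ball x0 (\<Lambda> * \<rho>)|\<nu>. lower_lip u y powr q) \<le> (LINT y|\<nu>. (L * N / s) powr q * G y)"
      unfolding set_lebesgue_integral_def
    \<comment> \<open>This comparison asks for integrability of the majorant; by convention a
      function that is not integrable has integral 0.\<close>
    proof (rule integral_mono')
      show "integrable \<nu> (\<lambda>y. (L * N / s) powr q * G y)" using Gi by simp
      show "indicator (ball x0 (\<Lambda> * \<rho>)) y *\<^sub>R lower_lip u y powr q \<le> (L * N / s) powr q * G y" for y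
        using lipG[of y] G0[of y] by (cases "y \<in> ball x0 (\<Lambda> * \<rho>)") auto
    qed (use G0 in auto)
    also have "\<dots> \<le> (L * N / s) powr q * (C * 3 powr d * s powr q * t powr q)"
      using GI by (simp add: mult_left_mono)
    also have "\<dots> = (L * N / s * s) powr q * (C * 3 powr d) * t powr q" by (simp only: powr_mult mult_ac)
    also have "\<dots> = (L * N) powr q * (C * 3 powr d) * t powr q" using s by simp
    finally have "average \<nu> (ball x0 (\<Lambda> * \<rho>)) (\<lambda>y. lower_lip u y powr q) \<le> (L * N) powr q * (C * 3 powr d) * t powr q / V2"
      unfolding average_def V2_def by (rule divide_right_mono) simp
    then show "average \<nu> (ball x0 (\<Lambda> * \<rho>)) (\<lambda>y. lower_lip u y powr q) \<le> k3 * t powr q" by (simp add: k3_def)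
    show "0 \<le> average \<nu> (ball x0 (\<Lambda> * \<rho>)) (\<lambda>y. lower_lip u y powr q)"
      unfolding average_def set_lebesgue_integral_def by (intro divide_nonneg_nonneg integral_nonneg) auto
  qed
  have "(INF c. average \<nu> (ball x0 \<rho>) (\<lambda>y. cmod (u y - c)))
      \<le> Cp * \<rho> * average \<nu> (ball x0 (\<Lambda> * \<rho>)) (\<lambda>y. lower_lip u y powr q) powr (1 / q)"
    by (rule poin) (use Lu \<rho> in auto)
  also have "\<dots> \<le> \<bar>Cp\<bar> * \<rho> * (k3 * t powr q) powr (1 / q)"
    using avg q \<rho> by (intro mult_mono powr_mono2) auto
  also have "\<dots> = \<bar>Cp\<bar> * \<rho> * k3 powr (1/q) * t" using q t by (simp add: powr_mult powr_powr)
  \<comment> \<open>The extra t makes the bound strict, since the infimum over c need not be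
    attained.\<close>
  also have "\<dots> < \<bar>Cp\<bar> * \<rho> * k3 powr (1/q) * t + t" using t by simp
  finally obtain c where c: "average \<nu> (ball x0 \<rho>) (\<lambda>y. cmod (u y - c)) < \<bar>Cp\<bar> * \<rho> * k3 powr (1/q) * t + t"
    using cInf_lessD[of "range (\<lambda>c. average \<nu> (ball x0 \<rho>) (\<lambda>y. cmod (u y - c)))"] by blast
  have I1: "(LINT y:ball x0 \<rho>|\<nu>. cmod (u y - c)) \<le> k1 * t"
  proof -
    have "(LINT y:ball x0 \<rho>|\<nu>. cmod (u y - c)) / V1 < (\<bar>Cp\<bar> * \<rho> * k3 powr (1/q) + 1) * t"
      using c unfolding average_def V1_def[symmetric] by (simp add: distrib_right)
    then show ?thesis using V12 by (simp add: k1_def pos_divide_less_eq mult_ac less_imp_le)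
  qed
  have I2: "s1 powr (1 - q) * N powr q * (LINT y|\<nu>. G y) \<le> k2 * t"
  proof -
    have "s powr q \<le> 1" using s q powr_mono2[of q s 1] by simp
    then have "s powr q * t powr q \<le> 1 * t" using tq by (intro mult_mono) auto
    then have "C * 3 powr d * (s powr q * t powr q) \<le> C * 3 powr d * t" using C by (intro mult_left_mono) auto
    then have "(LINT y|\<nu>. G y) \<le> C * 3 powr d * t" using GI by (simp add: mult.assoc)
    then have "s1 powr (1 - q) * N powr q * (LINT y|\<nu>. G y) \<le> s1 powr (1 - q) * N powr q * (C * 3 powr d * t)"
      by (intro mult_left_mono) auto
    then show ?thesis by (simp add: k2_def mult.assoc)
  qed
  have "dist w1 w2 \<le> dist w1 c + dist c w2" by (rule dist_triangle)
  then have "5 * s1 \<le> dist w1 c \<or> 5 * s1 \<le> dist w2 c" using s1_def by (simp add: dist_commute) linarith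
  then obtain w where w: "w \<in> {w1, w2}" "5 * s1 \<le> cmod (w - c)" by (auto simp: dist_norm)
  have s3: "0 < 3 * s" "3 * s < r1" "3 * s < r2" using s by auto
  obtain W where W: "W \<in> sets borel" "measure \<nu> W < m0 / 2" "W \<in> fmeasurable \<nu>"
    "\<And>x. x \<in> E w - W \<Longrightarrow> measure \<nu> (ball x (3 * s) - E w) \<le> \<delta> * measure \<nu> (ball x (3 * s))"
    using r1(2)[OF s3(1,2)] r2(2)[OF s3(1,3)] w(1) by blast
  \<comment> \<open>On the good part of \<open>E w\<close>, u is within s1 + M y of w, which is 5 s1
    away from c. What \<open>M y\<close> costs beyond s1 is charged to G, as in Chebyshev's
    inequality.\<close>
  have low: "3 * s1 * indicator (E w - W) y \<le> indicator (ball x0 \<rho>) y *\<^sub>R cmod (u y - c) + s1 powr (1 - q) * N powr q * G y" for y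
  proof (cases "y \<in> E w - W")
    case False
    then show ?thesis using G0[of y] by simp
  next
    case True
    have yB: "y \<in> ball x0 \<rho>" using True Eb by blast
    then have "y \<in> ball x0 (\<Lambda> * \<rho>)" using P by auto
    then obtain i where i: "i \<in> J" "dist i y < s" using cov by blast
    \<comment> \<open>At y the set \<open>E w\<close> is dense for \<nu> at radius 3 s; the reversed
      relation makes this a \<mu> proportion larger than an exceptional set can absorb.\<close>
    have meet: "\<epsilon> * measure \<mu> (ball y (3 * s)) < measure \<mu> (ball y (3 * s) \<inter> E w)"
      using W(4)[OF True] s3 Es by (intro rev) auto
    have near: "cmod (Z j - w) \<le> s1 + M y" if j: "j \<in> J" "dist j y < 2 * s" for j
    proof -
      have j3: "dist j y < 3 * s" using j s by simp
      have "\<exists>x\<in>ball y (3 * s) \<inter> E w. cmod (b x - Z j) \<le> \<kappa> j"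
      proof (rule concentrated_meets[OF \<mu> bm _ D3[OF j3] conc[OF j(1)]])
        show "0 \<le> \<theta>" using \<theta> by simp
        show "ball y (3 * s) \<inter> E w \<in> sets borel" using Es by auto
        have "ball y (3 * s) \<subseteq> ball j (6 * s)" using j3 by (intro ball_subset_ballI) (simp add: dist_commute)
        then show "ball y (3 * s) \<inter> E w \<subseteq> ball j (6 * s)" by blast
        have "\<theta> * D * measure \<mu> (ball y (3 * s)) \<le> \<epsilon> * measure \<mu> (ball y (3 * s))"
          using \<theta>(4) by (intro mult_right_mono) auto
        then show "\<theta> * D * measure \<mu> (ball y (3 * s)) < measure \<mu> (ball y (3 * s) \<inter> E w)" using meet by linarith
      qed
      then obtain x where x: "x \<in> E w" "cmod (b x - Z j) \<le> \<kappa> j" by blast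
      have "cmod (b x - w) < s1" using x(1) by (simp add: E_def dist_norm norm_minus_commute)
      then show ?thesis using x(2) kM[OF j(1) j3] norm_triangle_ineq4[of "b x - w" "b x - Z j"] by simp
    qed
    have "cmod (u y - w) \<le> s1 + M y"
      unfolding u_def by (rule discrete_convolution_near[OF J(1) s(1) i(1) _ near]) (use i in auto)
    then have 1: "4 * s1 - M y \<le> cmod (u y - c)"
      using w(2) norm_triangle_ineq[of "w - u y" "u y - c"] by (simp add: norm_minus_commute)
    \<comment> \<open>Above s1 the factor \<open>(M y / s1) powr (q - 1)\<close> is at least
      1.\<close>
    have 2: "M y \<le> s1 + s1 powr (1 - q) * M y powr q"
    proof (cases "M y \<le> s1")
      case True then show ?thesis by (simp add: add_increasing2)
    next
      case False
      then have Mp: "0 < M y" using s1 by simp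
      have "M y powr (1 - q) \<le> s1 powr (1 - q)" using False s1 q by (intro powr_mono2') auto
      then have "M y powr (1 - q) * M y powr q \<le> s1 powr (1 - q) * M y powr q" by (intro mult_right_mono) auto
      moreover have "M y powr (1 - q) * M y powr q = M y" unfolding powr_add[symmetric] using Mp by simp
      ultimately show ?thesis using s1 by linarith
    qed
    have "s1 powr (1 - q) * M y powr q \<le> s1 powr (1 - q) * (N powr q * G y)" by (intro mult_left_mono MG) simp
    then show ?thesis using 1 2 True yB by (simp add: mult.assoc)
  qed
  have EW: "E w - W \<in> fmeasurable \<nu>"
    using Es W(1) Eb by (intro doubling_subset_fmeasurable[OF \<nu>(1), where x=x0 and r=\<rho>]) auto
  have EWi: "integrable \<nu> (indicator (E w - W) :: 'a \<Rightarrow> real)" using EW by (simp add: fmeasurable_def)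
  have ui: "integrable \<nu> (\<lambda>y. indicator (ball x0 \<rho>) y *\<^sub>R cmod (u y - c))"
    using lipschitz_set_integrable[OF \<nu>(1) Lu, of x0 \<rho> c] unfolding set_integrable_def .
  have "3 * s1 * measure \<nu> (E w - W) = (LINT y|\<nu>. 3 * s1 * indicator (E w - W) y)"
    by (simp add: doubling_space[OF \<nu>(1)])
  also have "\<dots> \<le> (LINT y|\<nu>. indicator (ball x0 \<rho>) y *\<^sub>R cmod (u y - c) + s1 powr (1 - q) * N powr q * G y)"
    using EWi ui Gi by (intro integral_mono low) auto
  also have "\<dots> = (LINT y:ball x0 \<rho>|\<nu>. cmod (u y - c)) + s1 powr (1 - q) * N powr q * (LINT y|\<nu>. G y)"
    using ui Gi unfolding set_lebesgue_integral_def by (subst Bochner_Integration.integral_add) auto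
  also have "\<dots> \<le> (k1 + k2) * t" using I1 I2 by (simp add: distrib_right)
  also have "\<dots> \<le> s1 * m0" by (rule t)
  finally have fin1: "3 * s1 * measure \<nu> (E w - W) \<le> s1 * m0" .
  have "measure \<nu> (E w) \<le> measure \<nu> ((E w - W) \<union> W)"
    using Es W(3) EW by (intro measure_mono_fmeasurable fmeasurable.Un) (auto simp: doubling_sets[OF \<nu>(1)])
  also have "\<dots> \<le> measure \<nu> (E w - W) + measure \<nu> W"
    using EW W(3) by (intro measure_Un_le) (auto simp: fmeasurable_def)
  finally have "m0 / 2 < measure \<nu> (E w - W)" using m0(2)[OF w(1)] W(2) by linarith
  then have "3 * s1 * (m0 / 2) < 3 * s1 * measure \<nu> (E w - W)" using s1 by (intro mult_strict_left_mono) auto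
  then have "3 * s1 * (m0 / 2) < s1 * m0" using fin1 by (rule less_le_trans)
  then have "3/2 * (s1 * m0) < s1 * m0" by (simp only: times_divide_eq_left times_divide_eq_right mult.assoc)
  then show False using mult_pos_pos[OF s1 m0(1)] by linarith
qed

theorem corollary1p7:
  fixes \<mu> \<nu> :: "'a::metric_space measure"
    and d q :: real
    and D :: "('a \<Rightarrow> complex) set"
    and T R :: "('a \<Rightarrow> complex) \<Rightarrow> 'a \<Rightarrow> complex"
    and K :: "'a \<Rightarrow> 'a \<Rightarrow> complex"
    and b :: "'a \<Rightarrow> complex"
  assumes "doubling_measure \<mu>" and "doubling_measure \<nu>" and "A_infinity \<mu> \<nu>"
    and "1 < d" and "ahlfors_regular d \<nu>"
    and "1 \<le> q" and "q < d" and "poincare_inequality q \<nu>"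
    and "singular_integral \<mu> D T K" and "strongly_nondegenerate \<mu> K"
    and "locally_integrable \<mu> b"
    and "(bounded_on_L2 \<mu> D T \<and> (\<exists>\<eta>. \<eta> > max (1 - d / 2) 0 \<and> hoelder_regular \<eta> \<mu> K))
         \<or> (\<mu> = \<nu> \<and> d > 2)"
    and "realises_commutator \<mu> K b R"
    and "(\<lambda>n. real n powr (1 / d) * approximation_number \<mu> R n) \<longlonglongrightarrow> 0
         \<or> (limsup (\<lambda>n. ereal (real n powr (1 / d) * approximation_number \<mu> R n)) < \<infinity>
            \<and> liminf (\<lambda>n. ereal (real n powr (1 / d) * approximation_number \<mu> R n)) = 0)"
  shows "\<exists>c. AE x in \<mu>. b x = c"
  by (rule decay_imp_constant[OF assms(1,2,5,3,6,7,8,11) _ assms(10,13,14)])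
    (use assms(9) in \<open>simp add: singular_integral_def\<close>)

end
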